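(* Let $X$ be a Banach space, and let $(T(t))_{t \in \mathbb R}$ be a $C_0$-group on $X$ with generator $A$, such that $\|T(t)\|\le M (1 + |t|^a)$ for all $t\in\mathbb R$, for some constant $M$ and some $a \in [0,2]$. Then for any closed $F \subset \mathbb R$ $$X(F)= \Bigl\{x \in X: \lim_{\alpha \to 0+ }D(\alpha +i\beta)x=0 \text{ for every } \beta \in \mathbb R \setminus F\Bigr\}.$$ If moreover $X$ is reflexive, $\sigma_p(A)=\emptyset$ and $a \in[0,2)$, then for any closed $F\subset\mathbb R$ $$X(F)= \Bigl\{x \in X: \sup_{\alpha > 0 }\|D(\alpha +i\beta)x\|<\infty \text{ for every } \beta \in \mathbb R \setminus F\Bigr\}.$$
   Context: $X$ is a complex Banach space. $R(\lambda,A)=(\lambda-A)^{-1}$ is the resolvent of $A$; under the polynomial growth assumption on the group it is defined at least on $\mathbb C\setminus i\mathbb R$. For $\alpha\neq 0$, $\beta\in\mathbb R$, $$D(\alpha+i\beta)=R(\alpha+i\beta,A)-R(-\alpha+i\beta,A).$$ The local spectrum $\sigma(x)$ of $x\in X$ is the complement of the set of points $\lambda_0\in\mathbb C$ such that the local resolvent $\lambda\mapsto R(\lambda,A)x$ is analytic in (i.e. extends analytically to) a neighborhood of $\lambda_0$. For closed $F\subset\mathbb R$, the spectral subspace is $X(F)=\{x\in X:\sigma(x)\subset iF\}$. $\sigma_p(A)$ is the point spectrum (set of eigenvalues) of $A$. Limits of vectors are in the norm of $X$. *)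

theory Defs
  imports "HOL-Analysis.Analysis"
begin

class complex_normed_vector = real_normed_vector +
  fixes scaleC :: "complex \<Rightarrow> 'a \<Rightarrow> 'a" (infixr "*\<^sub>C" 75)
  assumes scaleC_add_right: "c *\<^sub>C (x + y) = c *\<^sub>C x + c *\<^sub>C y"
    and scaleC_add_left: "(c + d) *\<^sub>C x = c *\<^sub>C x + d *\<^sub>C x"
    and scaleC_scaleC: "c *\<^sub>C (d *\<^sub>C x) = (c * d) *\<^sub>C x"
    and scaleC_of_real: "complex_of_real r *\<^sub>C x = r *\<^sub>R x"
    and norm_scaleC: "norm (c *\<^sub>C x) = cmod c * norm x"

class complex_banach = complex_normed_vector + complete_space

subclass (in complex_banach) banach ..

instantiation complex :: complex_banach
begin

definition scaleC_complex_def: "scaleC c (x :: complex) = c * x"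

instance
  by standard
    (simp_all add: scaleC_complex_def algebra_simps norm_mult scaleR_conv_of_real)

end

definition bounded_clinear ::
    "('a::complex_normed_vector \<Rightarrow> 'b::complex_normed_vector) \<Rightarrow> bool" where
  "bounded_clinear f \<longleftrightarrow> bounded_linear f \<and> (\<forall>c x. f (c *\<^sub>C x) = c *\<^sub>C f x)"

text \<open>Reflexivity: every bounded complex-linear functional \<open>\<phi>\<close> on the dual (the bounded
  complex-linear functionals with the operator norm) is evaluation at a point. The functional
  \<open>\<phi>\<close> is a total function of which only the values on the dual matter.\<close>

definition reflexive_space :: "'a::complex_banach itself \<Rightarrow> bool" where
  "reflexive_space _ \<longleftrightarrow>
    (\<forall>\<phi> :: ('a \<Rightarrow> complex) \<Rightarrow> complex.
      (\<forall>f g. bounded_clinear f \<longrightarrow> bounded_clinear g \<longrightarrow> \<phi> (\<lambda>x. f x + g x) = \<phi> f + \<phi> g) \<longrightarrow>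
      (\<forall>c f. bounded_clinear f \<longrightarrow> \<phi> (\<lambda>x. c * f x) = c * \<phi> f) \<longrightarrow>
      (\<exists>K. \<forall>f. bounded_clinear f \<longrightarrow> cmod (\<phi> f) \<le> K * onorm f) \<longrightarrow>
      (\<exists>x. \<forall>f. bounded_clinear f \<longrightarrow> \<phi> f = f x))"

definition C0_group :: "(real \<Rightarrow> 'a::complex_banach \<Rightarrow> 'a) \<Rightarrow> bool" where
  "C0_group T \<longleftrightarrow>
    (\<forall>t. bounded_clinear (T t)) \<and>
    T 0 = id \<and>
    (\<forall>s t. T (s + t) = T s \<circ> T t) \<and>
    (\<forall>x. continuous_on UNIV (\<lambda>t. T t x))"

text \<open>An unbounded operator is a partial map; its domain is \<^const>\<open>dom\<close>.\<close>

definition generator :: "(real \<Rightarrow> 'a::complex_banach \<Rightarrow> 'a) \<Rightarrow> 'a \<rightharpoonup> 'a" where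
  "generator T x =
    (if \<exists>y. ((\<lambda>h. (T h x - x) /\<^sub>R h) \<longlongrightarrow> y) (at 0)
     then Some (Lim (at 0) (\<lambda>h. (T h x - x) /\<^sub>R h)) else None)"

text \<open>The value of \<open>resolvent A \<mu>\<close> is meaningful only for \<open>\<mu>\<close> in the resolvent set.\<close>

definition resolvent :: "('a::complex_banach \<rightharpoonup> 'a) \<Rightarrow> complex \<Rightarrow> 'a \<Rightarrow> 'a" where
  "resolvent A \<mu> = inv_into (dom A) (\<lambda>x. \<mu> *\<^sub>C x - the (A x))"

definition resolvent_set :: "('a::complex_banach \<rightharpoonup> 'a) \<Rightarrow> complex set" where
  "resolvent_set A =
    {\<mu>. bij_betw (\<lambda>x. \<mu> *\<^sub>C x - the (A x)) (dom A) UNIV \<and> bounded_clinear (resolvent A \<mu>)}"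

definition point_spectrum :: "('a::complex_banach \<rightharpoonup> 'a) \<Rightarrow> complex set" where
  "point_spectrum A = {\<mu>. \<exists>x. x \<noteq> 0 \<and> A x = Some (\<mu> *\<^sub>C x)}"

text \<open>\<^const>\<open>holomorphic_on\<close> covers only scalar-valued functions, hence a vector-valued version.
  It is used on open sets only, where it is the same as being analytic.\<close>

definition vholomorphic_on ::
    "(complex \<Rightarrow> 'a::complex_banach) \<Rightarrow> complex set \<Rightarrow> bool" where
  "vholomorphic_on f U \<longleftrightarrow>
    (\<forall>z\<in>U. \<exists>d. (f has_derivative (\<lambda>h. h *\<^sub>C d)) (at z within U))"

definition local_spectrum :: "('a::complex_banach \<rightharpoonup> 'a) \<Rightarrow> 'a \<Rightarrow> complex set" where
  "local_spectrum A x =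
    - {\<mu>\<^sub>0. \<exists>U g. open U \<and> \<mu>\<^sub>0 \<in> U \<and> vholomorphic_on g U \<and>
            (\<forall>\<mu> \<in> U \<inter> resolvent_set A. g \<mu> = resolvent A \<mu> x)}"

definition spectral_subspace :: "('a::complex_banach \<rightharpoonup> 'a) \<Rightarrow> real set \<Rightarrow> 'a set" where
  "spectral_subspace A F = {x. local_spectrum A x \<subseteq> (\<lambda>t. \<i> * complex_of_real t) ` F}"

text \<open>\<open>resolvent_jump A \<alpha> \<beta>\<close> is the operator \<open>D(\<alpha> + i\<beta>)\<close>.\<close>

definition resolvent_jump ::
    "('a::complex_banach \<rightharpoonup> 'a) \<Rightarrow> real \<Rightarrow> real \<Rightarrow> 'a \<Rightarrow> 'a" where
  "resolvent_jump A \<alpha> \<beta> x = resolvent A (Complex \<alpha> \<beta>) x - resolvent A (Complex (- \<alpha>) \<beta>) x"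

end

theory Submission
  imports Defs "HOL-Complex_Analysis.Complex_Analysis"
begin

text \<open>
  For \<open>\<alpha> > 0\<close> and a functional \<open>\<phi>\<close>, the function \<open>u(\<alpha> + i\<beta>) = \<phi> (D(\<alpha> + i\<beta>) x)\<close> is harmonic in the
  right half-plane: it is the difference of the local resolvent and of its mirror image in the
  imaginary axis. If the local resolvent extends across \<open>i\<beta>\<close>, then \<open>u\<close> vanishes there by continuity. The
  content of the theorem is the converse, a uniqueness theorem for harmonic functions: vanishing of
  \<open>D(\<alpha> + i\<beta>) x\<close> as \<open>\<alpha> \<rightarrow> 0\<close>, for each \<open>\<beta>\<close> separately and with no uniformity, has to produce an
  analytic continuation.

  For general harmonic functions this fails. The function \<open>\<alpha>\<beta> / (\<alpha>\<^sup>2 + \<beta>\<^sup>2)\<^sup>2\<close> tends to zero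
  along every horizontal line, and yet it is not zero; it is of size \<open>r\<^sup>-\<^sup>2\<close> at distance \<open>r\<close> from the origin.
  This is the critical growth. The hypothesis on the group bounds the resolvent by \<open>O(\<alpha>\<^sup>-\<^sup>a\<^sup>-\<^sup>1)\<close>, which exceeds
  it when \<open>a > 1\<close>. One power of \<open>\<alpha>\<close> is gained from the operators: the resolvent identity
  expresses \<open>D(\<alpha> + i(\<beta> + s)) x\<close> through \<open>D(\<alpha> + i\<beta>) x\<close>, and for \<open>|s| \<le> 3\<alpha>\<close> the operator that
  relates them has norm \<open>O(\<alpha>\<^sup>-\<^sup>a)\<close> (\<open>jump_in_cone\<close>). Hence \<open>D(\<lambda>) x\<close> is \<open>o(r\<^sup>-\<^sup>2)\<close> in a cone
  with vertex \<open>i\<beta>\<close> as soon as \<open>\<alpha>\<^sup>2\<^sup>-\<^sup>a \<parallel>D(\<alpha> + i\<beta>) x\<parallel> \<rightarrow> 0\<close>.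

  Suppose now that the local spectrum meets \<open>i\<beta>\<close> for some \<open>\<beta>\<close> outside \<open>F\<close>. By the Baire category
  theorem there is a segment around some point of the spectrum, disjoint from \<open>iF\<close>, such that
  \<open>D(\<alpha> + i\<beta>) x\<close> is bounded, uniformly in \<open>0 < \<alpha> \<le> 1\<close>, for all spectral points \<open>i\<beta>\<close> in the segment. The
  rest of the segment consists of gaps. Over a gap, \<open>u\<close> is bounded on the two horizontal sides of a strip and
  vanishes on the gap, and a Phragmen-Lindeloef argument at the two corners (\<open>corner_estimate\<close>,
  \<open>strip_bound\<close>), for which \<open>o(r\<^sup>-\<^sup>2)\<close> is exactly what is needed, bounds it inside with the same
  constant. So the jump is bounded over the whole segment, and a bounded harmonic function
  with zero radial limits is continued by reflection, because dominated convergence applies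
  (\<open>reflection_extension\<close>). The continuations for the single functionals are uniformly bounded, and
  they are assembled to a continuation of the vector-valued local resolvent
  (\<open>regular_if_jump_bounded\<close>). Hence the segment contains no point of the local spectrum, a contradiction.

  For the second equality, let \<open>D(\<alpha> + i\<beta>) x\<close> be bounded in \<open>\<alpha>\<close>. As \<open>((A - i\<beta>)\<^sup>2 - \<alpha>\<^sup>2) D(\<alpha> + i\<beta>) x = -2\<alpha>x\<close>,
  each weak cluster point \<open>z\<close> satisfies \<open>(A - i\<beta>)\<^sup>2 z = 0\<close>, so \<open>z = 0\<close> when there are no eigenvalues.
  In a reflexive space this means that the jump tends to zero weakly
  (\<open>jump_weakly_tendsto_0\<close>). This suffices for dominated convergence, and the condition
  \<open>\<alpha>\<^sup>2\<^sup>-\<^sup>a \<parallel>D(\<alpha> + i\<beta>) x\<parallel> \<rightarrow> 0\<close> follows from \<open>a < 2\<close>.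
\<close>

section \<open>Functionals that attain the norm\<close>

definition sublinear :: "('a::real_vector \<Rightarrow> real) \<Rightarrow> bool" where
  "sublinear p \<longleftrightarrow> (\<forall>x y. p (x + y) \<le> p x + p y) \<and> (\<forall>t x. 0 \<le> t \<longrightarrow> p (t *\<^sub>R x) = t * p x)"

lemma sublinear_add: "sublinear p \<Longrightarrow> p (x + y) \<le> p x + p y"
  by (simp add: sublinear_def)

lemma sublinear_scale: "sublinear p \<Longrightarrow> 0 \<le> t \<Longrightarrow> p (t *\<^sub>R x) = t * p x"
  by (simp add: sublinear_def)

lemma sublinear_0: "sublinear p \<Longrightarrow> p 0 = 0"
  using sublinear_scale[of p 0 0] by simp

lemma sublinear_minus: "sublinear p \<Longrightarrow> - p (- x) \<le> p x"
  using sublinear_add[of p x "-x"] sublinear_0[of p] by simp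

text \<open>
  The greatest sublinear \<open>p' \<le> p\<close> with \<open>p' (- y) \<le> - p y\<close>; such a functional is linear on the line through \<open>y\<close>.
\<close>

definition straighten :: "('a::real_vector \<Rightarrow> real) \<Rightarrow> 'a \<Rightarrow> 'a \<Rightarrow> real" where
  "straighten p y w = (INF t\<in>{0..}. p (w + t *\<^sub>R y) - t * p y)"

lemma straighten_bdd:
  assumes "sublinear p"
  shows "bdd_below ((\<lambda>t. p (w + t *\<^sub>R y) - t * p y) ` {0..})"
proof (rule bdd_belowI2)
  fix t :: real assume "t \<in> {0..}"
  then show "- p (- w) \<le> p (w + t *\<^sub>R y) - t * p y"
    using sublinear_add[OF assms, of "w + t *\<^sub>R y" "- w"] sublinear_scale[OF assms, of t y] by simp
qed

lemma straighten_le: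
  assumes "sublinear p" "0 \<le> t"
  shows "straighten p y w \<le> p (w + t *\<^sub>R y) - t * p y"
  unfolding straighten_def by (rule cINF_lower[OF straighten_bdd[OF assms(1)]]) (use assms in auto)

lemma straighten_ge:
  assumes "\<And>t. 0 \<le> t \<Longrightarrow> m \<le> p (w + t *\<^sub>R y) - t * p y"
  shows "m \<le> straighten p y w"
  unfolding straighten_def by (rule cINF_greatest) (use assms in auto)

lemma sublinear_straighten:
  assumes p: "sublinear p"
  shows "sublinear (straighten p y)"
proof -
  have add: "straighten p y (v + w) \<le> straighten p y v + straighten p y w" for v w
  proof -
    have "straighten p y (v + w) - straighten p y v \<le> p (w + t *\<^sub>R y) - t * p y" if t: "0 \<le> t" for t
    proof -
      have "straighten p y (v + w) - (p (w + t *\<^sub>R y) - t * p y) \<le> p (v + s *\<^sub>R y) - s * p y"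
        if s: "0 \<le> s" for s
      proof -
        have "straighten p y (v + w) \<le> p (v + w + (s + t) *\<^sub>R y) - (s + t) * p y"
          using s t by (intro straighten_le p) auto
        also have "v + w + (s + t) *\<^sub>R y = (v + s *\<^sub>R y) + (w + t *\<^sub>R y)"
          by (simp add: algebra_simps)
        also have "p \<dots> \<le> p (v + s *\<^sub>R y) + p (w + t *\<^sub>R y)"
          by (rule sublinear_add[OF p])
        finally show ?thesis by (simp add: algebra_simps)
      qed
      then have "straighten p y (v + w) - (p (w + t *\<^sub>R y) - t * p y) \<le> straighten p y v"
        by (rule straighten_ge)
      then show ?thesis by simp
    qed
    then have "straighten p y (v + w) - straighten p y v \<le> straighten p y w"
      by (rule straighten_ge)
    then show ?thesis by simp
  qed
  have scale: "straighten p y (s *\<^sub>R w) \<le> s * straighten p y w" if s: "0 < s" for s w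
  proof -
    have "straighten p y (s *\<^sub>R w) / s \<le> straighten p y w"
    proof (rule straighten_ge)
      fix t :: real assume t: "0 \<le> t"
      have "straighten p y (s *\<^sub>R w) \<le> p (s *\<^sub>R w + (s * t) *\<^sub>R y) - (s * t) * p y"
        using s t by (intro straighten_le p) auto
      also have "s *\<^sub>R w + (s * t) *\<^sub>R y = s *\<^sub>R (w + t *\<^sub>R y)"
        by (simp add: algebra_simps)
      also have "p \<dots> = s * p (w + t *\<^sub>R y)"
        using s by (simp add: sublinear_scale[OF p])
      finally show "straighten p y (s *\<^sub>R w) / s \<le> p (w + t *\<^sub>R y) - t * p y"
        using s by (simp add: field_simps)
    qed
    then show ?thesis using s by (simp add: field_simps)
  qed
  have scale0: "straighten p y 0 = 0"
  proof (rule antisym)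
    show "straighten p y 0 \<le> 0"
      using straighten_le[OF p, of 0 y 0] by (simp add: sublinear_0[OF p])
    show "0 \<le> straighten p y 0"
      by (rule straighten_ge) (simp add: sublinear_scale[OF p])
  qed
  have "straighten p y (s *\<^sub>R w) = s * straighten p y w" if s: "0 \<le> s" for s w
  proof (cases "s = 0")
    case False
    then have "0 < s" using s by simp
    then show ?thesis
      using scale[of s w] scale[of "inverse s" "s *\<^sub>R w"] by (simp add: field_simps)
  qed (simp add: scale0)
  with add show ?thesis by (auto simp: sublinear_def)
qed

text \<open>
  A minimal sublinear functional cannot be lowered by \<^const>\<open>straighten\<close>, and comparing it
  with its own straightening at \<open>t = 1\<close> gives superadditivity.
\<close>

lemma minimal_sublinear_additive:
  assumes p: "sublinear p"
    and minimal: "\<And>p'. sublinear p' \<Longrightarrow> (\<And>w. p' w \<le> p w) \<Longrightarrow> p' = p"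
  shows "p (v + w) = p v + p w"
proof (rule antisym)
  have "straighten p w = p"
    by (rule minimal[OF sublinear_straighten[OF p]]) (use straighten_le[OF p, of 0 w] in simp)
  then show "p v + p w \<le> p (v + w)"
    using straighten_le[OF p, of 1 w v] by simp
qed (rule sublinear_add[OF p])

text \<open>
  Zorn's lemma: the pointwise infimum of a chain is again sublinear. It is finite because every member
  satisfies \<open>p w \<ge> - p (- w) \<ge> - q (- w)\<close>.
\<close>

lemma exists_minimal_sublinear:
  assumes q: "sublinear q"
  obtains p where "sublinear p" "\<And>w. p w \<le> q w"
    "\<And>p'. sublinear p' \<Longrightarrow> (\<And>w. p' w \<le> p w) \<Longrightarrow> p' = p"
proof -
  define A where "A = {p. sublinear p \<and> (\<forall>w. p w \<le> q w)}"
  define P where "P = (\<lambda>(p::'a \<Rightarrow> real) p'. \<forall>w. p' w \<le> p w)"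
  have "\<exists>m\<in>A. \<forall>a\<in>A. P m a \<longrightarrow> a = m"
  proof (rule predicate_Zorn)
    show "partial_order_on A (relation_of P A)"
      by (rule partial_order_on_relation_ofI)
        (auto simp: P_def fun_eq_iff intro: order_trans antisym)
    fix C assume C: "C \<in> Chains (relation_of P A)"
    have CA: "C \<subseteq> A"
      using C by (auto simp: Chains_def relation_of_def)
    have total: "P p p' \<or> P p' p" if "p \<in> C" "p' \<in> C" for p p'
      using C that by (auto simp: Chains_def relation_of_def)
    show "\<exists>u\<in>A. \<forall>a\<in>C. P a u"
    proof (cases "C = {}")
      case True
      then show ?thesis using q by (auto simp: A_def)
    next
      case False
      define u where "u w = (INF p\<in>C. p w)" for w
      have bdd: "bdd_below ((\<lambda>p. p w) ` C)" for w
      proof (rule bdd_belowI2)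
        fix p assume "p \<in> C"
        then have "sublinear p" "p (- w) \<le> q (- w)" using CA by (auto simp: A_def)
        then show "- q (- w) \<le> p w" using sublinear_minus[of p w] by simp
      qed
      have u_le: "u w \<le> p w" if "p \<in> C" for p w
        unfolding u_def by (rule cINF_lower[OF bdd that])
      have u_ge: "m \<le> u w" if "\<And>p. p \<in> C \<Longrightarrow> m \<le> p w" for m w
        unfolding u_def by (rule cINF_greatest[OF False that])
      have "u (v + w) \<le> u v + u w" for v w
      proof -
        have "u (v + w) - u w \<le> p v" if p: "p \<in> C" for p
        proof -
          have "u (v + w) - p v \<le> p' w" if p': "p' \<in> C" for p'
          proof -
            have sp: "sublinear p" "sublinear p'" using p p' CA by (auto simp: A_def)
            consider "P p p'" | "P p' p" using total[OF p p'] by blast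
            then show ?thesis
            proof cases
              case 1
              have "u (v + w) \<le> p' v + p' w"
                using u_le[OF p', of "v + w"] sublinear_add[OF sp(2), of v w] by simp
              moreover have "p' v \<le> p v" using 1 by (simp add: P_def)
              ultimately show ?thesis by simp
            next
              case 2
              have "u (v + w) \<le> p v + p w"
                using u_le[OF p, of "v + w"] sublinear_add[OF sp(1), of v w] by simp
              moreover have "p w \<le> p' w" using 2 by (simp add: P_def)
              ultimately show ?thesis by simp
            qed
          qed
          then have "u (v + w) - p v \<le> u w" by (rule u_ge)
          then show ?thesis by simp
        qed
        then have "u (v + w) - u w \<le> u v" by (rule u_ge)
        then show ?thesis by simp
      qed
      moreover have "u (t *\<^sub>R w) = t * u w" if t: "0 \<le> t" for t w
      proof (cases "t = 0")
        case True
        obtain p where "p \<in> C" using False by blast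
        have eq: "p 0 = 0" if "p \<in> C" for p
          using CA that by (auto simp: A_def intro: sublinear_0)
        have "u 0 = (INF p\<in>C. 0)" unfolding u_def by (rule INF_cong) (auto simp: eq)
        then show ?thesis using True False by simp
      next
        case pos: False
        show ?thesis
        proof (rule antisym)
          have "u (t *\<^sub>R w) / t \<le> u w"
          proof (rule u_ge)
            fix p assume p: "p \<in> C"
            have "u (t *\<^sub>R w) \<le> t * p w"
              using u_le[OF p, of "t *\<^sub>R w"] p CA t by (auto simp: A_def sublinear_scale)
            then show "u (t *\<^sub>R w) / t \<le> p w" using t pos by (simp add: field_simps)
          qed
          then show "u (t *\<^sub>R w) \<le> t * u w" using t pos by (simp add: field_simps)
          show "t * u w \<le> u (t *\<^sub>R w)"
          proof (rule u_ge)
            fix p assume p: "p \<in> C"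
            then have "p (t *\<^sub>R w) = t * p w" using CA t by (auto simp: A_def sublinear_scale)
            then show "t * u w \<le> p (t *\<^sub>R w)" using u_le[OF p, of w] t by (simp add: mult_left_mono)
          qed
        qed
      qed
      ultimately have "sublinear u" by (auto simp: sublinear_def)
      moreover have "u w \<le> q w" for w
      proof -
        obtain p where "p \<in> C" using False by blast
        moreover have "p w \<le> q w" using \<open>p \<in> C\<close> CA by (auto simp: A_def)
        ultimately show ?thesis using u_le[of p w] by linarith
      qed
      ultimately have "u \<in> A" by (simp add: A_def)
      then show ?thesis using u_le by (auto simp: P_def)
    qed
  qed
  then obtain p where p: "p \<in> A" "\<And>p'. p' \<in> A \<Longrightarrow> P p p' \<Longrightarrow> p' = p" by blast
  show ?thesis
  proof
    show "sublinear p" "\<And>w. p w \<le> q w" using p(1) by (auto simp: A_def)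
    then show "p' = p" if "sublinear p'" "\<And>w. p' w \<le> p w" for p'
      using p(2)[of p'] that by (auto simp: A_def P_def intro: order_trans)
  qed
qed

text \<open>
  Hahn-Banach in the form needed here. Straightening the norm along \<open>v\<close> forces the value \<open>- norm v\<close> at \<open>- v\<close>,
  and this survives in every minorant.
\<close>

lemma real_norming_functional:
  fixes v :: "'a::real_normed_vector"
  obtains f :: "'a \<Rightarrow> real" where "linear f" "\<And>w. f w \<le> norm w" "f v = norm v"
proof -
  have n: "sublinear (norm :: 'a \<Rightarrow> real)"
    by (simp add: sublinear_def norm_triangle_ineq)
  obtain f where f: "sublinear f" "\<And>w. f w \<le> straighten norm v w"
      "\<And>p'. sublinear p' \<Longrightarrow> (\<And>w. p' w \<le> f w) \<Longrightarrow> p' = f"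
    using exists_minimal_sublinear[OF sublinear_straighten[OF n]] by metis
  have add: "f (x + y) = f x + f y" for x y
    by (rule minimal_sublinear_additive[OF f(1) f(3)])
  have neg: "f (- x) = - f x" for x
    using add[of x "- x"] sublinear_0[OF f(1)] by simp
  have scale: "f (t *\<^sub>R x) = t * f x" for t x
  proof (cases "0 \<le> t")
    case False
    then show ?thesis
      using sublinear_scale[OF f(1), of "- t" x] neg[of "t *\<^sub>R x"] by simp
  qed (simp add: sublinear_scale[OF f(1)])
  have le: "f w \<le> norm w" for w
    using f(2)[of w] straighten_le[OF n, of 0 v w] by simp
  show ?thesis
  proof
    show "linear f" by (rule linearI) (auto simp: add scale)
    show "f w \<le> norm w" for w by (rule le)
    have "f (- v) \<le> - norm v"
      using f(2)[of "- v"] straighten_le[OF n, of 1 v "- v"] by simp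
    then show "f v = norm v" using le[of v] neg[of v] by simp
  qed
qed

text \<open>
  The unit ball of the dual. Working in it replaces operator norms of functionals by the constant 1 in
  all estimates.
\<close>

definition unit_functional :: "('a::complex_normed_vector \<Rightarrow> complex) \<Rightarrow> bool" where
  "unit_functional \<phi> \<longleftrightarrow> bounded_clinear \<phi> \<and> (\<forall>w. cmod (\<phi> w) \<le> norm w)"

lemma bounded_clinear_linear: "bounded_clinear f \<Longrightarrow> bounded_linear f"
  by (simp add: bounded_clinear_def)

lemma bounded_clinear_scaleC: "bounded_clinear f \<Longrightarrow> f (c *\<^sub>C x) = c *\<^sub>C f x"
  by (simp add: bounded_clinear_def)

lemma bounded_clinear_diff: "bounded_clinear f \<Longrightarrow> f (x - y) = f x - f y"
  by (simp add: bounded_clinear_def linear_diff bounded_linear.linear)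

lemma bounded_clinear_add: "bounded_clinear f \<Longrightarrow> f (x + y) = f x + f y"
  by (simp add: bounded_clinear_def linear_add bounded_linear.linear)

lemma bounded_clinear_0: "bounded_clinear f \<Longrightarrow> f 0 = 0"
  by (simp add: bounded_clinear_def linear_0 bounded_linear.linear)

lemma bounded_clinear_minus: "bounded_clinear f \<Longrightarrow> f (- x) = - f x"
  by (simp add: bounded_clinear_def linear_neg bounded_linear.linear)

lemma scaleC_one [simp]: "1 *\<^sub>C (x::'a::complex_normed_vector) = x"
  using scaleC_of_real[of 1 x] by simp

lemma scaleC_0_left [simp]: "0 *\<^sub>C (x::'a::complex_normed_vector) = 0"
  using scaleC_of_real[of 0 x] by simp

lemma scaleC_0_right [simp]: "c *\<^sub>C (0::'a::complex_normed_vector) = 0"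
  using norm_scaleC[of c "0::'a"] by simp

lemma scaleC_minus_left: "(- c) *\<^sub>C (x::'a::complex_normed_vector) = - (c *\<^sub>C x)"
  using scaleC_add_left[of c "-c" x] by (simp add: eq_neg_iff_add_eq_0 add.commute)

lemma scaleC_minus_right: "c *\<^sub>C (- x::'a::complex_normed_vector) = - (c *\<^sub>C x)"
  using scaleC_add_right[of c x "- x"] by (simp add: eq_neg_iff_add_eq_0 add.commute)

lemma scaleC_diff_left: "(c - d) *\<^sub>C (x::'a::complex_normed_vector) = c *\<^sub>C x - d *\<^sub>C x"
  using scaleC_add_left[of c "-d" x] by (simp add: scaleC_minus_left)

lemma scaleC_diff_right: "c *\<^sub>C (x - y::'a::complex_normed_vector) = c *\<^sub>C x - c *\<^sub>C y"
  using scaleC_add_right[of c x "- y"] by (simp add: scaleC_minus_right)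

lemma bounded_bilinear_scaleC:
  "bounded_bilinear (scaleC :: complex \<Rightarrow> 'a::complex_normed_vector \<Rightarrow> 'a)"
proof
  show "\<exists>K. \<forall>a b. norm (a *\<^sub>C (b::'a)) \<le> norm a * norm b * K"
    by (rule exI[of _ 1]) (simp add: norm_scaleC)
  show "(r *\<^sub>R a) *\<^sub>C (b::'a) = r *\<^sub>R a *\<^sub>C b" for r a b
    by (simp add: scaleR_conv_of_real scaleC_scaleC[symmetric] scaleC_of_real[symmetric])
  show "a *\<^sub>C (r *\<^sub>R (b::'a)) = r *\<^sub>R a *\<^sub>C b" for r a b
    by (simp add: scaleC_of_real[symmetric] scaleC_scaleC mult.commute)
qed (simp_all add: scaleC_add_left scaleC_add_right)

lemmas tendsto_scaleC = bounded_bilinear.tendsto[OF bounded_bilinear_scaleC]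

text \<open>
  The usual complexification \<open>f w - i f (i w)\<close> of a real functional. Its norm does not grow, since the argument of
  its value can be rotated away.
\<close>

lemma norming_functional:
  fixes v :: "'a::complex_normed_vector"
  obtains \<phi> where "unit_functional \<phi>" "Re (\<phi> v) = norm v"
proof -
  obtain f :: "'a \<Rightarrow> real" where f: "linear f" "\<And>w. f w \<le> norm w" "f v = norm v"
    using real_norming_functional[of v] by metis
  have f_add: "f (x + y) = f x + f y" and f_scale: "f (r *\<^sub>R x) = r * f x" for x y r
    using f(1) by (simp_all add: linear_add linear_scale)
  have f_neg: "f (- x) = - f x" for x
    using f(1) by (simp add: linear_neg)
  have f_diff: "f (x - y) = f x - f y" for x y
    using f(1) by (simp add: linear_diff)
  define \<phi> where "\<phi> w = Complex (f w) (- f (\<i> *\<^sub>C w))" for w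
  have add: "\<phi> (x + y) = \<phi> x + \<phi> y" for x y
    by (simp add: \<phi>_def f_add scaleC_add_right complex_eq_iff)
  have scale: "\<phi> (c *\<^sub>C x) = c * \<phi> x" for c x
  proof -
    have c: "c *\<^sub>C y = Re c *\<^sub>R y + Im c *\<^sub>R \<i> *\<^sub>C y" for y :: 'a
    proof -
      have "(of_real (Re c) + of_real (Im c) * \<i>) = c"
        by (simp add: complex_eq_iff)
      then have "c *\<^sub>C y = (of_real (Re c) + of_real (Im c) * \<i>) *\<^sub>C y"
        by simp
      then show ?thesis by (simp add: scaleC_add_left scaleC_scaleC[symmetric] scaleC_of_real)
    qed
    have "\<i> *\<^sub>C c *\<^sub>C x = c *\<^sub>C \<i> *\<^sub>C x" by (simp add: scaleC_scaleC mult.commute)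
    also have "\<dots> = Re c *\<^sub>R \<i> *\<^sub>C x + Im c *\<^sub>R \<i> *\<^sub>C \<i> *\<^sub>C x" by (rule c)
    also have "\<i> *\<^sub>C \<i> *\<^sub>C x = - x" by (simp add: scaleC_scaleC scaleC_minus_left)
    finally show ?thesis
      unfolding \<phi>_def c[of x] by (simp add: f_add f_scale f_neg f_diff complex_eq_iff)
  qed
  have bound: "cmod (\<phi> w) \<le> norm w" for w
  proof (cases "\<phi> w = 0")
    case False
    define c where "c = cnj (\<phi> w) / cmod (\<phi> w)"
    have "cmod c = 1" using False by (simp add: c_def norm_divide)
    have "\<phi> (c *\<^sub>C w) = cmod (\<phi> w)"
      using False complex_norm_square[of "\<phi> w"]
      by (simp add: scale c_def field_simps power2_eq_square)
    then have "cmod (\<phi> w) = Re (\<phi> (c *\<^sub>C w))" by simp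
    also have "\<dots> = f (c *\<^sub>C w)" by (simp add: \<phi>_def)
    also have "\<dots> \<le> norm (c *\<^sub>C w)" by (rule f(2))
    finally show ?thesis by (simp add: norm_scaleC \<open>cmod c = 1\<close>)
  qed simp
  have "bounded_linear \<phi>"
  proof (rule bounded_linear_intro)
    show "\<phi> (r *\<^sub>R x) = r *\<^sub>R \<phi> x" for r x
      using scale[of "of_real r" x] by (simp add: scaleC_of_real scaleR_conv_of_real)
    show "norm (\<phi> x) \<le> norm x * 1" for x using bound by simp
  qed (rule add)
  then have "unit_functional \<phi>"
    using scale bound by (auto simp: unit_functional_def bounded_clinear_def scaleC_complex_def)
  moreover have "Re (\<phi> v) = norm v" by (simp add: \<phi>_def f(3))
  ultimately show ?thesis by (rule that)
qed

text \<open>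
  This is how estimates for scalar functions return to the space: only the real parts have to be
  bounded, because the unit ball of the dual is invariant under rotation.
\<close>

lemma norm_le_if_functionals_le:
  fixes v :: "'a::complex_normed_vector"
  assumes "\<And>\<phi>. unit_functional \<phi> \<Longrightarrow> Re (\<phi> v) \<le> B"
  shows "norm v \<le> B"
  by (metis assms norming_functional)

lemma unit_functional_linear: "unit_functional \<phi> \<Longrightarrow> bounded_clinear \<phi>"
  by (simp add: unit_functional_def)

lemma unit_functional_le: "unit_functional \<phi> \<Longrightarrow> cmod (\<phi> w) \<le> norm w"
  by (simp add: unit_functional_def)

lemma unit_functional_scaleC: "unit_functional \<phi> \<Longrightarrow> \<phi> (c *\<^sub>C w) = c * \<phi> w"
  by (simp add: unit_functional_def bounded_clinear_def scaleC_complex_def)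

section \<open>Weak and strong holomorphy\<close>

lemma second_order_Taylor_bound:
  assumes hol: "f holomorphic_on ball z0 r" and r: "0 < r"
    and B: "\<And>z. z \<in> ball z0 r \<Longrightarrow> cmod (f z) \<le> B"
    and h: "cmod h < r / 2"
  shows "cmod (f (z0 + h) - f z0 - h * deriv f z0) \<le> 8 * B / r^2 * cmod h ^ 2"
proof -
  have d: "((deriv ^^ i) f has_field_derivative (deriv ^^ Suc i) f x) (at x within ball z0 (r/2))"
    if "x \<in> ball z0 (r/2)" for i x
  proof -
    have x: "x \<in> ball z0 r" using that r by (auto simp: ball_def)
    have "(deriv ^^ i) f holomorphic_on ball z0 r"
      by (rule holomorphic_higher_deriv[OF hol]) simp
    then have "((deriv ^^ i) f has_field_derivative deriv ((deriv ^^ i) f) x) (at x)"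
      using x by (meson holomorphic_derivI open_ball)
    then show ?thesis by (simp add: has_field_derivative_at_within)
  qed
  have b: "cmod ((deriv ^^ 2) f x) \<le> 8 * B / r^2" if x: "x \<in> ball z0 (r/2)" for x
  proof -
    have sub: "cball x (r/2) \<subseteq> ball z0 r"
    proof
      fix y assume "y \<in> cball x (r/2)"
      then show "y \<in> ball z0 r" using x dist_triangle[of z0 y x] by (simp add: mem_ball)
    qed
    have "cmod ((deriv ^^ 2) f x) \<le> fact 2 * B / (r/2)^2"
    proof (rule Cauchy_inequality)
      show "f holomorphic_on ball x (r/2)"
        using hol sub by (meson ball_subset_cball holomorphic_on_subset order_trans)
      show "continuous_on (cball x (r/2)) f"
        using hol sub by (meson holomorphic_on_imp_continuous_on continuous_on_subset)
      show "cmod (f y) \<le> B" if "norm (x - y) = r/2" for y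
        using sub that B[of y] by (auto simp: dist_norm subset_iff)
    qed (use r in auto)
    then show ?thesis by (simp add: power2_eq_square field_simps)
  qed
  have "cmod ((deriv ^^ 0) f (z0 + h) - (\<Sum>i\<le>1. (deriv ^^ i) f z0 * (z0 + h - z0) ^ i / fact i))
      \<le> (8 * B / r^2) * cmod (z0 + h - z0) ^ Suc 1 / fact 1"
    by (rule complex_Taylor[where S="ball z0 (r/2)" and f="\<lambda>i. (deriv ^^ i) f"])
      (use d b h r in \<open>auto simp: dist_norm numeral_2_eq_2\<close>)
  then show ?thesis by (simp add: algebra_simps power2_eq_square)
qed

text \<open>
  Dunford's theorem. The second order Taylor bound is uniform over the unit ball of the dual,
  so that the difference quotients themselves form a Cauchy family.
\<close>

lemma vholomorphic_if_weakly_holomorphic: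
  fixes g :: "complex \<Rightarrow> 'a::complex_banach"
  assumes U: "open U"
    and weak: "\<And>\<phi>. unit_functional \<phi> \<Longrightarrow> (\<lambda>z. \<phi> (g z)) holomorphic_on U"
    and bound: "\<And>z. z \<in> U \<Longrightarrow> norm (g z) \<le> C"
  shows "vholomorphic_on g U"
  unfolding vholomorphic_on_def
proof
  fix z0 assume z0: "z0 \<in> U"
  obtain r where r: "0 < r" "ball z0 r \<subseteq> U" using U z0 by (meson openE)
  define K where "K = 8 * C / r^2"
  have "0 \<le> C" using bound[OF z0] norm_ge_zero order_trans by blast
  then have K0: "0 \<le> K" by (simp add: K_def)
  define Q where "Q h = inverse h *\<^sub>C (g (z0 + h) - g z0)" for h
  have Q: "norm (Q h - Q k) \<le> K * (cmod h + cmod k)"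
    if h: "h \<noteq> 0" "cmod h < r/2" and k: "k \<noteq> 0" "cmod k < r/2" for h k
  proof (rule norm_le_if_functionals_le)
    fix \<phi> :: "'a \<Rightarrow> complex" assume \<phi>: "unit_functional \<phi>"
    define f where "f z = \<phi> (g z)" for z
    have taylor: "cmod (f (z0 + h) - f z0 - h * deriv f z0) \<le> K * cmod h ^ 2"
      if "cmod h < r/2" for h
      unfolding K_def
    proof (rule second_order_Taylor_bound[OF _ r(1) _ that])
      show "f holomorphic_on ball z0 r"
        unfolding f_def using weak[OF \<phi>] r(2) holomorphic_on_subset by blast
      show "cmod (f z) \<le> C" if "z \<in> ball z0 r" for z
        using unit_functional_le[OF \<phi>, of "g z"] bound[of z] that r(2) by (force simp: f_def)
    qed
    have q: "cmod (\<phi> (Q h) - deriv f z0) \<le> K * cmod h" if h: "h \<noteq> 0" "cmod h < r/2" for h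
    proof -
      have "\<phi> (Q h) - deriv f z0 = (f (z0 + h) - f z0 - h * deriv f z0) / h"
        using h by (simp add: Q_def f_def unit_functional_scaleC[OF \<phi>]
            bounded_clinear_diff[OF unit_functional_linear[OF \<phi>]] field_simps)
      then have "cmod (\<phi> (Q h) - deriv f z0) = cmod (f (z0 + h) - f z0 - h * deriv f z0) / cmod h"
        by (simp add: norm_divide)
      also have "\<dots> \<le> K * cmod h ^ 2 / cmod h"
        by (intro divide_right_mono taylor h(2)) simp
      also have "\<dots> = K * cmod h" using h by (simp add: power2_eq_square)
      finally show ?thesis .
    qed
    have "Re (\<phi> (Q h - Q k)) \<le> cmod (\<phi> (Q h) - \<phi> (Q k))"
      by (simp add: bounded_clinear_diff[OF unit_functional_linear[OF \<phi>]])
        (metis complex_Re_le_cmod minus_complex.simps(1))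
    also have "\<dots> \<le> cmod (\<phi> (Q h) - deriv f z0) + cmod (\<phi> (Q k) - deriv f z0)"
      using norm_triangle_ineq4[of "\<phi> (Q h) - deriv f z0" "\<phi> (Q k) - deriv f z0"] by simp
    also have "\<dots> \<le> K * cmod h + K * cmod k"
      using q[OF h] q[OF k] by simp
    finally show "Re (\<phi> (Q h - Q k)) \<le> K * (cmod h + cmod k)" by (simp add: algebra_simps)
  qed
  have "\<exists>d. (Q \<longlongrightarrow> d) (at 0)"
  proof -
    define hs where "hs n = complex_of_real (r / 4 / Suc n)" for n
    have hs: "hs n \<noteq> 0" "cmod (hs n) < r/2" "cmod (hs n) = r / 4 / Suc n" for n
    proof -
      show "hs n \<noteq> 0" using r by (simp add: hs_def del: of_nat_Suc)
      show 1: "cmod (hs n) = r / 4 / Suc n" using r by (simp add: hs_def norm_divide del: of_nat_Suc)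
      have "r / 4 / Suc n \<le> r / 4 / 1" using r by (intro divide_left_mono) auto
      then show "cmod (hs n) < r/2" unfolding 1 using r by linarith
    qed
    have lim0: "(\<lambda>n. cmod (hs n)) \<longlonglongrightarrow> 0"
      unfolding hs(3) by real_asymp
    have "Cauchy (\<lambda>n. Q (hs n))"
    proof (rule CauchyI)
      fix e :: real assume e: "0 < e"
      have "(\<lambda>n. K * cmod (hs n)) \<longlonglongrightarrow> K * 0"
        by (intro tendsto_intros lim0)
      then have "eventually (\<lambda>n. K * cmod (hs n) < e/2) sequentially"
        using e by (intro order_tendstoD(2)[of _ "K * 0"]) auto
      then obtain N where N: "\<And>n. n \<ge> N \<Longrightarrow> K * cmod (hs n) < e/2"
        by (auto simp: eventually_sequentially)
      show "\<exists>M. \<forall>m\<ge>M. \<forall>n\<ge>M. norm (Q (hs m) - Q (hs n)) < e"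
      proof (intro exI allI impI)
        fix m n assume "N \<le> m" "N \<le> n"
        then show "norm (Q (hs m) - Q (hs n)) < e"
          using Q[OF hs(1,2) hs(1,2), of m n] N[of m] N[of n] by (simp add: algebra_simps)
      qed
    qed
    then obtain d where d: "(\<lambda>n. Q (hs n)) \<longlonglongrightarrow> d"
      using Cauchy_convergent convergent_def by blast
    have bd: "norm (Q h - d) \<le> K * cmod h" if h: "h \<noteq> 0" "cmod h < r/2" for h
    proof (rule tendsto_le)
      show "(\<lambda>n. norm (Q h - Q (hs n))) \<longlonglongrightarrow> norm (Q h - d)"
        by (intro tendsto_intros d)
      have "(\<lambda>n. K * (cmod h + cmod (hs n))) \<longlonglongrightarrow> K * (cmod h + 0)"
        by (intro tendsto_intros lim0)
      then show "(\<lambda>n. K * (cmod h + cmod (hs n))) \<longlonglongrightarrow> K * cmod h" by simp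
      show "\<forall>\<^sub>F n in sequentially. norm (Q h - Q (hs n)) \<le> K * (cmod h + cmod (hs n))"
        using Q[OF h hs(1,2)] by simp
    qed simp
    have "((\<lambda>h. Q h - d) \<longlongrightarrow> 0) (at 0)"
    proof (rule Lim_null_comparison)
      show "\<forall>\<^sub>F h in at 0. norm (Q h - d) \<le> K * cmod h"
        unfolding eventually_at using r bd by (intro exI[of _ "r/2"]) (auto simp: dist_norm)
      have "((\<lambda>h. K * cmod h) \<longlongrightarrow> K * cmod 0) (at 0)"
        by (intro tendsto_intros)
      then show "((\<lambda>h. K * cmod h) \<longlongrightarrow> 0) (at 0)" by simp
    qed
    then show ?thesis by (auto simp: LIM_zero_iff)
  qed
  then obtain d where d: "(Q \<longlongrightarrow> d) (at 0)" by blast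
  have bl: "bounded_linear (\<lambda>h. h *\<^sub>C d)"
    by (rule bounded_bilinear.bounded_linear_left[OF bounded_bilinear_scaleC])
  have "(g has_derivative (\<lambda>h. h *\<^sub>C d)) (at z0)"
    unfolding has_derivative_at
  proof (intro conjI bl)
    have "((\<lambda>h. norm (Q h - d)) \<longlongrightarrow> 0) (at 0)"
      using d by (simp add: tendsto_norm_zero LIM_zero)
    then show "((\<lambda>h. norm (g (z0 + h) - g z0 - h *\<^sub>C d) / norm h) \<longlongrightarrow> 0) (at 0)"
    proof (rule Lim_transform_eventually)
      have "norm (Q h - d) = norm (g (z0 + h) - g z0 - h *\<^sub>C d) / norm h" if "h \<noteq> 0" for h
      proof -
        have "g (z0 + h) - g z0 - h *\<^sub>C d = h *\<^sub>C (Q h - d)"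
          using that by (simp add: Q_def scaleC_diff_right scaleC_scaleC)
        then show ?thesis using that by (simp add: norm_scaleC)
      qed
      then show "\<forall>\<^sub>F h in at 0. norm (Q h - d) = norm (g (z0 + h) - g z0 - h *\<^sub>C d) / norm h"
        by (auto simp: eventually_at_filter)
    qed
  qed
  then show "\<exists>d. (g has_derivative (\<lambda>h. h *\<^sub>C d)) (at z0 within U)"
    using has_derivative_at_withinI by blast
qed

section \<open>Maximum principles and estimates across the imaginary axis\<close>

text \<open>
  The maximum principle under a \<open>limsup\<close> condition on the boundary. The set where the real part is at least
  \<open>M + e\<close> is compact and stays away from the boundary, and on the frontier of this set the
  real part is at most \<open>M + e\<close>.
\<close>

lemma max_principle_limsup:
  assumes \<Omega>: "open \<Omega>" "bounded \<Omega>" and f: "f holomorphic_on \<Omega>"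
    and bd: "\<And>\<zeta> e. \<zeta> \<in> frontier \<Omega> \<Longrightarrow> 0 < e \<Longrightarrow> \<forall>\<^sub>F z in at \<zeta> within \<Omega>. Re (f z) \<le> M + e"
    and z: "z \<in> \<Omega>"
  shows "Re (f z) \<le> M"
proof (rule field_le_epsilon)
  fix e :: real assume e: "0 < e"
  define S where "S = {w \<in> \<Omega>. M + e \<le> Re (f w)}"
  have cont: "continuous (at w) f" if "w \<in> \<Omega>" for w
    using f \<Omega>(1) that by (meson field_differentiable_imp_continuous_at holomorphic_on_imp_differentiable_at)
  have "closure S \<subseteq> S"
  proof
    fix w assume w: "w \<in> closure S"
    show "w \<in> S"
    proof (rule ccontr)
      assume nw: "w \<notin> S"
      have "\<forall>\<^sub>F v in at w within \<Omega>. Re (f v) < M + e"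
      proof (cases "w \<in> \<Omega>")
        case True
        then have "((\<lambda>v. Re (f v)) \<longlongrightarrow> Re (f w)) (at w within \<Omega>)"
          using cont[OF True] continuous_within_subset[of w UNIV f \<Omega>]
          by (intro tendsto_intros) (simp add: continuous_within)
        then show ?thesis using nw True by (intro order_tendstoD(2)) (auto simp: S_def)
      next
        case False
        have "w \<in> frontier \<Omega>"
          using w False \<Omega>(1) closure_mono[of S \<Omega>]
          by (auto simp: frontier_def interior_open S_def)
        from bd[OF this, of "e/2"] e show ?thesis
          by (auto elim!: eventually_mono)
      qed
      then obtain d where d: "0 < d" "\<And>v. v \<in> \<Omega> \<Longrightarrow> v \<noteq> w \<Longrightarrow> dist v w < d \<Longrightarrow> Re (f v) < M + e"
        by (auto simp: eventually_at)
      obtain v where "v \<in> S" "dist v w < d"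
        using w d(1) by (meson closure_approachable)
      then show False using d(2)[of v] nw by (auto simp: S_def)
    qed
  qed
  then have "closed S" by (metis closure_subset closed_closure subset_antisym)
  have S\<Omega>: "S \<subseteq> \<Omega>" by (auto simp: S_def)
  show "Re (f z) \<le> M + e"
  proof (cases "z \<in> S")
    case True
    show ?thesis
    proof (rule maximum_real_frontier[OF _ _ _ _ True])
      show "f holomorphic_on interior S"
        using f S\<Omega> interior_subset holomorphic_on_subset by (metis order_trans)
      show "continuous_on (closure S) f"
        using f S\<Omega> \<open>closed S\<close> by (simp add: holomorphic_on_imp_continuous_on holomorphic_on_subset)
      show "bounded S" using \<Omega>(2) S\<Omega> bounded_subset by blast
      show "Re (f w) \<le> M + e" if w: "w \<in> frontier S" for w
      proof (rule ccontr)
        assume gt: "\<not> Re (f w) \<le> M + e"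
        have wS: "w \<in> S" using w \<open>closed S\<close> frontier_subset_closed by blast
        then have w\<Omega>: "w \<in> \<Omega>" using S\<Omega> by blast
        have "((\<lambda>v. Re (f v)) \<longlongrightarrow> Re (f w)) (nhds w)"
          using cont[OF w\<Omega>] by (intro tendsto_intros) (simp add: isCont_def tendsto_nhds_iff)
        then have "\<forall>\<^sub>F v in nhds w. M + e < Re (f v)"
          using gt by (intro order_tendstoD(1)) auto
        moreover have "\<forall>\<^sub>F v in nhds w. v \<in> \<Omega>"
          using \<Omega>(1) w\<Omega> by (rule eventually_nhds_in_open)
        ultimately have "\<forall>\<^sub>F v in nhds w. v \<in> S"
          by eventually_elim (simp add: S_def)
        then have "w \<in> interior S"
          by (meson eventually_nhds interiorI subsetI)
        then show False using w by (simp add: frontier_def)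
      qed
    qed
  qed (use z in \<open>auto simp: S_def\<close>)
qed

text \<open>
  The Phragmen-Lindeloef principle: at the exceptional points \<open>E\<close> it is enough that the function is
  dominated by every positive multiple of the real part of a barrier \<open>b\<close>.
\<close>

lemma max_principle_barrier:
  assumes \<Omega>: "open \<Omega>" "bounded \<Omega>" and f: "f holomorphic_on \<Omega>" and b: "b holomorphic_on \<Omega>"
    and b0: "\<And>z. z \<in> \<Omega> \<Longrightarrow> 0 \<le> Re (b z)"
    and bd: "\<And>\<zeta> e. \<zeta> \<in> frontier \<Omega> - E \<Longrightarrow> 0 < e \<Longrightarrow> \<forall>\<^sub>F z in at \<zeta> within \<Omega>. Re (f z) \<le> M + e"
    and ex: "\<And>\<zeta> \<eta>. \<zeta> \<in> E \<Longrightarrow> 0 < \<eta> \<Longrightarrow> \<forall>\<^sub>F z in at \<zeta> within \<Omega>. Re (f z) \<le> M + \<eta> * Re (b z)"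
    and z: "z \<in> \<Omega>"
  shows "Re (f z) \<le> M"
proof -
  have *: "Re (f z) \<le> M + \<eta> * Re (b z)" if \<eta>: "0 < \<eta>" for \<eta>
  proof -
    have "Re (f z - of_real \<eta> * b z) \<le> M"
    proof (rule max_principle_limsup[OF \<Omega> _ _ z])
      show "(\<lambda>z. f z - of_real \<eta> * b z) holomorphic_on \<Omega>"
        using f b by (intro holomorphic_intros)
      fix \<zeta> e assume \<zeta>: "\<zeta> \<in> frontier \<Omega>" and e: "(0::real) < e"
      have in\<Omega>: "\<forall>\<^sub>F z in at \<zeta> within \<Omega>. z \<in> \<Omega>"
        by (simp add: eventually_at_filter)
      show "\<forall>\<^sub>F z in at \<zeta> within \<Omega>. Re (f z - of_real \<eta> * b z) \<le> M + e"
      proof (cases "\<zeta> \<in> E")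
        case True
        show ?thesis using ex[OF True \<eta>] by eventually_elim (use e in simp)
      next
        case False
        have "\<forall>\<^sub>F z in at \<zeta> within \<Omega>. Re (f z) \<le> M + e" using False \<zeta> e bd by blast
        with in\<Omega> show ?thesis
        proof eventually_elim
          case (elim z)
          have "0 \<le> \<eta> * Re (b z)" using b0[of z] elim \<eta> by simp
          then show ?case using elim by simp
        qed
      qed
    qed
    then show ?thesis by simp
  qed
  show ?thesis
  proof (rule tendsto_lowerbound)
    have "((\<lambda>\<eta>. M + \<eta> * Re (b z)) \<longlongrightarrow> M + 0 * Re (b z)) (at_right 0)"
      by (intro tendsto_intros)
    then show "((\<lambda>\<eta>. M + \<eta> * Re (b z)) \<longlongrightarrow> M) (at_right 0)" by simp
    show "\<forall>\<^sub>F \<eta> in at_right 0. Re (f z) \<le> M + \<eta> * Re (b z)"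
      using * by (auto simp: eventually_at_filter)
  qed simp
qed

text \<open>
  A bound that blows up at the imaginary axis gives a bound across the axis. The polynomial
  \<open>((z - z0)\<^sup>2 + R\<^sup>2)\<^sup>3\<close> has modulus \<open>(2 R |Re z|)\<^sup>3\<close> on the circle with radius \<open>R\<close> about a point of the axis, which
  compensates the singularity there, and the maximum principle carries the estimate inside.
\<close>

lemma bound_from_distance_to_axis:
  assumes S: "open S" "cball z0 R \<subseteq> S" and h: "h holomorphic_on S"
    and z0: "Re z0 = 0" and R: "0 < R" and C: "0 \<le> C"
    and bound: "\<And>z. z \<in> cball z0 R \<Longrightarrow> Re z \<noteq> 0 \<Longrightarrow> cmod (h z) \<le> C / \<bar>Re z\<bar> ^ 3"
    and z: "cmod (z - z0) \<le> R / 2"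
  shows "cmod (h z) \<le> 19 * C / R ^ 3"
proof -
  define w where "w z = (z - z0)\<^sup>2 + of_real (R\<^sup>2)" for z
  define k where "k z = w z ^ 3 * h z" for z
  have hk: "k holomorphic_on S"
    unfolding k_def w_def by (intro holomorphic_intros h)
  have zb: "z \<in> ball z0 R" using z R by (simp add: dist_norm norm_minus_commute)
  have "cmod (k z) \<le> 8 * C * R ^ 3"
  proof (rule maximum_modulus_frontier[OF _ _ _ _ zb])
    show "k holomorphic_on interior (ball z0 R)"
      using hk S(2) by (metis ball_subset_cball holomorphic_on_subset interior_ball order_trans)
    show "continuous_on (closure (ball z0 R)) k"
      using hk S(2) R by (simp add: holomorphic_on_imp_continuous_on holomorphic_on_subset)
    fix \<zeta> assume "\<zeta> \<in> frontier (ball z0 R)"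
    then have \<zeta>: "cmod (\<zeta> - z0) = R" using R by (simp add: dist_norm norm_minus_commute)
    have "w \<zeta> = (\<zeta> - z0) * (\<zeta> - z0) + (\<zeta> - z0) * cnj (\<zeta> - z0)"
      using complex_norm_square[of "\<zeta> - z0"] \<zeta> by (simp add: w_def power2_eq_square)
    also have "\<dots> = (\<zeta> - z0) * of_real (2 * Re \<zeta>)"
      using z0 by (simp add: complex_eq_iff algebra_simps)
    finally have w: "cmod (w \<zeta>) = R * (2 * \<bar>Re \<zeta>\<bar>)"
      using \<zeta> by (simp add: norm_mult)
    show "cmod (k \<zeta>) \<le> 8 * C * R ^ 3"
    proof (cases "Re \<zeta> = 0")
      case True
      then show ?thesis using w C R by (simp add: k_def)
    next
      case False
      have "cmod (k \<zeta>) = (R * (2 * \<bar>Re \<zeta>\<bar>)) ^ 3 * cmod (h \<zeta>)"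
        by (simp add: k_def norm_mult norm_power w)
      also have "\<dots> \<le> (R * (2 * \<bar>Re \<zeta>\<bar>)) ^ 3 * (C / \<bar>Re \<zeta>\<bar> ^ 3)"
        using \<zeta> R False by (intro mult_left_mono bound) (auto simp: dist_norm norm_minus_commute)
      also have "\<dots> = 8 * C * R ^ 3" using False by (simp add: power_mult_distrib field_simps)
      finally show ?thesis .
    qed
  qed simp
  moreover have "27/64 * R ^ 6 \<le> cmod (w z) ^ 3"
  proof -
    have "cmod (z - z0) ^ 2 \<le> (R/2) ^ 2" using z by (intro power_mono) auto
    then have "3/4 * R\<^sup>2 \<le> R\<^sup>2 - cmod (z - z0) ^ 2" by (simp add: power2_eq_square)
    also have "\<dots> = cmod (of_real (R\<^sup>2)) - cmod (- (z - z0)\<^sup>2)" by (simp add: norm_power)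
    also have "\<dots> \<le> cmod (w z)"
      unfolding w_def by (metis add.commute diff_minus_eq_add norm_triangle_ineq2)
    finally have "(3/4 * R\<^sup>2) ^ 3 \<le> cmod (w z) ^ 3" using R by (intro power_mono) auto
    then show ?thesis by (simp add: power_mult_distrib power_divide)
  qed
  ultimately have "27/64 * R ^ 6 * cmod (h z) \<le> 8 * C * R ^ 3"
    by (smt (verit) k_def mult_right_mono norm_ge_zero norm_mult norm_power)
  then have "R ^ 3 * (27 * (R ^ 3 * cmod (h z))) \<le> R ^ 3 * (512 * C)"
    by (simp add: algebra_simps flip: power_add)
  then have "27 * (R ^ 3 * cmod (h z)) \<le> 512 * C" using R by simp
  then have "R ^ 3 * cmod (h z) \<le> 19 * C" using C by simp
  then show ?thesis using R by (simp add: field_simps)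
qed

section \<open>Critical growth at corners and in strips\<close>

lemma Re_inverse_power:
  assumes "z \<noteq> 0"
  shows "Re (c / z ^ n) = Re (c * cnj z ^ n) / cmod z ^ (2 * n)"
proof -
  have "c / z ^ n = c * cnj z ^ n / (z * cnj z) ^ n"
    using assms by (simp add: power_mult_distrib)
  also have "\<dots> = c * cnj z ^ n / of_real (cmod z ^ (2 * n))"
    by (simp add: complex_norm_square[symmetric] power_mult)
  finally show ?thesis by (simp only: Re_divide_of_real)
qed

text \<open>
  The harmonic function of critical growth in the quadrant: it is positive inside and vanishes on both sides.
\<close>

lemma Re_barrier2: "z \<noteq> 0 \<Longrightarrow> Re (\<i> / z\<^sup>2) = 2 * Re z * Im z / cmod z ^ 4"
  by (subst Re_inverse_power) (auto simp: power2_eq_square)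

text \<open>
  A barrier of order \<open>-2\<close>, positive up to the boundary of the sector below the line \<open>Im z = 3 Re z\<close>. The
  opening of this sector is less than a right angle, and the factor \<open>1 + 3i\<close> turns the positive sector of
  \<open>1 / z\<^sup>2\<close> to it.
\<close>

lemma Re_barrier2':
  assumes "0 < Re z" "0 \<le> Im z" "Im z \<le> 3 * Re z"
  shows "1 / cmod z ^ 2 \<le> Re ((1 + 3 * \<i>) / z\<^sup>2)"
proof -
  have z: "z \<noteq> 0" using assms by auto
  have "Im z * Im z \<le> Im z * (3 * Re z)" using assms by (intro mult_left_mono) auto
  then have "cmod z ^ 2 \<le> Re ((1 + 3 * \<i>) * cnj z ^ 2)"
    unfolding cmod_power2 by (simp add: power2_eq_square algebra_simps)
  then have "cmod z ^ 2 / cmod z ^ 4 \<le> Re ((1 + 3 * \<i>) / z\<^sup>2)"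
    using z by (subst Re_inverse_power) (auto intro!: divide_right_mono)
  then show ?thesis using z by (simp add: field_simps power4_eq_xxxx power2_eq_square)
qed

text \<open>
  A barrier of order \<open>-4\<close> for the complementary sector. A line of slope 3, which is more than \<open>1 + \<surd>2\<close>, makes
  an angle less than \<open>\<pi> / 8\<close> with the imaginary axis; therefore \<open>1 / z\<^sup>4\<close> stays in the right half-plane.
\<close>

lemma Re_barrier4:
  assumes "0 < Re z" "3 * Re z \<le> Im z"
  shows "1 / (4 * cmod z ^ 4) \<le> Re (1 / z ^ 4)"
proof -
  have z: "z \<noteq> 0" using assms by auto
  define p q where "p = (Re z)\<^sup>2" and "q = (Im z)\<^sup>2"
  have "(3 * Re z)\<^sup>2 \<le> (Im z)\<^sup>2" using assms by (intro power_mono) auto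
  then have pq: "0 \<le> p" "9 * p \<le> q" by (auto simp: p_def q_def power_mult_distrib)
  have "Re (cnj z ^ 4) = p\<^sup>2 - 6 * p * q + q\<^sup>2"
    by (simp add: power4_eq_xxxx power2_eq_square p_def q_def algebra_simps)
  moreover have "cmod z ^ 4 = (p + q)\<^sup>2"
    using cmod_power2[of z] by (simp add: p_def q_def power2_eq_square power4_eq_xxxx)
  moreover have "(p + q)\<^sup>2 / 4 \<le> p\<^sup>2 - 6 * p * q + q\<^sup>2"
  proof -
    have "0 \<le> q * (q - 9 * p)" using pq by (intro mult_nonneg_nonneg) auto
    moreover have "0 \<le> p * q" using pq by (intro mult_nonneg_nonneg) auto
    moreover have "p\<^sup>2 - 6 * p * q + q\<^sup>2 - (p + q)\<^sup>2 / 4 = 3/4 * (q * (q - 9 * p)) + p * q / 4 + 3/4 * p\<^sup>2"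
      by (simp add: power2_eq_square field_simps)
    moreover have "0 \<le> p\<^sup>2" by simp
    ultimately show ?thesis by linarith
  qed
  ultimately have "cmod z ^ 4 / 4 \<le> Re (1 * cnj z ^ 4)" by simp
  then have "cmod z ^ 4 / 4 / cmod z ^ 8 \<le> Re (1 * cnj z ^ 4) / cmod z ^ 8"
    by (intro divide_right_mono) auto
  then have "cmod z ^ 4 / 4 / cmod z ^ 8 \<le> Re (1 / z ^ 4)"
    using Re_inverse_power[OF z, of 1 4] by simp
  moreover have "cmod z ^ 4 / 4 / cmod z ^ 8 = 1 / (4 * cmod z ^ 4)"
  proof -
    have "cmod z ^ 8 = cmod z ^ 4 * cmod z ^ 4" by (simp flip: power_add)
    moreover have "r / 4 / (r * r) = 1 / (4 * r)" if "r \<noteq> 0" for r :: real using that by simp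
    ultimately show ?thesis using z by (metis power_not_zero norm_eq_zero)
  qed
  ultimately show ?thesis by simp
qed

text \<open>
  The local estimate at a corner of a strip. In the whole quadrant \<open>r\<^sup>-\<^sup>2\<close> is the critical growth of the
  Phragmen-Lindeloef principle, and it is attained by \<open>Re (i / z\<^sup>2)\<close>. The line \<open>Im z = 3 Re z\<close> divides the quadrant
  into two sectors with a larger critical exponent. On the line, \<open>f\<close> is eventually below \<open>\<epsilon> Re (i / z\<^sup>2)\<close> by
  the hypothesis on the cone; in each sector the difference of the two is therefore bounded on the sides, its growth
  is subcritical (\<open>r\<^sup>-\<^sup>3\<close> against \<open>r\<^sup>-\<^sup>4\<close> above the line, \<open>o(r\<^sup>-\<^sup>2)\<close> below), and so it is bounded above. The
  constant \<open>M\<close> depends on \<open>\<epsilon>\<close> in an uncontrolled manner, which does no harm in \<open>strip_bound\<close>.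
\<close>

lemma corner_estimate:
  fixes f :: "complex \<Rightarrow> complex"
  defines "Q \<rho> \<equiv> {z. 0 < Re z \<and> 0 < Im z \<and> cmod z < \<rho>}"
  assumes f: "f holomorphic_on Q \<rho>0" and \<rho>0: "0 < \<rho>0" and B: "0 \<le> B"
    and growth: "\<And>z. z \<in> Q \<rho>0 \<Longrightarrow> Re (f z) \<le> B / cmod z ^ 3"
    and bottom: "\<And>s e. 0 < s \<Longrightarrow> s < \<rho>0 \<Longrightarrow> 0 < e \<Longrightarrow>
        \<forall>\<^sub>F z in at (Complex 0 s) within Q \<rho>0. Re (f z) \<le> e"
    and side: "\<And>t e. 0 < t \<Longrightarrow> t < \<rho>0 \<Longrightarrow> 0 < e \<Longrightarrow>
        \<forall>\<^sub>F z in at (Complex t 0) within Q \<rho>0. Re (f z) \<le> C + e"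
    and cone: "\<And>\<epsilon>. 0 < \<epsilon> \<Longrightarrow>
        \<exists>\<rho>>0. \<forall>z\<in>Q \<rho>0. cmod z < \<rho> \<longrightarrow> Im z \<le> 3 * Re z \<longrightarrow> Re (f z) \<le> \<epsilon> / cmod z ^ 2"
    and \<epsilon>: "0 < \<epsilon>"
  shows "\<exists>\<rho> M. 0 < \<rho> \<and> \<rho> < \<rho>0 \<and> (\<forall>z\<in>Q \<rho>. Re (f z) \<le> \<epsilon> * Re (\<i> / z\<^sup>2) + M)"
proof -
  obtain \<rho>1 where \<rho>1: "0 < \<rho>1"
    "\<And>z. z \<in> Q \<rho>0 \<Longrightarrow> cmod z < \<rho>1 \<Longrightarrow> Im z \<le> 3 * Re z \<Longrightarrow> Re (f z) \<le> 3/5 * \<epsilon> / cmod z ^ 2"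
    using cone[of "3/5 * \<epsilon>"] \<epsilon> by auto
  \<comment> \<open>On the line \<open>Im z = 3 Re z\<close> one has \<open>Re (i / z\<^sup>2) = 3/5 r\<^sup>-\<^sup>2\<close>, which is where the factor comes from.\<close>
  define \<rho> where "\<rho> = min \<rho>1 \<rho>0 / 2"
  have \<rho>: "0 < \<rho>" "\<rho> < \<rho>0" "\<rho> < \<rho>1" using \<rho>0 \<rho>1(1) by (auto simp: \<rho>_def)
  define M where "M = max (max 0 C) (B / \<rho> ^ 3)"
  have M: "0 \<le> M" "C \<le> M" "B / \<rho> ^ 3 \<le> M" by (auto simp: M_def)
  define F where "F z = f z - of_real \<epsilon> * (\<i> / z\<^sup>2)" for z
  have ReF: "Re (F z) = Re (f z) - \<epsilon> * Re (\<i> / z\<^sup>2)" for z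
    by (simp only: F_def minus_complex.simps Re_complex_of_real times_complex.simps Im_complex_of_real)
  have b_pos: "0 \<le> \<epsilon> * Re (\<i> / z\<^sup>2)" if "z \<in> Q \<rho>0" for z
    using that \<epsilon> by (subst Re_barrier2) (auto simp: Q_def)
  have F_le: "Re (F z) \<le> Re (f z)" if "z \<in> Q \<rho>0" for z
    using b_pos[OF that] ReF[of z] by simp
  have openQ: "open (Q r)" for r
    unfolding Q_def by (intro open_Collect_conj open_Collect_less continuous_intros)
  have Fhol: "F holomorphic_on Q \<rho>0"
    unfolding F_def by (intro holomorphic_intros f) (auto simp: Q_def)
  have inside: "\<forall>\<^sub>F z in at \<zeta> within \<Omega>. Re (F z) \<le> M + e"
    if "\<zeta> \<in> Q \<rho>0" "Re (F \<zeta>) \<le> M" "0 < e" for \<zeta> e \<Omega>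
  proof -
    have "continuous (at \<zeta>) F"
      using Fhol openQ that(1)
      by (meson field_differentiable_imp_continuous_at holomorphic_on_imp_differentiable_at)
    then have "((\<lambda>v. Re (F v)) \<longlongrightarrow> Re (F \<zeta>)) (at \<zeta> within \<Omega>)"
      using continuous_within_subset[of \<zeta> UNIV F \<Omega>]
      by (intro tendsto_intros) (simp add: continuous_within)
    then have "\<forall>\<^sub>F v in at \<zeta> within \<Omega>. Re (F v) < M + e"
      using that by (intro order_tendstoD(2)) auto
    then show ?thesis by eventually_elim simp
  qed
  have mono: "\<forall>\<^sub>F z in at \<zeta> within \<Omega>. Re (F z) \<le> M + e"
    if "\<forall>\<^sub>F z in at \<zeta> within Q \<rho>0. Re (f z) \<le> M + e" "\<Omega> \<subseteq> Q \<rho>0" for \<zeta> e \<Omega>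
  proof -
    have "\<forall>\<^sub>F z in at \<zeta> within \<Omega>. Re (f z) \<le> M + e"
      using that at_le filter_leD by blast
    moreover have "\<forall>\<^sub>F z in at \<zeta> within \<Omega>. z \<in> \<Omega>"
      by (simp add: eventually_at_filter)
    ultimately show ?thesis
      by eventually_elim (use F_le that(2) in force)
  qed
  have ray: "Re (F z) \<le> M" if z: "z \<in> Q \<rho>0" "cmod z < \<rho>1" "Im z = 3 * Re z" for z
  proof -
    have z0: "z \<noteq> 0" using z by (auto simp: Q_def)
    have "cmod z ^ 2 = 10 * (Re z)\<^sup>2" using z by (simp add: cmod_power2 power_mult_distrib)
    then have "2 * Re z * Im z = 3/5 * cmod z ^ 2" using z(3) by (simp add: power2_eq_square)
    moreover have "cmod z ^ 4 = cmod z ^ 2 * cmod z ^ 2" by (simp flip: power_add)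
    moreover have "c * r / (r * r) = c / r" if "r \<noteq> 0" for c r :: real using that by simp
    ultimately have "Re (\<i> / z\<^sup>2) = 3/5 / cmod z ^ 2"
      using z0 by (simp only: Re_barrier2[OF z0]) (metis power_not_zero norm_eq_zero)
    then show ?thesis using \<rho>1(2)[OF z(1,2)] z M(1) by (simp add: ReF)
  qed
  have arc: "Re (F z) \<le> M" if z: "z \<in> Q \<rho>0" "cmod z = \<rho>" for z
    using growth[OF z(1)] F_le[OF z(1)] z M by simp
  define S1 where "S1 = {z. 0 < Re z \<and> 3 * Re z < Im z \<and> cmod z < \<rho>}"
  define S2 where "S2 = {z. 0 < Im z \<and> Im z < 3 * Re z \<and> cmod z < \<rho>}"
  have sub: "S1 \<subseteq> Q \<rho>0" "S2 \<subseteq> Q \<rho>0" using \<rho> by (auto simp: S1_def S2_def Q_def)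
  have S_open: "open S1" "open S2"
    unfolding S1_def S2_def by (intro open_Collect_conj open_Collect_less continuous_intros)+
  have bdd: "bounded S1" "bounded S2"
    by (rule bounded_subset[OF bounded_ball[of 0 \<rho>]], auto simp: S1_def S2_def)+
  have fr1: "0 \<le> Re \<zeta>" "3 * Re \<zeta> \<le> Im \<zeta>" "cmod \<zeta> \<le> \<rho>" "\<zeta> \<notin> S1" if "\<zeta> \<in> frontier S1" for \<zeta>
  proof -
    have "closed {z. 0 \<le> Re z \<and> 3 * Re z \<le> Im z \<and> cmod z \<le> \<rho>}"
      by (intro closed_Collect_conj closed_Collect_le continuous_intros)
    then have "closure S1 \<subseteq> {z. 0 \<le> Re z \<and> 3 * Re z \<le> Im z \<and> cmod z \<le> \<rho>}"
      by (intro closure_minimal) (auto simp: S1_def)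
    then show "0 \<le> Re \<zeta>" "3 * Re \<zeta> \<le> Im \<zeta>" "cmod \<zeta> \<le> \<rho>" "\<zeta> \<notin> S1"
      using that S_open by (auto simp: frontier_def interior_open)
  qed
  have fr2: "0 \<le> Im \<zeta>" "Im \<zeta> \<le> 3 * Re \<zeta>" "cmod \<zeta> \<le> \<rho>" "\<zeta> \<notin> S2" if "\<zeta> \<in> frontier S2" for \<zeta>
  proof -
    have "closed {z. 0 \<le> Im z \<and> Im z \<le> 3 * Re z \<and> cmod z \<le> \<rho>}"
      by (intro closed_Collect_conj closed_Collect_le continuous_intros)
    then have "closure S2 \<subseteq> {z. 0 \<le> Im z \<and> Im z \<le> 3 * Re z \<and> cmod z \<le> \<rho>}"
      by (intro closure_minimal) (auto simp: S2_def)
    then show "0 \<le> Im \<zeta>" "Im \<zeta> \<le> 3 * Re \<zeta>" "cmod \<zeta> \<le> \<rho>" "\<zeta> \<notin> S2"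
      using that S_open by (auto simp: frontier_def interior_open)
  qed
  have S1: "Re (F z) \<le> M" if "z \<in> S1" for z
  proof (rule max_principle_barrier[where b = "\<lambda>z. 1 / z ^ 4" and E = "{0}", OF S_open(1) bdd(1) _ _ _ _ _ that])
    show "F holomorphic_on S1" by (rule holomorphic_on_subset[OF Fhol]) (use sub in auto)
    show "(\<lambda>z. 1 / z ^ 4) holomorphic_on S1"
      by (intro holomorphic_intros) (auto simp: S1_def)
    have b4: "1 / (4 * cmod z ^ 4) \<le> Re (1 / z ^ 4)" if "z \<in> S1" for z
      using that by (intro Re_barrier4) (auto simp: S1_def)
    then show "0 \<le> Re (1 / z ^ 4)" if "z \<in> S1" for z
      by (rule order_trans[rotated]) (use that in auto)
    show "\<forall>\<^sub>F z in at \<zeta> within S1. Re (F z) \<le> M + e" if \<zeta>: "\<zeta> \<in> frontier S1 - {0}" and e: "0 < e" for \<zeta> e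
    proof -
      have fr: "0 \<le> Re \<zeta>" "3 * Re \<zeta> \<le> Im \<zeta>" "cmod \<zeta> \<le> \<rho>" "\<zeta> \<notin> S1" "\<zeta> \<noteq> 0" using fr1 \<zeta> by auto
      show ?thesis
      proof (cases "Re \<zeta> = 0")
        case True
        then have "\<zeta> = Complex 0 (Im \<zeta>)" "0 < Im \<zeta>" using fr by (auto simp: complex_eq_iff)
        moreover have "Im \<zeta> < \<rho>0" using fr(3) \<rho> abs_Im_le_cmod[of \<zeta>] by linarith
        ultimately have "\<forall>\<^sub>F z in at \<zeta> within Q \<rho>0. Re (f z) \<le> e" using bottom[of "Im \<zeta>" e] e by simp
        then show ?thesis
          by (intro mono sub) (auto elim!: eventually_mono simp: add_increasing M(1))
      next
        case False
        then have q: "\<zeta> \<in> Q \<rho>0" using fr \<rho> by (auto simp: Q_def)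
        have "Re (F \<zeta>) \<le> M"
        proof (cases "cmod \<zeta> = \<rho>")
          case False
          then show ?thesis using fr \<open>Re \<zeta> \<noteq> 0\<close> \<rho> by (intro ray q) (auto simp: S1_def)
        qed (rule arc[OF q])
        then show ?thesis by (intro inside q e)
      qed
    qed
    show "\<forall>\<^sub>F z in at \<zeta> within S1. Re (F z) \<le> M + \<eta> * Re (1 / z ^ 4)" if "\<zeta> \<in> {0}" and \<eta>: "0 < \<eta>" for \<zeta> \<eta>
    proof -
      have "\<forall>\<^sub>F z in at \<zeta> within S1. z \<in> S1" by (simp add: eventually_at_filter)
      moreover have "\<forall>\<^sub>F z in at \<zeta> within S1. cmod z < \<eta> / (4 * B + 1)"
        using that B unfolding eventually_at
        by (intro exI[of _ "\<eta> / (4 * B + 1)"]) (auto simp: dist_norm)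
      ultimately show ?thesis
      proof eventually_elim
        case (elim z)
        have z0: "0 < cmod z" using elim by (auto simp: S1_def)
        have "cmod z * (4 * B + 1) \<le> \<eta>" using elim B by (simp add: field_simps)
        moreover have "cmod z * (4 * B + 1) = 4 * B * cmod z + cmod z" by (simp add: algebra_simps)
        ultimately have "4 * B * cmod z \<le> \<eta>" using z0 by linarith
        then have "B / cmod z ^ 3 \<le> \<eta> * (1 / (4 * cmod z ^ 4))"
          using z0 by (simp add: field_simps power4_eq_xxxx power3_eq_cube)
        also have "\<dots> \<le> \<eta> * Re (1 / z ^ 4)" using \<eta> b4 elim by (intro mult_left_mono) auto
        finally show ?case using growth[of z] F_le[of z] elim sub M by auto
      qed
    qed
  qed
  have S2: "Re (F z) \<le> M" if "z \<in> S2" for z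
  proof (rule max_principle_barrier[where b = "\<lambda>z. (1 + 3 * \<i>) / z\<^sup>2" and E = "{0}", OF S_open(2) bdd(2) _ _ _ _ _ that])
    show "F holomorphic_on S2" by (rule holomorphic_on_subset[OF Fhol]) (use sub in auto)
    show "(\<lambda>z. (1 + 3 * \<i>) / z\<^sup>2) holomorphic_on S2"
      by (intro holomorphic_intros) (auto simp: S2_def)
    have b2: "1 / cmod z ^ 2 \<le> Re ((1 + 3 * \<i>) / z\<^sup>2)" if "z \<in> S2" for z
      using that by (intro Re_barrier2') (auto simp: S2_def)
    then show "0 \<le> Re ((1 + 3 * \<i>) / z\<^sup>2)" if "z \<in> S2" for z
      by (rule order_trans[rotated]) (use that in auto)
    show "\<forall>\<^sub>F z in at \<zeta> within S2. Re (F z) \<le> M + e" if \<zeta>: "\<zeta> \<in> frontier S2 - {0}" and e: "0 < e" for \<zeta> e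
    proof -
      have fr: "0 \<le> Im \<zeta>" "Im \<zeta> \<le> 3 * Re \<zeta>" "cmod \<zeta> \<le> \<rho>" "\<zeta> \<notin> S2" "\<zeta> \<noteq> 0" using fr2 \<zeta> by auto
      show ?thesis
      proof (cases "Im \<zeta> = 0")
        case True
        then have "\<zeta> = Complex (Re \<zeta>) 0" "0 < Re \<zeta>" using fr by (auto simp: complex_eq_iff)
        moreover have "Re \<zeta> < \<rho>0" using fr(3) \<rho> abs_Re_le_cmod[of \<zeta>] by linarith
        ultimately have "\<forall>\<^sub>F z in at \<zeta> within Q \<rho>0. Re (f z) \<le> C + e" using side[of "Re \<zeta>" e] e by simp
        then show ?thesis
          by (intro mono sub) (use M(2) in \<open>auto elim!: eventually_mono\<close>)
      next
        case False
        then have q: "\<zeta> \<in> Q \<rho>0" using fr \<rho> by (auto simp: Q_def)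
        have "Re (F \<zeta>) \<le> M"
        proof (cases "cmod \<zeta> = \<rho>")
          case False
          then show ?thesis using fr \<open>Im \<zeta> \<noteq> 0\<close> \<rho> by (intro ray q) (auto simp: S2_def)
        qed (rule arc[OF q])
        then show ?thesis by (intro inside q e)
      qed
    qed
    show "\<forall>\<^sub>F z in at \<zeta> within S2. Re (F z) \<le> M + \<eta> * Re ((1 + 3 * \<i>) / z\<^sup>2)" if "\<zeta> \<in> {0}" and \<eta>: "0 < \<eta>" for \<zeta> \<eta>
    proof -
      obtain r where r: "0 < r"
        "\<And>z. z \<in> Q \<rho>0 \<Longrightarrow> cmod z < r \<Longrightarrow> Im z \<le> 3 * Re z \<Longrightarrow> Re (f z) \<le> \<eta> / cmod z ^ 2"
        using cone[OF \<eta>] by auto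
      have "\<forall>\<^sub>F z in at \<zeta> within S2. z \<in> S2" by (simp add: eventually_at_filter)
      moreover have "\<forall>\<^sub>F z in at \<zeta> within S2. cmod z < r"
        using that r unfolding eventually_at by (intro exI[of _ r]) (auto simp: dist_norm)
      ultimately show ?thesis
      proof eventually_elim
        case (elim z)
        have "Re (f z) \<le> \<eta> * (1 / cmod z ^ 2)"
          using r(2)[of z] elim sub by (auto simp: S2_def)
        also have "\<dots> \<le> \<eta> * Re ((1 + 3 * \<i>) / z\<^sup>2)" using \<eta> b2 elim by (intro mult_left_mono) auto
        finally show ?case using F_le[of z] elim sub M by auto
      qed
    qed
  qed
  have "Re (f z) \<le> \<epsilon> * Re (\<i> / z\<^sup>2) + M" if z: "z \<in> Q \<rho>" for z
  proof -
    have q: "z \<in> Q \<rho>0" using z \<rho> by (auto simp: Q_def)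
    consider "z \<in> S1" | "z \<in> S2" | "Im z = 3 * Re z"
      using z less_linear[of "Im z" "3 * Re z"] by (auto simp: S1_def S2_def Q_def)
    then have "Re (F z) \<le> M"
    proof cases
      case 3
      then show ?thesis using z \<rho> by (intro ray q) (auto simp: Q_def)
    qed (use S1 S2 in auto)
    then show ?thesis by (simp add: ReF)
  qed
  then show ?thesis using \<rho> by blast
qed

text \<open>
  By \<open>corner_estimate\<close>, \<open>f\<close> minus \<open>\<epsilon>\<close> times the critical functions of the two corners is bounded above near
  the corners. Two boundary points near which a function is bounded above are removed with the logarithmic
  barrier, which gives the bound \<open>C\<close> with no trace of the constants from the corners; then \<open>\<epsilon>\<close> tends
  to zero. The upper corner is reduced to the lower one by complex conjugation.
\<close>

lemma strip_bound:
  fixes f :: "complex \<Rightarrow> complex" and c d :: real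
  defines "\<Omega> \<equiv> {z. 0 < Re z \<and> Re z < 1 \<and> c < Im z \<and> Im z < d}"
  assumes f: "f holomorphic_on {z. 0 < Re z}" and cd: "c < d" and C: "0 \<le> C" and B: "0 \<le> B"
    and r0: "0 < r0" "r0 < 1" "r0 < d - c"
    and sides: "\<And>t. 0 < t \<Longrightarrow> t \<le> 1 \<Longrightarrow> Re (f (Complex t c)) \<le> C"
      "\<And>t. 0 < t \<Longrightarrow> t \<le> 1 \<Longrightarrow> Re (f (Complex t d)) \<le> C"
    and top: "\<And>s. c \<le> s \<Longrightarrow> s \<le> d \<Longrightarrow> Re (f (Complex 1 s)) \<le> C"
    and bottom: "\<And>s e. c < s \<Longrightarrow> s < d \<Longrightarrow> 0 < e \<Longrightarrow>
        \<forall>\<^sub>F z in at (Complex 0 s) within {z. 0 < Re z}. Re (f z) \<le> e"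
    and growth: "\<And>z. z \<in> \<Omega> \<Longrightarrow> cmod (z - Complex 0 c) < r0 \<Longrightarrow> Re (f z) \<le> B / cmod (z - Complex 0 c) ^ 3"
      "\<And>z. z \<in> \<Omega> \<Longrightarrow> cmod (z - Complex 0 d) < r0 \<Longrightarrow> Re (f z) \<le> B / cmod (z - Complex 0 d) ^ 3"
    and cone: "\<And>\<epsilon>. 0 < \<epsilon> \<Longrightarrow> \<exists>\<rho>>0. \<forall>z\<in>\<Omega>. cmod (z - Complex 0 c) < \<rho> \<longrightarrow> Im z - c \<le> 3 * Re z \<longrightarrow>
        Re (f z) \<le> \<epsilon> / cmod (z - Complex 0 c) ^ 2"
      "\<And>\<epsilon>. 0 < \<epsilon> \<Longrightarrow> \<exists>\<rho>>0. \<forall>z\<in>\<Omega>. cmod (z - Complex 0 d) < \<rho> \<longrightarrow> d - Im z \<le> 3 * Re z \<longrightarrow>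
        Re (f z) \<le> \<epsilon> / cmod (z - Complex 0 d) ^ 2"
    and z: "z \<in> \<Omega>"
  shows "Re (f z) \<le> C"
proof -
  define H where "H = {z. 0 < Re z}"
  have openH: "open H" unfolding H_def by (intro open_Collect_less continuous_intros)
  define Q where "Q \<rho> = {z. 0 < Re z \<and> 0 < Im z \<and> cmod z < \<rho>}" for \<rho>
  have open\<Omega>: "open \<Omega>"
    unfolding \<Omega>_def by (intro open_Collect_conj open_Collect_less continuous_intros)
  have \<Omega>H: "\<Omega> \<subseteq> H" by (auto simp: \<Omega>_def H_def)
  have fH: "f holomorphic_on H" using f by (simp add: H_def)
  have cont: "((\<lambda>v. Re (f v)) \<longlongrightarrow> Re (f \<zeta>)) (at \<zeta>)" if "\<zeta> \<in> H" for \<zeta>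
  proof -
    have "continuous (at \<zeta>) f"
      using fH openH that by (meson field_differentiable_imp_continuous_at holomorphic_on_imp_differentiable_at)
    then show ?thesis by (intro tendsto_intros) (simp add: isCont_def)
  qed
  have near: "\<forall>\<^sub>F z in at \<zeta> within S. Re (f z) \<le> M + e" if "\<zeta> \<in> H" "Re (f \<zeta>) \<le> M" "0 < e" for \<zeta> S M e
  proof -
    have "\<forall>\<^sub>F v in at \<zeta>. Re (f v) < M + e"
      using cont[OF that(1)] that by (intro order_tendstoD(2)) auto
    then have "\<forall>\<^sub>F v in at \<zeta> within S. Re (f v) < M + e"
      using at_le[of S UNIV] filter_leD by blast
    then show ?thesis by eventually_elim simp
  qed
  have corner_c: "\<exists>\<rho> M. 0 < \<rho> \<and> (\<forall>z\<in>\<Omega>. cmod (z - Complex 0 c) < \<rho> \<longrightarrow>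
      Re (f z) \<le> \<epsilon> * Re (\<i> / (z - Complex 0 c)\<^sup>2) + M)" if \<epsilon>: "0 < \<epsilon>" for \<epsilon>
  proof -
    define g where "g w = f (w + Complex 0 c)" for w
    have in\<Omega>: "w + Complex 0 c \<in> \<Omega>" if "w \<in> Q r0" for w
      using that r0 abs_Re_le_cmod[of w] abs_Im_le_cmod[of w] by (auto simp: Q_def \<Omega>_def)
    have lim: "filterlim (\<lambda>w. w + Complex 0 c) (at (\<zeta> + Complex 0 c) within H) (at \<zeta> within Q r0)" for \<zeta>
    proof -
      have "\<forall>\<^sub>F w in at \<zeta> within Q r0. w + Complex 0 c \<noteq> \<zeta> + Complex 0 c \<and> w + Complex 0 c \<in> H"
        by (auto simp: eventually_at_filter Q_def H_def)
      moreover have "((\<lambda>w. w + Complex 0 c) \<longlongrightarrow> \<zeta> + Complex 0 c) (at \<zeta> within Q r0)"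
        by (intro tendsto_intros)
      ultimately show ?thesis by (simp add: filterlim_at eventually_conj_iff)
    qed
    have "\<exists>\<rho> M. 0 < \<rho> \<and> \<rho> < r0 \<and> (\<forall>w\<in>Q \<rho>. Re (g w) \<le> \<epsilon> * Re (\<i> / w\<^sup>2) + M)"
    proof (rule corner_estimate[where f = g and C = C, OF _ r0(1) B _ _ _ _ \<epsilon>, folded Q_def])
      have "(\<lambda>w. w + Complex 0 c) ` Q r0 \<subseteq> H" using in\<Omega> \<Omega>H by auto
      moreover have "(\<lambda>w. w + Complex 0 c) holomorphic_on Q r0"
        by (intro holomorphic_intros)
      ultimately show "g holomorphic_on Q r0"
        unfolding g_def using holomorphic_on_compose_gen[OF _ fH] by (auto simp: o_def)
      show "Re (g w) \<le> B / cmod w ^ 3" if "w \<in> Q r0" for w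
        using growth(1)[OF in\<Omega>[OF that]] that by (simp add: g_def Q_def)
      show "\<forall>\<^sub>F w in at (Complex 0 s) within Q r0. Re (g w) \<le> e" if "0 < s" "s < r0" "0 < e" for s e
      proof -
        have "Complex 0 s + Complex 0 c = Complex 0 (s + c)" by (simp add: complex_eq_iff)
        then have "\<forall>\<^sub>F z in at (Complex 0 s + Complex 0 c) within H. Re (f z) \<le> e"
          using bottom[of "s + c" e] that r0 by (simp add: H_def)
        then show ?thesis unfolding g_def by (rule eventually_compose_filterlim[OF _ lim])
      qed
      show "\<forall>\<^sub>F w in at (Complex t 0) within Q r0. Re (g w) \<le> C + e" if "0 < t" "t < r0" "0 < e" for t e
      proof -
        have "Complex t 0 + Complex 0 c = Complex t c" by (simp add: complex_eq_iff)
        then have "\<forall>\<^sub>F z in at (Complex t 0 + Complex 0 c) within H. Re (f z) \<le> C + e"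
          using that r0 sides(1)[of t] by (intro near) (auto simp: H_def)
        then show ?thesis unfolding g_def by (rule eventually_compose_filterlim[OF _ lim])
      qed
      show "\<exists>\<rho>>0. \<forall>w\<in>Q r0. cmod w < \<rho> \<longrightarrow> Im w \<le> 3 * Re w \<longrightarrow> Re (g w) \<le> e / cmod w ^ 2" if e: "0 < e" for e
      proof -
        obtain \<rho> where \<rho>: "0 < \<rho>" "\<And>z. z \<in> \<Omega> \<Longrightarrow> cmod (z - Complex 0 c) < \<rho> \<Longrightarrow> Im z - c \<le> 3 * Re z \<Longrightarrow>
            Re (f z) \<le> e / cmod (z - Complex 0 c) ^ 2"
          using cone(1)[OF e] by blast
        show ?thesis
          using \<rho>(1) \<rho>(2)[OF in\<Omega>] by (intro exI[of _ \<rho>]) (auto simp: g_def)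
      qed
    qed
    then obtain \<rho> M where \<rho>: "0 < \<rho>" "\<rho> < r0" "\<And>w. w \<in> Q \<rho> \<Longrightarrow> Re (g w) \<le> \<epsilon> * Re (\<i> / w\<^sup>2) + M" by blast
    have "Re (f z) \<le> \<epsilon> * Re (\<i> / (z - Complex 0 c)\<^sup>2) + M" if "z \<in> \<Omega>" "cmod (z - Complex 0 c) < \<rho>" for z
      using \<rho>(3)[of "z - Complex 0 c"] that by (simp add: Q_def \<Omega>_def g_def)
    then show ?thesis using \<rho>(1) by blast
  qed
  have corner_d: "\<exists>\<rho> M. 0 < \<rho> \<and> (\<forall>z\<in>\<Omega>. cmod (z - Complex 0 d) < \<rho> \<longrightarrow>
      Re (f z) \<le> \<epsilon> * Re (- \<i> / (z - Complex 0 d)\<^sup>2) + M)" if \<epsilon>: "0 < \<epsilon>" for \<epsilon>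
  proof -
    define j where "j w = cnj w + Complex 0 d" for w
    define g where "g w = cnj (f (j w))" for w
    have Re_g: "Re (g w) = Re (f (j w))" for w by (simp add: g_def)
    have j_dist: "cmod (j w - Complex 0 d) = cmod w" for w by (simp add: j_def)
    have in\<Omega>: "j w \<in> \<Omega>" if "w \<in> Q r0" for w
      using that r0 abs_Re_le_cmod[of w] abs_Im_le_cmod[of w] by (auto simp: Q_def \<Omega>_def j_def)
    have lim: "filterlim j (at (j \<zeta>) within H) (at \<zeta> within Q r0)" for \<zeta>
    proof -
      have "\<forall>\<^sub>F w in at \<zeta> within Q r0. j w \<noteq> j \<zeta> \<and> j w \<in> H"
        by (auto simp: eventually_at_filter Q_def H_def j_def)
      moreover have "(j \<longlongrightarrow> j \<zeta>) (at \<zeta> within Q r0)"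
        unfolding j_def by (intro tendsto_intros)
      ultimately show ?thesis by (simp add: filterlim_at eventually_conj_iff)
    qed
    have "\<exists>\<rho> M. 0 < \<rho> \<and> \<rho> < r0 \<and> (\<forall>w\<in>Q \<rho>. Re (g w) \<le> \<epsilon> * Re (\<i> / w\<^sup>2) + M)"
    proof (rule corner_estimate[where f = g and C = C, OF _ r0(1) B _ _ _ _ \<epsilon>, folded Q_def])
      have openQ: "open (Q r0)"
        unfolding Q_def by (intro open_Collect_conj open_Collect_less continuous_intros)
      have "(\<lambda>w. w + Complex 0 d) ` cnj ` Q r0 \<subseteq> H" using in\<Omega> \<Omega>H by (auto simp: j_def)
      moreover have "(\<lambda>w. w + Complex 0 d) holomorphic_on cnj ` Q r0"
        by (intro holomorphic_intros)
      ultimately have "(\<lambda>w. f (w + Complex 0 d)) holomorphic_on cnj ` Q r0"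
        using holomorphic_on_compose_gen[OF _ fH] by (auto simp: o_def)
      from holomorphic_on_compose_cnj_cnj[OF this openQ]
      show "g holomorphic_on Q r0" by (simp add: o_def g_def[abs_def] j_def)
      show "Re (g w) \<le> B / cmod w ^ 3" if "w \<in> Q r0" for w
        using growth(2)[OF in\<Omega>[OF that]] that by (simp add: Re_g Q_def j_dist)
      show "\<forall>\<^sub>F w in at (Complex 0 s) within Q r0. Re (g w) \<le> e" if "0 < s" "s < r0" "0 < e" for s e
      proof -
        have "j (Complex 0 s) = Complex 0 (d - s)" by (simp add: j_def complex_eq_iff)
        then have "\<forall>\<^sub>F z in at (j (Complex 0 s)) within H. Re (f z) \<le> e"
          using bottom[of "d - s" e] that r0 by (simp add: H_def)
        then show ?thesis unfolding Re_g by (rule eventually_compose_filterlim[OF _ lim])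
      qed
      show "\<forall>\<^sub>F w in at (Complex t 0) within Q r0. Re (g w) \<le> C + e" if "0 < t" "t < r0" "0 < e" for t e
      proof -
        have "j (Complex t 0) = Complex t d" by (simp add: j_def complex_eq_iff)
        then have "\<forall>\<^sub>F z in at (j (Complex t 0)) within H. Re (f z) \<le> C + e"
          using that r0 sides(2)[of t] by (intro near) (auto simp: H_def)
        then show ?thesis unfolding Re_g by (rule eventually_compose_filterlim[OF _ lim])
      qed
      show "\<exists>\<rho>>0. \<forall>w\<in>Q r0. cmod w < \<rho> \<longrightarrow> Im w \<le> 3 * Re w \<longrightarrow> Re (g w) \<le> e / cmod w ^ 2" if e: "0 < e" for e
      proof -
        obtain \<rho> where \<rho>: "0 < \<rho>" "\<And>z. z \<in> \<Omega> \<Longrightarrow> cmod (z - Complex 0 d) < \<rho> \<Longrightarrow> d - Im z \<le> 3 * Re z \<Longrightarrow>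
            Re (f z) \<le> e / cmod (z - Complex 0 d) ^ 2"
          using cone(2)[OF e] by blast
        have "d - Im (j w) = Im w" "Re (j w) = Re w" for w by (simp_all add: j_def)
        then show ?thesis
          using \<rho>(1) \<rho>(2)[OF in\<Omega>, unfolded j_dist] by (intro exI[of _ \<rho>]) (auto simp: Re_g)
      qed
    qed
    then obtain \<rho> M where \<rho>: "0 < \<rho>" "\<rho> < r0" "\<And>w. w \<in> Q \<rho> \<Longrightarrow> Re (g w) \<le> \<epsilon> * Re (\<i> / w\<^sup>2) + M" by blast
    have "Re (f z) \<le> \<epsilon> * Re (- \<i> / (z - Complex 0 d)\<^sup>2) + M" if "z \<in> \<Omega>" "cmod (z - Complex 0 d) < \<rho>" for z
    proof -
      define w where "w = cnj (z - Complex 0 d)"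
      have w: "w \<in> Q \<rho>" "j w = z"
        using that complex_mod_cnj[of "z - Complex 0 d"]
        by (auto simp: w_def Q_def \<Omega>_def j_def complex_eq_iff simp del: complex_mod_cnj)
      have "\<i> / w\<^sup>2 = cnj (- \<i> / (z - Complex 0 d)\<^sup>2)" by (simp add: w_def)
      then have eq: "Re (\<i> / w\<^sup>2) = Re (- \<i> / (z - Complex 0 d)\<^sup>2)" by (simp only: cnj.simps(1))
      show ?thesis using \<rho>(3)[OF w(1)] unfolding Re_g w(2) eq .
    qed
    then show ?thesis using \<rho>(1) by blast
  qed
  define bc where "bc z = \<i> / (z - Complex 0 c)\<^sup>2" for z
  define bd where "bd z = - \<i> / (z - Complex 0 d)\<^sup>2" for z
  have bc0: "0 \<le> Re (bc z)" if "z \<in> \<Omega>" for z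
  proof -
    have "z - Complex 0 c \<noteq> 0" using that by (auto simp: \<Omega>_def)
    then show ?thesis using that by (auto simp: bc_def Re_barrier2 \<Omega>_def)
  qed
  have bd0: "0 \<le> Re (bd z)" if "z \<in> \<Omega>" for z
  proof -
    have "cnj (z - Complex 0 d) \<noteq> 0" using that by (auto simp: \<Omega>_def complex_eq_iff)
    moreover have "Re (bd z) = Re (\<i> / (cnj (z - Complex 0 d))\<^sup>2)"
      unfolding bd_def by (metis complex_cnj_cnj complex_cnj_divide complex_cnj_i complex_cnj_minus complex_cnj_power
        cnj.simps(1) minus_minus)
    ultimately show ?thesis
      using that by (auto simp: Re_barrier2 \<Omega>_def intro!: divide_nonneg_nonneg mult_nonneg_nonneg)
  qed
  have main: "Re (f z) \<le> C + \<epsilon> * (Re (bc z) + Re (bd z))" if \<epsilon>: "0 < \<epsilon>" for \<epsilon>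
  proof -
    define F where "F z = f z - of_real \<epsilon> * bc z - of_real \<epsilon> * bd z" for z
    have ReF: "Re (F z) = Re (f z) - \<epsilon> * Re (bc z) - \<epsilon> * Re (bd z)" for z
      by (simp add: F_def)
    have F_le: "Re (F z) \<le> Re (f z)" if "z \<in> \<Omega>" for z
      using mult_nonneg_nonneg[OF less_imp_le[OF \<epsilon>] bc0[OF that]]
        mult_nonneg_nonneg[OF less_imp_le[OF \<epsilon>] bd0[OF that]] by (simp add: ReF)
    have mono: "\<forall>\<^sub>F z in at \<zeta> within \<Omega>. Re (F z) \<le> C + e"
      if "\<forall>\<^sub>F z in at \<zeta> within H. Re (f z) \<le> C + e" for \<zeta> e
    proof -
      have "\<forall>\<^sub>F z in at \<zeta> within \<Omega>. Re (f z) \<le> C + e"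
        using that \<Omega>H at_le filter_leD by blast
      moreover have "\<forall>\<^sub>F z in at \<zeta> within \<Omega>. z \<in> \<Omega>"
        by (simp add: eventually_at_filter)
      ultimately show ?thesis by eventually_elim (use F_le in force)
    qed
    define R where "R = 2 + (d - c)"
    have R: "0 < R" using cd by (simp add: R_def)
    define b where "b z = - Ln ((z - Complex 0 c) / of_real R) - Ln ((z - Complex 0 d) / of_real R)" for z
    have le_R: "cmod (z - Complex 0 c) \<le> R" "cmod (z - Complex 0 d) \<le> R"
      "z - Complex 0 c \<noteq> 0" "z - Complex 0 d \<noteq> 0" if "z \<in> \<Omega>" for z
      using that cmod_le[of "z - Complex 0 c"] cmod_le[of "z - Complex 0 d"] by (auto simp: \<Omega>_def R_def)
    have Re_b: "Re (b z) = - ln (cmod (z - Complex 0 c) / R) - ln (cmod (z - Complex 0 d) / R)" if "z \<in> \<Omega>" for z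
      using le_R[OF that] R by (simp add: b_def Re_Ln norm_divide)
    have ln_neg: "ln (cmod (z - Complex 0 c) / R) \<le> 0" "ln (cmod (z - Complex 0 d) / R) \<le> 0" if "z \<in> \<Omega>" for z
      using le_R[OF that] R by (simp_all add: ln_le_zero_iff divide_le_eq_1)
    have "Re (F z) \<le> C"
    proof (rule max_principle_barrier[where E = "{Complex 0 c, Complex 0 d}" and b = b, OF open\<Omega> _ _ _ _ _ _ z])
      show "bounded \<Omega>"
        by (rule bounded_subset[OF bounded_cball[of "Complex 0 c" R]])
          (use le_R in \<open>auto simp: dist_norm norm_minus_commute\<close>)
      show "F holomorphic_on \<Omega>"
        unfolding F_def bc_def bd_def using holomorphic_on_subset[OF fH \<Omega>H] le_R
        by (intro holomorphic_intros) auto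
      show "b holomorphic_on \<Omega>"
        unfolding b_def using R
        by (intro holomorphic_intros) (auto simp: \<Omega>_def complex_nonpos_Reals_iff)
      show "0 \<le> Re (b z)" if "z \<in> \<Omega>" for z
        using ln_neg[OF that] by (simp add: Re_b[OF that])
      show "\<forall>\<^sub>F z in at \<zeta> within \<Omega>. Re (F z) \<le> C + e"
        if \<zeta>: "\<zeta> \<in> frontier \<Omega> - {Complex 0 c, Complex 0 d}" and e: "0 < e" for \<zeta> e
      proof -
        have "closed {z. 0 \<le> Re z \<and> Re z \<le> 1 \<and> c \<le> Im z \<and> Im z \<le> d}"
          by (intro closed_Collect_conj closed_Collect_le continuous_intros)
        then have "closure \<Omega> \<subseteq> {z. 0 \<le> Re z \<and> Re z \<le> 1 \<and> c \<le> Im z \<and> Im z \<le> d}"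
          by (intro closure_minimal) (auto simp: \<Omega>_def)
        then have fr: "0 \<le> Re \<zeta>" "Re \<zeta> \<le> 1" "c \<le> Im \<zeta>" "Im \<zeta> \<le> d" "\<zeta> \<notin> \<Omega>"
          using \<zeta> open\<Omega> by (auto simp: frontier_def interior_open)
        have \<zeta>_eq: "\<zeta> = Complex (Re \<zeta>) (Im \<zeta>)" by simp
        show ?thesis
        proof (cases "Re \<zeta> = 0")
          case True
          then have "\<zeta> = Complex 0 (Im \<zeta>)" by (simp add: complex_eq_iff)
          moreover from this have "Im \<zeta> \<noteq> c" "Im \<zeta> \<noteq> d" using \<zeta> by auto
          ultimately have "\<forall>\<^sub>F z in at \<zeta> within H. Re (f z) \<le> e"
            using bottom[of "Im \<zeta>" e] fr e by (simp add: H_def)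
          then show ?thesis by (intro mono) (auto elim!: eventually_mono simp: add_increasing C)
        next
          case False
          then have pos: "0 < Re \<zeta>" using fr by simp
          consider "Re \<zeta> = 1" | "Im \<zeta> = c" | "Im \<zeta> = d" using fr pos by (force simp: \<Omega>_def)
          then have "Re (f \<zeta>) \<le> C"
            by cases (use fr pos \<zeta>_eq top[of "Im \<zeta>"] sides[of "Re \<zeta>"] in metis)+
          then show ?thesis using pos e by (intro mono near) (auto simp: H_def)
        qed
      qed
      show "\<forall>\<^sub>F z in at \<zeta> within \<Omega>. Re (F z) \<le> C + \<eta> * Re (b z)"
        if \<zeta>: "\<zeta> \<in> {Complex 0 c, Complex 0 d}" and \<eta>: "0 < \<eta>" for \<zeta> \<eta>
      proof -
        obtain \<rho> M where \<rho>: "0 < \<rho>" and M: "\<And>z. z \<in> \<Omega> \<Longrightarrow> cmod (z - \<zeta>) < \<rho> \<Longrightarrow> Re (F z) \<le> M"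
        proof (cases "\<zeta> = Complex 0 c")
          case True
          obtain \<rho> M where *: "0 < \<rho>" "\<And>z. z \<in> \<Omega> \<Longrightarrow> cmod (z - Complex 0 c) < \<rho> \<Longrightarrow>
              Re (f z) \<le> \<epsilon> * Re (\<i> / (z - Complex 0 c)\<^sup>2) + M"
            using corner_c[OF \<epsilon>] by blast
          have "Re (F z) \<le> M" if "z \<in> \<Omega>" "cmod (z - \<zeta>) < \<rho>" for z
            using *(2)[of z] that mult_nonneg_nonneg[OF less_imp_le[OF \<epsilon>] bd0[OF that(1)]] True
            by (simp add: ReF bc_def)
          then show ?thesis using that *(1) by blast
        next
          case False
          then have True: "\<zeta> = Complex 0 d" using \<zeta> by auto
          obtain \<rho> M where *: "0 < \<rho>" "\<And>z. z \<in> \<Omega> \<Longrightarrow> cmod (z - Complex 0 d) < \<rho> \<Longrightarrow>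
              Re (f z) \<le> \<epsilon> * Re (- \<i> / (z - Complex 0 d)\<^sup>2) + M"
            using corner_d[OF \<epsilon>] by blast
          have "Re (F z) \<le> M" if "z \<in> \<Omega>" "cmod (z - \<zeta>) < \<rho>" for z
            using *(2)[of z] that mult_nonneg_nonneg[OF less_imp_le[OF \<epsilon>] bc0[OF that(1)]] True
            by (simp add: ReF bd_def)
          then show ?thesis using that *(1) by blast
        qed
        \<comment> \<open>Within distance \<open>r\<close> of the corner the logarithmic barrier is at least \<open>|M - C| / \<eta>\<close>.\<close>
        define r where "r = min \<rho> (R * exp (- (\<bar>M - C\<bar> / \<eta>)))"
        have r: "0 < r" using \<rho> R by (simp add: r_def)
        have "\<forall>\<^sub>F z in at \<zeta> within \<Omega>. z \<in> \<Omega>" by (simp add: eventually_at_filter)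
        moreover have "\<forall>\<^sub>F z in at \<zeta> within \<Omega>. cmod (z - \<zeta>) < r"
          using r unfolding eventually_at by (intro exI[of _ r]) (auto simp: dist_norm)
        ultimately show ?thesis
        proof eventually_elim
          case (elim z)
          have z0: "0 < cmod (z - \<zeta>)" using le_R[OF elim(1)] \<zeta> by auto
          have "cmod (z - \<zeta>) / R \<le> exp (- (\<bar>M - C\<bar> / \<eta>))"
            using elim(2) R by (simp add: r_def field_simps)
          then have "ln (cmod (z - \<zeta>) / R) \<le> - (\<bar>M - C\<bar> / \<eta>)"
            using z0 R by (metis divide_pos_pos exp_gt_zero ln_exp ln_le_cancel_iff)
          moreover have "- ln (cmod (z - \<zeta>) / R) \<le> Re (b z)"
            using \<zeta> ln_neg[OF elim(1)] Re_b[OF elim(1)] by auto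
          ultimately have "\<bar>M - C\<bar> / \<eta> \<le> Re (b z)" by linarith
          then have "\<bar>M - C\<bar> \<le> \<eta> * Re (b z)" using \<eta> by (simp add: field_simps)
          moreover have "Re (F z) \<le> M" using M elim by (simp add: r_def)
          ultimately show ?case by linarith
        qed
      qed
    qed
    then show ?thesis by (simp add: ReF algebra_simps)
  qed
  show ?thesis
  proof (rule tendsto_lowerbound)
    have "((\<lambda>\<epsilon>. C + \<epsilon> * (Re (bc z) + Re (bd z))) \<longlongrightarrow> C + 0 * (Re (bc z) + Re (bd z))) (at_right 0)"
      by (intro tendsto_intros)
    then show "((\<lambda>\<epsilon>. C + \<epsilon> * (Re (bc z) + Re (bd z))) \<longlongrightarrow> C) (at_right 0)" by simp
    show "\<forall>\<^sub>F \<epsilon> in at_right 0. Re (f z) \<le> C + \<epsilon> * (Re (bc z) + Re (bd z))"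
      using main by (auto simp: eventually_at_filter)
  qed simp
qed

section \<open>Continuation by reflection\<close>

text \<open>
  The Cauchy estimate for \<open>exp f\<close>, whose modulus lies between \<open>exp (- C)\<close> and \<open>exp C\<close>.
\<close>

lemma deriv_bound_from_Re_bound:
  assumes hol: "f holomorphic_on ball z r" and r: "0 < r"
    and C: "\<And>w. w \<in> ball z r \<Longrightarrow> \<bar>Re (f w)\<bar> \<le> C"
  shows "cmod (deriv f z) \<le> 2 * exp (2 * C) / r"
proof -
  have sub: "cball z (r/2) \<subseteq> ball z r" using r by (auto simp: mem_ball)
  have d: "(f has_field_derivative deriv f z) (at z)"
    using hol r by (meson centre_in_ball holomorphic_derivI open_ball)
  have ehol: "(\<lambda>w. exp (f w)) holomorphic_on ball z r"
    using hol by (intro holomorphic_intros)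
  have "cmod ((deriv ^^ 1) (\<lambda>w. exp (f w)) z) \<le> fact 1 * exp C / (r/2) ^ 1"
  proof (rule Cauchy_inequality)
    show "(\<lambda>w. exp (f w)) holomorphic_on ball z (r/2)"
      using ehol by (rule holomorphic_on_subset) (use sub ball_subset_cball in blast)
    show "continuous_on (cball z (r/2)) (\<lambda>w. exp (f w))"
      using ehol sub holomorphic_on_imp_continuous_on holomorphic_on_subset by blast
    show "cmod (exp (f w)) \<le> exp C" if "cmod (z - w) = r/2" for w
      using C[of w] that r by (simp add: dist_norm abs_le_iff)
  qed (use r in simp)
  moreover have "deriv (\<lambda>w. exp (f w)) z = exp (f z) * deriv f z"
    by (rule DERIV_imp_deriv) (auto intro!: derivative_eq_intros d)
  ultimately have "exp (Re (f z)) * cmod (deriv f z) \<le> 2 * exp C / r"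
    by (simp add: norm_mult mult.commute[of 2])
  moreover have "exp (- C) \<le> exp (Re (f z))"
    using C[of z] r by (simp add: abs_le_iff)
  ultimately have "exp (- C) * cmod (deriv f z) \<le> 2 * exp C / r"
    by (meson mult_right_mono norm_ge_zero order_trans)
  then have "exp C * (exp (- C) * cmod (deriv f z)) \<le> exp C * (2 * exp C / r)"
    by (intro mult_left_mono) auto
  then have "cmod (deriv f z) \<le> exp C * (2 * exp C / r)" by (simp add: mult.assoc[symmetric] exp_add[symmetric])
  also have "\<dots> = 2 * exp (2 * C) / r" by (simp add: exp_double power2_eq_square)
  finally show ?thesis .
qed

text \<open>
  A bounded real part gives \<open>|f'| = O(1 / Re z)\<close>, whence \<open>|f| = O(1 / \<surd>(Re z))\<close>, whence a primitive of \<open>f\<close> is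
  Hoelder continuous up to the imaginary axis. On the line \<open>Re z = \<alpha>\<close> the imaginary part of the primitive has the
  derivative \<open>Re f\<close>, and this tends to zero pointwise and boundedly as \<open>\<alpha> \<rightarrow> 0\<close>. By dominated convergence the imaginary
  part of the primitive is constant on the axis. So the primitive, and with it \<open>f\<close>, is
  continued by Schwarz reflection.
\<close>

lemma reflection_extension:
  fixes f :: "complex \<Rightarrow> complex" and r :: real
  defines "H \<equiv> \<lambda>\<rho>. {z. 0 < Re z \<and> cmod z < \<rho>}"
  assumes f: "f holomorphic_on H r" and r: "0 < r"
    and C: "\<And>z. z \<in> H r \<Longrightarrow> \<bar>Re (f z)\<bar> \<le> C"
    and lim: "\<And>\<beta>. \<bar>\<beta>\<bar> < r \<Longrightarrow> ((\<lambda>\<alpha>. Re (f (Complex \<alpha> \<beta>))) \<longlongrightarrow> 0) (at_right 0)"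
  obtains F where "F holomorphic_on ball 0 (r/16)" "\<And>z. z \<in> H (r/16) \<Longrightarrow> F z = f z"
    "\<And>z. z \<in> ball 0 (r/16) \<Longrightarrow> F (- cnj z) = - cnj (F z)"
proof -
  have openH: "open (H \<rho>)" for \<rho>
    unfolding H_def by (intro open_Collect_conj open_Collect_less continuous_intros)
  have H_eq: "H \<rho> = {z. 0 < Re z} \<inter> ball 0 \<rho>" for \<rho> by (auto simp: H_def)
  have convH: "convex (H \<rho>)" for \<rho>
    unfolding H_eq by (intro convex_Int convex_ball convex_halfspace_Re_gt)
  have df: "(f has_field_derivative deriv f z) (at z)" if "z \<in> H r" for z
    using f openH that by (rule holomorphic_derivI)
  have C0: "0 \<le> C" using C[of "of_real (r/2)"] r by (simp add: H_def)
  \<comment> \<open>The disc with radius \<open>Re z / 2\<close> about \<open>z\<close> stays in the domain; this doubles the constant of the derivative bound.\<close>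
  define B where "B = 4 * exp (2 * C)"
  have B: "0 < B" by (simp add: B_def)
  have deriv_bound: "cmod (deriv f z) \<le> B / Re z" if z: "z \<in> H (r/2)" for z
  proof -
    have sub: "ball z (Re z / 2) \<subseteq> H r"
    proof
      fix w assume w: "w \<in> ball z (Re z / 2)"
      have "\<bar>Re (z - w)\<bar> < Re z / 2"
        using w abs_Re_le_cmod[of "z - w"] by (simp add: dist_norm)
      then have "0 < Re w" using z by (auto simp: H_def abs_if split: if_splits)
      moreover have "cmod w < r"
        using w norm_triangle_ineq2[of w z] abs_Re_le_cmod[of z] z
        by (simp add: dist_norm H_def norm_minus_commute)
      ultimately show "w \<in> H r" by (simp add: H_def)
    qed
    have "cmod (deriv f z) \<le> 2 * exp (2 * C) / (Re z / 2)"
      using z sub C by (intro deriv_bound_from_Re_bound holomorphic_on_subset[OF f]) (auto simp: H_def)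
    then show ?thesis by (simp add: B_def)
  qed
  obtain B0 where B0: "\<And>\<beta>. \<bar>\<beta>\<bar> \<le> r/4 \<Longrightarrow> cmod (f (Complex (r/4) \<beta>)) \<le> B0"
  proof -
    have "continuous_on {-r/4..r/4} (\<lambda>\<beta>. f (Complex (r/4) \<beta>))"
    proof (rule continuous_on_compose2[OF holomorphic_on_imp_continuous_on[OF f]])
      show "continuous_on {-r/4..r/4} (Complex (r/4))"
        unfolding Complex_eq by (intro continuous_intros)
      show "Complex (r/4) ` {-r/4..r/4} \<subseteq> H r"
      proof
        fix z assume "z \<in> Complex (r/4) ` {-r/4..r/4}"
        then show "z \<in> H r" using cmod_le[of z] r by (auto simp: H_def)
      qed
    qed
    then have "bounded ((\<lambda>\<beta>. f (Complex (r/4) \<beta>)) ` {-r/4..r/4})"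
      by (intro compact_imp_bounded compact_continuous_image) auto
    then show ?thesis using that by (force simp: bounded_iff)
  qed
  have B00: "0 \<le> B0" using order_trans[OF norm_ge_zero B0[of 0]] r by simp
  define K where "K = (2 * B + B0) * sqrt (r/4)"
  have K: "0 \<le> K" using B B00 r by (simp add: K_def)
  have f_bound: "cmod (f z) \<le> K / sqrt (Re z)" if z: "z \<in> H (r/4)" for z
  proof -
    define a b where "a = Re z" and "b = Im z"
    have ab: "0 < a" "a < r/4" "\<bar>b\<bar> < r/4"
      using z abs_Re_le_cmod[of z] abs_Im_le_cmod[of z] by (auto simp: a_def b_def H_def)
    have inH: "Complex t b \<in> H (r/2)" if "0 < t" "t \<le> r/4" for t
      using cmod_le[of "Complex t b"] that ab by (auto simp: H_def)
    have inH': "Complex t b \<in> H r" if "0 < t" "t \<le> r/4" for t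
      using inH[OF that] r by (auto simp: H_def)
    have der: "((\<lambda>t. f (Complex t b)) has_vector_derivative deriv f (Complex t b)) (at t)" if "0 < t" "t \<le> r/4" for t
    proof -
      have 1: "((\<lambda>t. Complex t b) has_vector_derivative 1) (at t)"
        unfolding Complex_eq by (auto intro!: derivative_eq_intros)
      show ?thesis
        using field_vector_diff_chain_at[OF 1 df[OF inH'[OF that]]] by (simp add: o_def)
    qed
    have "cmod (f (Complex (r/4) b) - f (Complex a b)) \<le> B * ln (r/4) - B * ln a"
    proof (rule differentiable_bound_general[where f' = "\<lambda>t. deriv f (Complex t b)" and \<phi>' = "\<lambda>t. B / t"])
      show "continuous_on {a..r/4} (\<lambda>t. f (Complex t b))"
        using ab by (intro continuous_at_imp_continuous_on ballI has_vector_derivative_continuous[OF der]) auto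
      show "continuous_on {a..r/4} (\<lambda>t. B * ln t)"
        using ab by (intro continuous_intros) auto
      show "((\<lambda>t. B * ln t) has_vector_derivative B / t) (at t)" if "a < t" "t < r/4" for t
        unfolding has_real_derivative_iff_has_vector_derivative[symmetric]
        using ab that by (auto intro!: derivative_eq_intros)
      show "cmod (deriv f (Complex t b)) \<le> B / t" if "a < t" "t < r/4" for t
        using deriv_bound[OF inH[of t]] that ab by simp
    qed (use ab der in auto)
    also have "\<dots> = B * ln ((r/4) / a)"
    proof -
      have "ln ((r/4) / a) = ln (r/4) - ln a" using ab by (intro ln_divide_pos) auto
      then show ?thesis by (simp only: right_diff_distrib)
    qed
    also have "\<dots> = B * (2 * ln (sqrt ((r/4) / a)))"
      using ab by (subst ln_sqrt) auto
    also have "\<dots> \<le> B * (2 * sqrt ((r/4) / a))"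
      using ab r B less_imp_le[OF ln_less_self[of "sqrt ((r/4) / a)"]] by (intro mult_left_mono) simp_all
    finally have 1: "cmod (f (Complex (r/4) b) - f z) \<le> 2 * B * sqrt ((r/4) / a)"
      by (simp add: a_def b_def)
    have "B0 * 1 \<le> B0 * sqrt ((r/4) / a)"
      using ab B00 by (intro mult_left_mono) auto
    then have 2: "cmod (f (Complex (r/4) b)) \<le> B0 * sqrt ((r/4) / a)"
      using B0[of b] ab by simp
    have "cmod (f z) \<le> cmod (f (Complex (r/4) b)) + cmod (f (Complex (r/4) b) - f z)"
      using norm_triangle_ineq4[of "f (Complex (r/4) b)" "f (Complex (r/4) b) - f z"] by simp
    also have "\<dots> \<le> (2 * B + B0) * sqrt ((r/4) / a)" using 1 2 by (simp add: algebra_simps)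
    also have "\<dots> = K / sqrt (Re z)" by (simp only: K_def a_def real_sqrt_divide times_divide_eq_right)
    finally show ?thesis .
  qed
  obtain F1 where F1: "\<And>z. z \<in> H r \<Longrightarrow> (F1 has_field_derivative f z) (at z)"
    using holomorphic_convex_primitive'[OF convH openH f] at_within_open[OF _ openH] by metis
  define \<rho> where "\<rho> = r / 16"
  have \<rho>: "0 < \<rho>" using r by (simp add: \<rho>_def)
  \<comment> \<open>To compare two points at distance \<open>\<delta>\<close>, move both away from the axis by \<open>\<delta>\<close>: there \<open>|f| = O(\<delta>\<^sup>-\<^sup>1\<^sup>/\<^sup>2)\<close>.\<close>
  have up: "cmod (F1 (z + of_real \<delta>) - F1 z) \<le> 2 * K * sqrt \<delta>" if z: "z \<in> H \<rho>" and \<delta>: "0 < \<delta>" "\<delta> \<le> 2 * \<rho>" for z \<delta>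
  proof -
    have inH: "z + of_real t \<in> H (r/4)" if "0 \<le> t" "t \<le> \<delta>" for t
    proof -
      have "cmod (z + of_real t) \<le> cmod z + t"
        using norm_triangle_ineq[of z "of_real t"] that by simp
      then show ?thesis using that z \<delta> by (auto simp: H_def \<rho>_def)
    qed
    have der: "((\<lambda>t. F1 (z + of_real t)) has_vector_derivative f (z + of_real t)) (at t)" if "0 \<le> t" "t \<le> \<delta>" for t
    proof -
      have 1: "((\<lambda>t. z + of_real t) has_vector_derivative 1) (at t)"
        by (auto intro!: derivative_eq_intros)
      have "z + of_real t \<in> H r" using inH[OF that] r by (auto simp: H_def)
      from field_vector_diff_chain_at[OF 1 F1[OF this]] show ?thesis by (simp add: o_def)
    qed
    have "cmod (F1 (z + of_real \<delta>) - F1 (z + of_real 0)) \<le> 2 * K * sqrt \<delta> - 2 * K * sqrt 0"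
    proof (rule differentiable_bound_general[where f' = "\<lambda>t. f (z + of_real t)" and \<phi>' = "\<lambda>t. K / sqrt t"])
      show "continuous_on {0..\<delta>} (\<lambda>t. F1 (z + of_real t))"
        by (intro continuous_at_imp_continuous_on ballI has_vector_derivative_continuous[OF der]) auto
      show "continuous_on {0..\<delta>} (\<lambda>t. 2 * K * sqrt t)" by (intro continuous_intros)
      show "((\<lambda>t. 2 * K * sqrt t) has_vector_derivative K / sqrt t) (at t)" if "0 < t" "t < \<delta>" for t
        unfolding has_real_derivative_iff_has_vector_derivative[symmetric]
        using that by (auto intro!: derivative_eq_intros simp: field_simps)
      show "cmod (f (z + of_real t)) \<le> K / sqrt t" if t: "0 < t" "t < \<delta>" for t
      proof -
        have "cmod (f (z + of_real t)) \<le> K / sqrt (Re (z + of_real t))"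
          using inH[of t] t by (intro f_bound) auto
        also have "\<dots> \<le> K / sqrt t"
          using t z K by (intro divide_left_mono) (auto simp: H_def)
        finally show ?thesis .
      qed
    qed (use \<delta> der in auto)
    then show ?thesis by simp
  qed
  have holder: "cmod (F1 z - F1 w) \<le> 5 * K * sqrt (cmod (z - w))" if z: "z \<in> H \<rho>" and w: "w \<in> H \<rho>" for z w
  proof (cases "z = w")
    case False
    define \<delta> where "\<delta> = cmod (z - w)"
    have \<delta>: "0 < \<delta>" "\<delta> \<le> 2 * \<rho>"
      using False norm_triangle_ineq4[of z w] z w by (auto simp: \<delta>_def H_def)
    define S where "S = {v. \<delta> \<le> Re v} \<inter> ball 0 (r/4)"
    have SH: "S \<subseteq> H (r/4)" using \<delta> by (auto simp: S_def H_def)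
    have inS: "v + of_real \<delta> \<in> S" if "v \<in> H \<rho>" for v
    proof -
      have "cmod (v + of_real \<delta>) \<le> cmod v + \<delta>"
        using norm_triangle_ineq[of v "of_real \<delta>"] \<delta> by simp
      then show ?thesis using that \<delta> r by (auto simp: H_def \<rho>_def S_def)
    qed
    have "cmod (F1 (z + of_real \<delta>) - F1 (w + of_real \<delta>)) \<le> K / sqrt \<delta> * cmod ((z + of_real \<delta>) - (w + of_real \<delta>))"
    proof (rule field_differentiable_bound[where S = S and f' = f])
      show "convex S" unfolding S_def by (intro convex_Int convex_ball convex_halfspace_Re_ge)
      show "(F1 has_field_derivative f v) (at v within S)" if "v \<in> S" for v
      proof (rule has_field_derivative_at_within[OF F1])
        have "v \<in> H (r/4)" using that SH by blast
        then show "v \<in> H r" using r by (simp add: H_def)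
      qed
      show "cmod (f v) \<le> K / sqrt \<delta>" if "v \<in> S" for v
      proof -
        have "cmod (f v) \<le> K / sqrt (Re v)" using that SH by (intro f_bound) auto
        also have "\<dots> \<le> K / sqrt \<delta>"
          using that \<delta> K by (intro divide_left_mono) (auto simp: S_def)
        finally show ?thesis .
      qed
    qed (use inS z w in auto)
    also have "\<dots> = K * sqrt \<delta>"
      using \<delta> real_div_sqrt[of \<delta>] by (simp add: \<delta>_def[symmetric]) (metis times_divide_eq_right)
    finally have mid: "cmod (F1 (z + of_real \<delta>) - F1 (w + of_real \<delta>)) \<le> K * sqrt \<delta>" .
    have "F1 z - F1 w = (F1 (z + of_real \<delta>) - F1 (w + of_real \<delta>))
        - (F1 (z + of_real \<delta>) - F1 z) + (F1 (w + of_real \<delta>) - F1 w)" by (simp only: algebra_simps)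
    also have "cmod \<dots> \<le> cmod (F1 (z + of_real \<delta>) - F1 (w + of_real \<delta>))
        + cmod (F1 (z + of_real \<delta>) - F1 z) + cmod (F1 (w + of_real \<delta>) - F1 w)"
      by (rule order_trans[OF norm_triangle_ineq add_right_mono[OF norm_triangle_ineq4]])
    also have "\<dots> \<le> K * sqrt \<delta> + 2 * K * sqrt \<delta> + 2 * K * sqrt \<delta>"
      using mid up[OF z \<delta>] up[OF w \<delta>] by linarith
    finally show ?thesis by (simp add: \<delta>_def)
  qed simp
  have "uniformly_continuous_on (H \<rho>) F1"
    unfolding uniformly_continuous_on_def
  proof (intro allI impI)
    fix e :: real assume e: "0 < e"
    define d where "d = (e / (5 * K + 1))\<^sup>2"
    have d: "0 < d" using e K by (simp add: d_def add_nonneg_pos)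
    show "\<exists>d>0. \<forall>x\<in>H \<rho>. \<forall>x'\<in>H \<rho>. dist x' x < d \<longrightarrow> dist (F1 x') (F1 x) < e"
    proof (intro exI[of _ d] conjI ballI impI)
      show "0 < d" by (rule d)
    next
      fix x x' assume x: "x \<in> H \<rho>" "x' \<in> H \<rho>" "dist x' x < d"
      have "sqrt (cmod (x' - x)) < sqrt d" using x by (simp add: dist_norm)
      also have "sqrt d = e / (5 * K + 1)" using e K by (simp add: d_def)
      finally have s: "sqrt (cmod (x' - x)) * (5 * K + 1) < e" using K by (simp add: field_simps)
      have "cmod (F1 x' - F1 x) \<le> 5 * K * sqrt (cmod (x' - x))" using x by (intro holder) auto
      also have "\<dots> \<le> sqrt (cmod (x' - x)) * (5 * K + 1)" by (simp add: algebra_simps)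
      finally show "dist (F1 x') (F1 x) < e" using s by (simp add: dist_norm)
    qed
  qed
  then obtain G where G: "uniformly_continuous_on (closure (H \<rho>)) G" "\<And>z. z \<in> H \<rho> \<Longrightarrow> F1 z = G z"
    using uniformly_continuous_on_extension_on_closure by metis
  have contG: "continuous_on (closure (H \<rho>)) G"
    using G(1) by (rule uniformly_continuous_imp_continuous)
  define D where "D = {z. 0 \<le> Re z \<and> cmod z < \<rho>}"
  have approach: "(\<lambda>k. Complex ((\<rho> - \<bar>\<beta>\<bar>) / (real k + 2)) \<beta>) \<longlonglongrightarrow> Complex 0 \<beta>" for \<beta>
  proof -
    have "(\<lambda>k. (\<rho> - \<bar>\<beta>\<bar>) / (real k + 2)) \<longlonglongrightarrow> 0" by real_asymp
    then show ?thesis by (intro tendsto_Complex tendsto_const)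
  qed
  have seq_in: "Complex ((\<rho> - \<bar>\<beta>\<bar>) / (real k + 2)) \<gamma> \<in> H \<rho>" if "\<bar>\<beta>\<bar> < \<rho>" "\<bar>\<gamma>\<bar> \<le> \<bar>\<beta>\<bar>" for k \<beta> \<gamma>
  proof -
    have "(\<rho> - \<bar>\<beta>\<bar>) / (real k + 2) \<le> (\<rho> - \<bar>\<beta>\<bar>) / 2" using that by (intro divide_left_mono) auto
    also have "\<dots> < \<rho> - \<bar>\<beta>\<bar>" using that by simp
    finally have "(\<rho> - \<bar>\<beta>\<bar>) / (real k + 2) < \<rho> - \<bar>\<beta>\<bar>" .
    moreover have "0 < (\<rho> - \<bar>\<beta>\<bar>) / (real k + 2)" using that by simp
    ultimately show ?thesis
      using that cmod_le[of "Complex ((\<rho> - \<bar>\<beta>\<bar>) / (real k + 2)) \<gamma>"] by (auto simp: H_def)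
  qed
  have D_closure: "D \<subseteq> closure (H \<rho>)"
  proof
    fix z assume z: "z \<in> D"
    show "z \<in> closure (H \<rho>)"
    proof (cases "Re z = 0")
      case True
      then have "z = Complex 0 (Im z)" "\<bar>Im z\<bar> < \<rho>"
        using z abs_Im_le_cmod[of z] by (auto simp: D_def complex_eq_iff)
      then show ?thesis
        unfolding closure_sequential using seq_in[of "Im z" "Im z"] approach[of "Im z"]
        by (intro exI[of _ "\<lambda>k. Complex ((\<rho> - \<bar>Im z\<bar>) / (real k + 2)) (Im z)"]) auto
    next
      case False
      then have "z \<in> H \<rho>" using z by (auto simp: D_def H_def)
      then show ?thesis using closure_subset by blast
    qed
  qed
  have ImG: "Im (G (Complex 0 \<beta>)) = Im (G 0)" if \<beta>: "\<bar>\<beta>\<bar> < \<rho>" for \<beta>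
  proof -
    define \<alpha> where "\<alpha> k = (\<rho> - \<bar>\<beta>\<bar>) / (real k + 2)" for k
    have in_H: "Complex (\<alpha> k) (t * \<beta>) \<in> H \<rho>" if "0 \<le> t" "t \<le> 1" for k t
      unfolding \<alpha>_def using that \<beta> by (intro seq_in) (auto simp: abs_mult mult_left_le_one_le)
    have lim_G: "(\<lambda>k. F1 (Complex (\<alpha> k) (t * \<beta>))) \<longlonglongrightarrow> G (Complex 0 (t * \<beta>))" if t: "0 \<le> t" "t \<le> 1" for t
    proof -
      have "Complex 0 (t * \<beta>) \<in> closure (H \<rho>)"
      proof (rule subsetD[OF D_closure])
        have "\<bar>t * \<beta>\<bar> \<le> \<bar>\<beta>\<bar>" using t by (auto simp: abs_mult mult_left_le_one_le)
        then show "Complex 0 (t * \<beta>) \<in> D" using \<beta> by (simp add: D_def complex_norm)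
      qed
      moreover have "(\<lambda>k. Complex (\<alpha> k) (t * \<beta>)) \<longlonglongrightarrow> Complex 0 (t * \<beta>)"
      proof (intro tendsto_Complex tendsto_const)
        show "\<alpha> \<longlonglongrightarrow> 0" unfolding \<alpha>_def by real_asymp
      qed
      moreover have "\<forall>k. Complex (\<alpha> k) (t * \<beta>) \<in> closure (H \<rho>)"
        using in_H[OF t] closure_subset by blast
      ultimately have "(\<lambda>k. G (Complex (\<alpha> k) (t * \<beta>))) \<longlonglongrightarrow> G (Complex 0 (t * \<beta>))"
        by (intro continuous_on_tendsto_compose[OF contG]) auto
      then show ?thesis using in_H[OF t] by (simp add: G(2))
    qed
    have "\<rho> \<le> r" using r by (simp add: \<rho>_def)
    have in_Hr: "Complex (\<alpha> k) (t * \<beta>) \<in> H r" if "0 \<le> t" "t \<le> 1" for k t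
      using in_H[OF that, of k] \<open>\<rho> \<le> r\<close> by (auto simp: H_def)
    have der: "((\<lambda>t. Im (F1 (Complex (\<alpha> k) (t * \<beta>)))) has_vector_derivative \<beta> * Re (f (Complex (\<alpha> k) (t * \<beta>)))) (at t within {0..1})"
      if "t \<in> {0..1}" for t k
    proof -
      have 1: "((\<lambda>t. Complex (\<alpha> k) (t * \<beta>)) has_vector_derivative \<i> * of_real \<beta>) (at t)"
        unfolding Complex_eq by (auto intro!: derivative_eq_intros)
      have "((\<lambda>t. F1 (Complex (\<alpha> k) (t * \<beta>))) has_vector_derivative \<i> * of_real \<beta> * f (Complex (\<alpha> k) (t * \<beta>))) (at t)"
        using field_vector_diff_chain_at[OF 1 F1[OF in_Hr]] that by (simp add: o_def)
      from bounded_linear.has_vector_derivative[OF bounded_linear_Im this]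
      show ?thesis by (rule has_vector_derivative_at_within[OF has_vector_derivative_eq_rhs]) simp
    qed
    have int: "((\<lambda>t. \<beta> * Re (f (Complex (\<alpha> k) (t * \<beta>)))) has_integral
        Im (F1 (Complex (\<alpha> k) (1 * \<beta>))) - Im (F1 (Complex (\<alpha> k) (0 * \<beta>)))) {0..1}" for k
      by (rule fundamental_theorem_of_calculus) (use der in auto)
    have "(\<lambda>k. integral {0..1} (\<lambda>t. \<beta> * Re (f (Complex (\<alpha> k) (t * \<beta>))))) \<longlonglongrightarrow> integral {0..1} (\<lambda>t::real. 0::real)"
    proof (rule dominated_convergence)
      show "(\<lambda>t. \<beta> * Re (f (Complex (\<alpha> k) (t * \<beta>)))) integrable_on {0..1}" for k
        using int by blast
      show "(\<lambda>t. \<bar>\<beta>\<bar> * C) integrable_on {0..1::real}" by (rule integrable_const_ivl)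
      show "norm (\<beta> * Re (f (Complex (\<alpha> k) (t * \<beta>)))) \<le> \<bar>\<beta>\<bar> * C" if "t \<in> {0..1}" for k t
        using C[OF in_Hr, of t k] that by (simp add: abs_mult mult_left_mono)
      show "(\<lambda>k. \<beta> * Re (f (Complex (\<alpha> k) (t * \<beta>)))) \<longlonglongrightarrow> 0" if t: "t \<in> {0..1}" for t
      proof -
        have "\<bar>t * \<beta>\<bar> \<le> \<bar>\<beta>\<bar>" using t by (auto simp: abs_mult mult_left_le_one_le)
        then have "((\<lambda>\<alpha>. Re (f (Complex \<alpha> (t * \<beta>)))) \<longlongrightarrow> 0) (at_right 0)"
          using \<beta> \<open>\<rho> \<le> r\<close> by (intro lim) simp
        moreover have "filterlim \<alpha> (at_right 0) sequentially"
        proof -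
          have "\<alpha> \<longlonglongrightarrow> 0" unfolding \<alpha>_def by real_asymp
          moreover have "0 < \<alpha> k" for k using \<beta> by (simp add: \<alpha>_def)
          ultimately show ?thesis by (simp add: filterlim_at order_less_imp_not_eq2)
        qed
        ultimately have "(\<lambda>k. Re (f (Complex (\<alpha> k) (t * \<beta>)))) \<longlonglongrightarrow> 0"
          by (rule filterlim_compose)
        then show ?thesis using tendsto_mult_right_zero by blast
      qed
    qed
    then have "(\<lambda>k. Im (F1 (Complex (\<alpha> k) (1 * \<beta>))) - Im (F1 (Complex (\<alpha> k) (0 * \<beta>)))) \<longlonglongrightarrow> 0"
      using integral_unique[OF int] by simp
    moreover have "(\<lambda>k. Im (F1 (Complex (\<alpha> k) (1 * \<beta>))) - Im (F1 (Complex (\<alpha> k) (0 * \<beta>))))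
        \<longlonglongrightarrow> Im (G (Complex 0 (1 * \<beta>))) - Im (G (Complex 0 (0 * \<beta>)))"
      by (intro tendsto_intros lim_G) auto
    ultimately have "Im (G (Complex 0 (1 * \<beta>))) - Im (G (Complex 0 (0 * \<beta>))) = 0"
      using LIMSEQ_unique by blast
    then show ?thesis by (simp add: zero_complex.code[symmetric])
  qed
  \<comment> \<open>Rotate the axis to the real line, where the primitive minus its constant imaginary part is real.\<close>
  define E where "E \<zeta> = G (- \<i> * \<zeta>) - \<i> * of_real (Im (G 0))" for \<zeta>
  define E' where "E' \<zeta> = (if 0 \<le> Im \<zeta> then E \<zeta> else cnj (E (cnj \<zeta>)))" for \<zeta>
  have G_hol: "G holomorphic_on H \<rho>"
  proof -
    have "F1 holomorphic_on H \<rho>"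
    proof (rule holomorphic_onI)
      fix z assume "z \<in> H \<rho>"
      then have "z \<in> H r" using r by (auto simp: H_def \<rho>_def)
      then show "F1 field_differentiable at z within H \<rho>"
        using F1 has_field_derivative_at_within unfolding field_differentiable_def by blast
    qed
    then show ?thesis by (rule holomorphic_transform) (use G(2) in auto)
  qed
  have E_real: "Im (E \<zeta>) = 0" if "\<zeta> \<in> ball 0 \<rho>" "Im \<zeta> = 0" for \<zeta>
  proof -
    have "- \<i> * \<zeta> = Complex 0 (- Re \<zeta>)" using that by (simp add: complex_eq_iff)
    moreover have "\<bar>- Re \<zeta>\<bar> < \<rho>" using that abs_Re_le_cmod[of \<zeta>] by simp
    ultimately show ?thesis using ImG[of "- Re \<zeta>"] by (simp add: E_def)
  qed
  have E'_hol: "E' holomorphic_on ball 0 \<rho>"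
    unfolding E'_def
  proof (rule Schwarz_reflection)
    show "cnj ` ball 0 \<rho> \<subseteq> ball 0 \<rho>" by auto
    have "(\<lambda>\<zeta>. - \<i> * \<zeta>) ` (ball 0 \<rho> \<inter> {z. 0 < Im z}) \<subseteq> H \<rho>"
      by (auto simp: H_def norm_mult)
    moreover have "(\<lambda>\<zeta>. - \<i> * \<zeta>) holomorphic_on (ball 0 \<rho> \<inter> {z. 0 < Im z})"
      by (intro holomorphic_intros)
    ultimately have "(\<lambda>\<zeta>. G (- \<i> * \<zeta>)) holomorphic_on (ball 0 \<rho> \<inter> {z. 0 < Im z})"
      using holomorphic_on_compose_gen[OF _ G_hol] by (auto simp: o_def)
    then show "E holomorphic_on (ball 0 \<rho> \<inter> {z. 0 < Im z})"
      unfolding E_def by (intro holomorphic_intros)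
    have "(\<lambda>\<zeta>. - \<i> * \<zeta>) ` (ball 0 \<rho> \<inter> {z. 0 \<le> Im z}) \<subseteq> closure (H \<rho>)"
    proof (rule order_trans[OF _ D_closure])
      show "(\<lambda>\<zeta>. - \<i> * \<zeta>) ` (ball 0 \<rho> \<inter> {z. 0 \<le> Im z}) \<subseteq> D" by (auto simp: D_def norm_mult)
    qed
    then show "continuous_on (ball 0 \<rho> \<inter> {z. 0 \<le> Im z}) E"
      unfolding E_def
      by (intro continuous_intros continuous_on_compose2[OF contG, of _ "\<lambda>\<zeta>. - \<i> * \<zeta>"])
    show "E z \<in> \<real>" if "z \<in> ball 0 \<rho>" "z \<in> \<real>" for z
      using E_real[of z] that by (simp add: complex_is_Real_iff)
  qed simp
  have E'_sym: "E' (cnj \<zeta>) = cnj (E' \<zeta>)" if "\<zeta> \<in> ball 0 \<rho>" for \<zeta>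
  proof (cases "Im \<zeta> = 0")
    case True
    then have "cnj \<zeta> = \<zeta>" by (simp add: complex_eq_iff)
    moreover have "cnj (E \<zeta>) = E \<zeta>" using E_real[OF that True] by (simp add: complex_eq_iff)
    ultimately show ?thesis using True by (simp add: E'_def)
  qed (auto simp: E'_def)
  define P where "P z = E' (\<i> * z)" for z
  have P_hol: "P holomorphic_on ball 0 \<rho>"
  proof -
    have "(\<lambda>z. \<i> * z) ` ball 0 \<rho> \<subseteq> ball 0 \<rho>" by (auto simp: norm_mult)
    moreover have "(\<lambda>z. \<i> * z) holomorphic_on ball 0 \<rho>" by (intro holomorphic_intros)
    ultimately show ?thesis
      using holomorphic_on_compose_gen[OF _ E'_hol] unfolding P_def by (auto simp: o_def)
  qed
  have dP: "(P has_field_derivative deriv P z) (at z)" if "z \<in> ball 0 \<rho>" for z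
    using P_hol that by (meson holomorphic_derivI open_ball)
  have P_sym: "P z = cnj (P (- cnj z))" if "z \<in> ball 0 \<rho>" for z
  proof -
    have "cnj (\<i> * z) = \<i> * (- cnj z)" by simp
    then show ?thesis using E'_sym[of "\<i> * z"] that by (simp add: P_def norm_mult)
  qed
  show ?thesis
  proof (rule that[of "deriv P"])
    show "deriv P holomorphic_on ball 0 (r/16)"
      using P_hol by (intro holomorphic_deriv) (auto simp: \<rho>_def)
    show "deriv P z = f z" if "z \<in> H (r/16)" for z
    proof -
      have z: "z \<in> H \<rho>" using that by (simp add: \<rho>_def)
      have "(F1 has_field_derivative f z) (at z)" using z r by (intro F1) (auto simp: H_def \<rho>_def)
      then have "((\<lambda>w. F1 w - \<i> * of_real (Im (G 0))) has_field_derivative f z) (at z)"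
        by (auto intro!: derivative_eq_intros)
      then have "(P has_field_derivative f z) (at z)"
      proof (rule has_field_derivative_transform_within_open[OF _ openH z])
        show "F1 w - \<i> * of_real (Im (G 0)) = P w" if "w \<in> H \<rho>" for w
          using G(2)[OF that] that by (simp add: P_def E'_def E_def H_def)
      qed
      then show ?thesis by (rule DERIV_imp_deriv)
    qed
    show "deriv P (- cnj z) = - cnj (deriv P z)" if "z \<in> ball 0 (r/16)" for z
    proof -
      have z: "- cnj z \<in> ball 0 \<rho>" using that by (simp add: \<rho>_def)
      have "((\<lambda>w. P (- w)) has_field_derivative deriv P z * (-1)) (at (cnj (- cnj z)))"
      proof -
        have 1: "(P has_field_derivative deriv P z) (at (- (- z)))"
          using dP[of z] that by (simp add: \<rho>_def)
        have 2: "(uminus has_field_derivative -1) (at (- z))"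
          by (auto intro!: derivative_eq_intros)
        from DERIV_chain2[OF 1 2] show ?thesis by simp
      qed
      from has_field_derivative_cnj_cnj[OF this]
      have "((\<lambda>w. cnj (P (- cnj w))) has_field_derivative - cnj (deriv P z)) (at (- cnj z))"
        by (simp add: o_def)
      then have "(P has_field_derivative - cnj (deriv P z)) (at (- cnj z))"
        by (rule has_field_derivative_transform_within_open[OF _ open_ball z]) (rule P_sym[symmetric])
      then show ?thesis by (rule DERIV_imp_deriv)
    qed
  qed
qed

text \<open>
  The real part of \<open>c (h z - h (- cnj z))\<close> is that of the antisymmetrised function \<open>c h z - cnj (c h (- cnj z))\<close>,
  which is holomorphic; the cases \<open>c = 1\<close> and \<open>c = - i\<close> together determine \<open>h\<close>. The radius does not depend on
  \<open>h\<close> or \<open>C\<close>, so it is common to all functionals in the application.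
\<close>

lemma two_sided_extension:
  fixes h :: "complex \<Rightarrow> complex"
  assumes h: "h holomorphic_on {z. Re z \<noteq> 0 \<and> cmod z < r}" and r: "0 < r"
    and C: "\<And>z. 0 < Re z \<Longrightarrow> cmod z < r \<Longrightarrow> cmod (h z - h (- cnj z)) \<le> C"
    and lim: "\<And>\<beta>. \<bar>\<beta>\<bar> < r \<Longrightarrow> ((\<lambda>\<alpha>. h (Complex \<alpha> \<beta>) - h (Complex (- \<alpha>) \<beta>)) \<longlongrightarrow> 0) (at_right 0)"
  obtains g where "g holomorphic_on ball 0 (r/16)"
    "\<And>z. z \<in> ball 0 (r/16) \<Longrightarrow> Re z \<noteq> 0 \<Longrightarrow> g z = h z"
proof -
  \<comment> \<open>The antisymmetrised function satisfies \<open>H c (- cnj z) = - cnj (H c z)\<close>, as does its continuation.\<close>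
  define H where "H c z = c * h z - cnj (c * h (- cnj z))" for c z
  have ReH: "Re (H c z) = Re (c * (h z - h (- cnj z)))" for c z
    by (simp add: H_def algebra_simps)
  have ex: "\<exists>F. F holomorphic_on ball 0 (r/16) \<and> (\<forall>z\<in>ball 0 (r/16). Re z \<noteq> 0 \<longrightarrow> F z = H c z)"
    if c: "cmod c = 1" for c
  proof -
    have "\<exists>F. F holomorphic_on ball 0 (r/16) \<and> (\<forall>z\<in>{z. 0 < Re z \<and> cmod z < r/16}. F z = H c z) \<and>
        (\<forall>z\<in>ball 0 (r/16). F (- cnj z) = - cnj (F z))"
    proof (rule reflection_extension[of "H c" r C])
      have openR: "open {z. 0 < Re z \<and> cmod z < r}"
        by (intro open_Collect_conj open_Collect_less continuous_intros)
      have 1: "h holomorphic_on {z. 0 < Re z \<and> cmod z < r}"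
        by (rule holomorphic_on_subset[OF h]) auto
      have "uminus ` cnj ` {z. 0 < Re z \<and> cmod z < r} \<subseteq> {z. Re z \<noteq> 0 \<and> cmod z < r}" by auto
      moreover have "uminus holomorphic_on cnj ` {z. 0 < Re z \<and> cmod z < r}"
        by (intro holomorphic_intros)
      ultimately have "(\<lambda>w. c * h (- w)) holomorphic_on cnj ` {z. 0 < Re z \<and> cmod z < r}"
        using holomorphic_on_compose_gen[OF _ h, of uminus] by (auto simp: o_def intro!: holomorphic_intros)
      from holomorphic_on_compose_cnj_cnj[OF this openR]
      have 2: "(\<lambda>z. cnj (c * h (- cnj z))) holomorphic_on {z. 0 < Re z \<and> cmod z < r}"
        by (simp only: o_def)
      show "H c holomorphic_on {z. 0 < Re z \<and> cmod z < r}"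
        unfolding H_def by (intro holomorphic_intros 1 2)
      show "\<bar>Re (H c z)\<bar> \<le> C" if "z \<in> {z. 0 < Re z \<and> cmod z < r}" for z
      proof -
        have "\<bar>Re (H c z)\<bar> \<le> cmod (c * (h z - h (- cnj z)))" unfolding ReH by (rule abs_Re_le_cmod)
        also have "\<dots> \<le> C" using C[of z] that c by (simp add: norm_mult)
        finally show ?thesis .
      qed
      show "((\<lambda>\<alpha>. Re (H c (Complex \<alpha> \<beta>))) \<longlongrightarrow> 0) (at_right 0)" if "\<bar>\<beta>\<bar> < r" for \<beta>
      proof -
        have "((\<lambda>\<alpha>. Re (c * (h (Complex \<alpha> \<beta>) - h (Complex (- \<alpha>) \<beta>)))) \<longlongrightarrow> Re (c * 0)) (at_right 0)"
          by (intro tendsto_intros lim that)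
        moreover have "- cnj (Complex \<alpha> \<beta>) = Complex (- \<alpha>) \<beta>" for \<alpha> by (simp add: complex_eq_iff)
        ultimately show ?thesis by (simp add: ReH)
      qed
    qed (use r in blast)+
    then obtain F where F: "F holomorphic_on ball 0 (r/16)"
      "\<And>z. 0 < Re z \<Longrightarrow> cmod z < r/16 \<Longrightarrow> F z = H c z"
      "\<And>z. z \<in> ball 0 (r/16) \<Longrightarrow> F (- cnj z) = - cnj (F z)" by auto
    have "F z = H c z" if z: "z \<in> ball 0 (r/16)" "Re z \<noteq> 0" for z
    proof (cases "0 < Re z")
      case False
      then have "F (- cnj z) = H c (- cnj z)" using z by (intro F(2)) auto
      moreover have "F z = - cnj (F (- cnj z))" using F(3)[of "- cnj z"] z by simp
      ultimately show ?thesis by (simp add: H_def)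
    qed (use F(2) z in auto)
    then show ?thesis using F(1) by blast
  qed
  obtain F1 where F1: "F1 holomorphic_on ball 0 (r/16)" "\<And>z. z \<in> ball 0 (r/16) \<Longrightarrow> Re z \<noteq> 0 \<Longrightarrow> F1 z = H 1 z"
    using ex[of 1] by auto
  obtain F2 where F2: "F2 holomorphic_on ball 0 (r/16)" "\<And>z. z \<in> ball 0 (r/16) \<Longrightarrow> Re z \<noteq> 0 \<Longrightarrow> F2 z = H (- \<i>) z"
    using ex[of "- \<i>"] by auto
  show ?thesis
  proof (rule that[of "\<lambda>z. (F1 z + \<i> * F2 z) / 2"])
    show "(\<lambda>z. (F1 z + \<i> * F2 z) / 2) holomorphic_on ball 0 (r/16)"
      by (intro holomorphic_intros F1 F2) auto
    show "(F1 z + \<i> * F2 z) / 2 = h z" if "z \<in> ball 0 (r/16)" "Re z \<noteq> 0" for z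
      using F1(2)[OF that] F2(2)[OF that] by (simp add: H_def complex_eq_iff)
  qed
qed

section \<open>The resolvent of a polynomially bounded group\<close>

lemma has_vector_derivative_iff_quotient:
  fixes f :: "real \<Rightarrow> 'a::real_normed_vector"
  shows "(f has_vector_derivative d) (at t) \<longleftrightarrow> ((\<lambda>h. (f (t + h) - f t) /\<^sub>R h) \<longlongrightarrow> d) (at 0)"
proof -
  have "norm (f (t + h) - f t - h *\<^sub>R d) / norm h = norm ((f (t + h) - f t) /\<^sub>R h - d)" if "h \<noteq> 0" for h
  proof -
    have "f (t + h) - f t - h *\<^sub>R d = h *\<^sub>R ((f (t + h) - f t) /\<^sub>R h - d)"
      using that by (simp add: scaleR_diff_right)
    then show ?thesis using that by simp
  qed
  then have ev: "\<forall>\<^sub>F h in at 0. norm (f (t + h) - f t - h *\<^sub>R d) / norm h = norm ((f (t + h) - f t) /\<^sub>R h - d)"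
    by (auto simp: eventually_at_filter)
  have "(f has_vector_derivative d) (at t) \<longleftrightarrow>
      ((\<lambda>h. norm (f (t + h) - f t - h *\<^sub>R d) / norm h) \<longlongrightarrow> 0) (at 0)"
    unfolding has_vector_derivative_def has_derivative_at
    by (simp add: bounded_linear_scaleR_left)
  also have "\<dots> \<longleftrightarrow> ((\<lambda>h. norm ((f (t + h) - f t) /\<^sub>R h - d)) \<longlongrightarrow> 0) (at 0)"
    by (rule tendsto_cong[OF ev])
  also have "\<dots> \<longleftrightarrow> ((\<lambda>h. (f (t + h) - f t) /\<^sub>R h) \<longlongrightarrow> d) (at 0)"
    by (simp add: tendsto_norm_zero_iff LIM_zero_iff)
  finally show ?thesis .
qed

locale polynomially_bounded_group =
  fixes T :: "real \<Rightarrow> 'a::complex_banach \<Rightarrow> 'a" and M a :: real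
  assumes C0_group: "C0_group T"
    and a_nonneg: "0 \<le> a" and a_le_2: "a \<le> 2"
    and onorm_T: "\<And>t. onorm (T t) \<le> M * (1 + \<bar>t\<bar> powr a)"
begin

lemma T_clinear: "bounded_clinear (T t)"
  and T_zero: "T 0 x = x"
  and T_add: "T (s + t) x = T s (T t x)"
  and T_continuous: "continuous_on UNIV (\<lambda>t. T t x)"
  using C0_group by (simp_all add: C0_group_def)

lemmas T_linear = bounded_clinear_linear[OF T_clinear]

lemma M_nonneg: "0 \<le> M"
  using order_trans[OF onorm_pos_le[OF T_linear] onorm_T[of 0]] by simp

lemma T_bound: "norm (T t x) \<le> M * (1 + \<bar>t\<bar> powr a) * norm x"
proof -
  have "norm (T t x) \<le> onorm (T t) * norm x" by (rule onorm[OF T_linear])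
  also have "\<dots> \<le> M * (1 + \<bar>t\<bar> powr a) * norm x"
    by (intro mult_right_mono onorm_T) auto
  finally show ?thesis .
qed

text \<open>
  With \<open>y = \<alpha> t\<close>, this is \<open>y\<^sup>a \<le> 1 + y\<^sup>2 \<le> 8 exp (y/2)\<close>. Half of the exponential decay is kept for the integral.
\<close>

lemma damped_T_bound:
  assumes \<alpha>: "0 < \<alpha>" and t: "0 \<le> t"
  shows "exp (- \<alpha> * t) * norm (T t x) \<le> M * (1 + 8 * \<alpha> powr (- a)) * norm x * exp (- (\<alpha> / 2) * t)"
proof -
  define y where "y = \<alpha> * t"
  have y: "0 \<le> y" using \<alpha> t by (simp add: y_def)
  have "y powr a \<le> 1 + y\<^sup>2"
  proof (cases "y \<le> 1")
    case True
    then have "y powr a \<le> 1" using y a_nonneg by (intro powr_le1) auto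
    then show ?thesis by (simp add: add_increasing2)
  next
    case False
    then have "y powr a \<le> y powr 2" using a_le_2 by (intro powr_mono) auto
    then show ?thesis using False by (simp add: powr_numeral)
  qed
  also have "1 + y\<^sup>2 \<le> 8 * exp (y / 2)"
    using exp_lower_Taylor_quadratic[of "y / 2"] y by (simp add: power_divide)
  finally have "\<alpha> powr (- a) * (y powr a) \<le> \<alpha> powr (- a) * (8 * exp (y / 2))"
    by (intro mult_left_mono) auto
  moreover have "\<alpha> powr (- a) * (y powr a) = t powr a"
    using \<alpha> t by (simp add: y_def powr_mult powr_minus)
  ultimately have "1 + t powr a \<le> (1 + 8 * \<alpha> powr (- a)) * exp (y / 2)"
    using y by (simp add: algebra_simps add_mono)
  then have "M * norm x * (1 + t powr a) \<le> M * norm x * ((1 + 8 * \<alpha> powr (- a)) * exp (y / 2))"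
    using M_nonneg by (intro mult_left_mono) auto
  then have "norm (T t x) \<le> M * (1 + 8 * \<alpha> powr (- a)) * norm x * exp (y / 2)"
    using T_bound[of t x] t by (simp add: algebra_simps)
  then have "exp (- y) * norm (T t x) \<le> exp (- y) * (M * (1 + 8 * \<alpha> powr (- a)) * norm x * exp (y / 2))"
    by (intro mult_left_mono) auto
  also have "\<dots> = M * (1 + 8 * \<alpha> powr (- a)) * norm x * (exp (- y) * exp (y / 2))" by simp
  also have "exp (- y) * exp (y / 2) = exp (- (\<alpha> / 2) * t)"
    by (simp add: exp_add[symmetric] y_def)
  finally show ?thesis by (simp add: y_def)
qed

text \<open>
  The graph of the generator. A relation avoids reasoning about undefined values of the partial map.
\<close>

definition gen :: "'a \<Rightarrow> 'a \<Rightarrow> bool" where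
  "gen x y \<longleftrightarrow> ((\<lambda>h. (T h x - x) /\<^sub>R h) \<longlongrightarrow> y) (at 0)"

lemma generator_eq_Some_iff: "generator T x = Some y \<longleftrightarrow> gen x y"
proof -
  have "Lim (at 0) (\<lambda>h. (T h x - x) /\<^sub>R h) = y" if "gen x y" for y
    using tendsto_Lim[OF _ that[unfolded gen_def]] by simp
  then show ?thesis unfolding generator_def gen_def[symmetric] by auto
qed

lemma gen_iff_derivative: "gen x y \<longleftrightarrow> ((\<lambda>t. T t x) has_vector_derivative y) (at 0)"
  unfolding has_vector_derivative_iff_quotient gen_def by (simp add: T_zero)

lemma gen_add: "gen x y \<Longrightarrow> gen x' y' \<Longrightarrow> gen (x + x') (y + y')"
  unfolding gen_iff_derivative
  by (simp add: bounded_clinear_add[OF T_clinear] has_vector_derivative_add)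

lemma gen_scale: "gen x y \<Longrightarrow> gen (c *\<^sub>C x) (c *\<^sub>C y)"
proof -
  assume "gen x y"
  then have "((\<lambda>h. c *\<^sub>C ((T h x - x) /\<^sub>R h)) \<longlongrightarrow> c *\<^sub>C y) (at 0)"
    unfolding gen_def by (intro tendsto_scaleC tendsto_const)
  moreover have "c *\<^sub>C ((T h x - x) /\<^sub>R h) = (T h (c *\<^sub>C x) - c *\<^sub>C x) /\<^sub>R h" for h
    by (simp add: bounded_clinear_scaleC[OF T_clinear] scaleC_diff_right[symmetric]
        scaleC_of_real[symmetric] scaleC_scaleC mult.commute)
  ultimately show ?thesis by (simp add: gen_def)
qed

lemma gen_diff: "gen x y \<Longrightarrow> gen x' y' \<Longrightarrow> gen (x - x') (y - y')"
  using gen_add[of x y "(-1) *\<^sub>C x'" "(-1) *\<^sub>C y'"] gen_scale[of x' y' "-1"]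
  by (simp add: scaleC_minus_left)

lemma orbit_derivative:
  assumes "gen x y"
  shows "((\<lambda>t. T t x) has_vector_derivative T t y) (at t)"
proof -
  have "((\<lambda>h. T t ((T h x - x) /\<^sub>R h)) \<longlongrightarrow> T t y) (at 0)"
    using assms unfolding gen_def by (rule bounded_linear.tendsto[OF T_linear])
  moreover have "T t ((T h x - x) /\<^sub>R h) = (T (t + h) x - T t x) /\<^sub>R h" for h
    by (simp add: linear_scale[OF bounded_linear.linear[OF T_linear]] bounded_clinear_diff[OF T_clinear] T_add)
  ultimately show ?thesis by (simp add: has_vector_derivative_iff_quotient)
qed

definition damped_orbit :: "complex \<Rightarrow> 'a \<Rightarrow> real \<Rightarrow> 'a" where
  "damped_orbit \<mu> x t = exp (- \<mu> * of_real t) *\<^sub>C T t x"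

lemma exp_derivative:
  fixes \<mu> :: complex
  shows "((\<lambda>t. exp (\<mu> * of_real t)) has_vector_derivative \<mu> * exp (\<mu> * of_real t)) (at t)"
proof -
  have 1: "((\<lambda>t. \<mu> * of_real t) has_vector_derivative \<mu>) (at t)"
    by (auto intro!: derivative_eq_intros)
  have 2: "(exp has_field_derivative exp (\<mu> * of_real t)) (at (\<mu> * of_real t))"
    by (rule DERIV_exp)
  show ?thesis using field_vector_diff_chain_at[OF 1 2] by (simp add: o_def)
qed

lemma damped_orbit_continuous: "continuous_on S (damped_orbit \<mu> x)"
  unfolding damped_orbit_def
  by (intro bounded_bilinear.continuous_on[OF bounded_bilinear_scaleC] continuous_intros
      continuous_on_subset[OF T_continuous]) auto

lemma damped_orbit_add:
  "damped_orbit \<mu> x (t + h) = exp (- \<mu> * of_real h) *\<^sub>C T h (damped_orbit \<mu> x t)"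
  by (simp add: damped_orbit_def bounded_clinear_scaleC[OF T_clinear] scaleC_scaleC T_add[symmetric]
      exp_add[symmetric] algebra_simps)

lemma damped_orbit_bound:
  assumes "0 < Re \<mu>" "0 \<le> t"
  shows "norm (damped_orbit \<mu> x t) \<le> M * (1 + 8 * Re \<mu> powr (- a)) * norm x * exp (- (Re \<mu> / 2) * t)"
  using damped_T_bound[OF assms, of x] by (simp add: damped_orbit_def norm_scaleC)

text \<open>
  The Laplace transform of the orbit, as the limit of Riemann integrals. The integrals start at \<open>- 1\<close>, so that
  they can be differentiated at 0 from both sides. Translating the orbit by \<open>h\<close> gives
  \<open>exp (- \<mu> h) T h z = L - \<Phi> h\<close>, and the derivative at \<open>h = 0\<close> identifies \<open>z\<close> as the value of the resolvent.
\<close>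

lemma resolvent_exists_right:
  assumes \<mu>: "0 < Re \<mu>"
  shows "\<exists>z. gen z (\<mu> *\<^sub>C z - x) \<and> norm z \<le> 2 * M * (1 + 8 * Re \<mu> powr (- a)) / Re \<mu> * norm x"
proof -
  define \<alpha> where "\<alpha> = Re \<mu>"
  define K where "K = M * (1 + 8 * \<alpha> powr (- a)) * norm x"
  have \<alpha>: "0 < \<alpha>" using \<mu> by (simp add: \<alpha>_def)
  have K: "0 \<le> K" using M_nonneg by (simp add: K_def)
  define o' where "o' = damped_orbit \<mu> x"
  define \<Phi> where "\<Phi> t = integral {-1..t} o'" for t
  have d\<Phi>: "(\<Phi> has_vector_derivative o' t) (at t)" if "-1 < t" for t
  proof -
    have "(\<Phi> has_vector_derivative o' t) (at t within {-1..t + 1})"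
      unfolding \<Phi>_def using that damped_orbit_continuous
      by (intro integral_has_vector_derivative) (auto simp: o'_def)
    then have "(\<Phi> has_vector_derivative o' t) (at t within {-1<..<t + 1})"
      by (rule has_vector_derivative_within_subset) auto
    then show ?thesis using that at_within_open[of t "{-1<..<t + 1}"] by auto
  qed
  have \<Phi>_bound: "norm (\<Phi> t - \<Phi> s) \<le> 2 * K / \<alpha> * exp (- (\<alpha> / 2) * s)" if st: "0 \<le> s" "s \<le> t" for s t
  proof (cases "s = t")
    case False
    define \<psi> where "\<psi> t = - (2 * K / \<alpha>) * exp (- (\<alpha> / 2) * t)" for t
    have "norm (\<Phi> t - \<Phi> s) \<le> \<psi> t - \<psi> s"
    proof (rule differentiable_bound_general[where f' = o' and \<phi>' = "\<lambda>t. K * exp (- (\<alpha> / 2) * t)"])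
      show "continuous_on {s..t} \<Phi>"
        using st by (intro continuous_at_imp_continuous_on ballI has_vector_derivative_continuous[OF d\<Phi>]) auto
      show "continuous_on {s..t} \<psi>" unfolding \<psi>_def by (intro continuous_intros)
      show "(\<psi> has_vector_derivative K * exp (- (\<alpha> / 2) * u)) (at u)" for u
        unfolding has_real_derivative_iff_has_vector_derivative[symmetric] \<psi>_def
        using \<alpha> by (auto intro!: derivative_eq_intros)
      show "norm (o' u) \<le> K * exp (- (\<alpha> / 2) * u)" if "s < u" "u < t" for u
        using damped_orbit_bound[OF \<mu>, of u x] that st by (simp add: o'_def K_def \<alpha>_def)
    qed (use False st d\<Phi> in auto)
    also have "\<dots> \<le> - \<psi> s" using K \<alpha> by (simp add: \<psi>_def)
    finally show ?thesis by (simp add: \<psi>_def)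
  qed (use K \<alpha> in simp)
  have decay: "((\<lambda>t. 2 * K / \<alpha> * exp (- (\<alpha> / 2) * t)) \<longlongrightarrow> 0) at_top"
    using \<alpha> by real_asymp
  have "Cauchy (\<lambda>n. \<Phi> (real n))"
  proof (rule metric_CauchyI)
    fix e :: real assume e: "0 < e"
    have "\<forall>\<^sub>F t in at_top. 2 * K / \<alpha> * exp (- (\<alpha> / 2) * t) < e / 2"
      using e by (intro order_tendstoD(2)[OF decay]) auto
    then obtain t0 where t0: "\<And>t. t0 \<le> t \<Longrightarrow> 2 * K / \<alpha> * exp (- (\<alpha> / 2) * t) < e / 2"
      by (auto simp: eventually_at_top_linorder)
    define N where "N = nat \<lceil>max t0 0\<rceil>"
    have N: "t0 \<le> real N" by (simp add: N_def) linarith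
    have *: "dist (\<Phi> (real n)) (\<Phi> (real N)) < e / 2" if "N \<le> n" for n
      using \<Phi>_bound[of "real N" "real n"] t0[OF N] that by (simp add: dist_norm)
    show "\<exists>M. \<forall>m\<ge>M. \<forall>n\<ge>M. dist (\<Phi> (real m)) (\<Phi> (real n)) < e"
      by (intro exI[of _ N] allI impI) (meson * dist_triangle_half_l dist_commute)
  qed
  then obtain L where L: "(\<lambda>n. \<Phi> (real n)) \<longlonglongrightarrow> L"
    using Cauchy_convergent convergent_def by blast
  have L_bound: "norm (\<Phi> t - L) \<le> 2 * K / \<alpha> * exp (- (\<alpha> / 2) * t)" if "0 \<le> t" for t
  proof (rule tendsto_upperbound)
    show "(\<lambda>n. norm (\<Phi> t - \<Phi> (real n))) \<longlonglongrightarrow> norm (\<Phi> t - L)"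
      by (intro tendsto_intros L)
    show "\<forall>\<^sub>F n in sequentially. norm (\<Phi> t - \<Phi> (real n)) \<le> 2 * K / \<alpha> * exp (- (\<alpha> / 2) * t)"
      unfolding eventually_sequentially
    proof (intro exI[of _ "nat \<lceil>t\<rceil>"] allI impI)
      fix n assume "nat \<lceil>t\<rceil> \<le> n"
      then have "t \<le> real n" by linarith
      then show "norm (\<Phi> t - \<Phi> (real n)) \<le> 2 * K / \<alpha> * exp (- (\<alpha> / 2) * t)"
        using \<Phi>_bound[of t "real n"] that by (simp add: norm_minus_commute)
    qed
  qed simp
  have L_top: "(\<Phi> \<longlongrightarrow> L) at_top"
  proof (rule Lim_null_comparison[THEN LIM_zero_cancel])
    show "\<forall>\<^sub>F t in at_top. norm (\<Phi> t - L) \<le> 2 * K / \<alpha> * exp (- (\<alpha> / 2) * t)"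
      using L_bound by (auto simp: eventually_at_top_linorder)
  qed (rule decay)
  define z where "z = L - \<Phi> 0"
  have z_bound: "norm z \<le> 2 * K / \<alpha>"
    using L_bound[of 0] by (simp add: z_def norm_minus_commute)
  have shift: "exp (- \<mu> * of_real h) *\<^sub>C T h (\<Phi> t - \<Phi> 0) = \<Phi> (t + h) - \<Phi> h" if h: "\<bar>h\<bar> < 1" and t: "0 \<le> t" for h t
  proof -
    define G where "G t = exp (- \<mu> * of_real h) *\<^sub>C T h (\<Phi> t - \<Phi> 0) - (\<Phi> (t + h) - \<Phi> h)" for t
    have bl: "bounded_linear (\<lambda>v. exp (- \<mu> * of_real h) *\<^sub>C T h v)"
      by (rule bounded_linear_compose[OF bounded_bilinear.bounded_linear_right[OF bounded_bilinear_scaleC] T_linear])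
    have dG: "(G has_vector_derivative 0) (at u within {0..t})" if "u \<in> {0..t}" for u
    proof -
      have 1: "((\<lambda>t. \<Phi> t - \<Phi> 0) has_vector_derivative o' u) (at u)"
        using that by (auto intro!: derivative_eq_intros d\<Phi>)
      have 2: "((\<lambda>t. \<Phi> (t + h)) has_vector_derivative o' (u + h)) (at u)"
      proof -
        have 3: "((\<lambda>t. t + h) has_vector_derivative 1) (at u)" by (auto intro!: derivative_eq_intros)
        have "-1 < u + h" using that h by auto
        from vector_diff_chain_at[OF 3 d\<Phi>[OF this]] show ?thesis by (simp add: o_def)
      qed
      have "(G has_vector_derivative exp (- \<mu> * of_real h) *\<^sub>C T h (o' u) - (o' (u + h) - 0)) (at u)"
        unfolding G_def
        by (intro has_vector_derivative_diff has_vector_derivative_const 2 bounded_linear.has_vector_derivative[OF bl 1])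
      then show ?thesis
        using damped_orbit_add[of \<mu> x u h] by (auto simp: o'_def intro: has_vector_derivative_at_within)
    qed
    obtain c where c: "\<And>u. u \<in> {0..t} \<Longrightarrow> G u = c"
      using has_vector_derivative_zero_constant[OF convex_real_interval(5) dG] by metis
    have "G t = G 0" using c[of 0] c[of t] t by simp
    also have "G 0 = 0" by (simp add: G_def bounded_clinear_0[OF T_clinear])
    finally show ?thesis by (simp add: G_def)
  qed
  have limit: "exp (- \<mu> * of_real h) *\<^sub>C T h z = L - \<Phi> h" if h: "\<bar>h\<bar> < 1" for h
  proof (rule tendsto_unique)
    show "((\<lambda>t. exp (- \<mu> * of_real h) *\<^sub>C T h (\<Phi> t - \<Phi> 0)) \<longlongrightarrow> exp (- \<mu> * of_real h) *\<^sub>C T h z) at_top"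
      unfolding z_def
      by (intro tendsto_scaleC tendsto_const bounded_linear.tendsto[OF T_linear] tendsto_diff L_top)
    have "filterlim (\<lambda>t. t + h) at_top at_top" by real_asymp
    then have "((\<lambda>t. \<Phi> (t + h) - \<Phi> h) \<longlongrightarrow> L - \<Phi> h) at_top"
      by (intro tendsto_diff tendsto_const filterlim_compose[OF L_top])
    then show "((\<lambda>t. exp (- \<mu> * of_real h) *\<^sub>C T h (\<Phi> t - \<Phi> 0)) \<longlongrightarrow> L - \<Phi> h) at_top"
    proof (rule Lim_transform_eventually)
      show "\<forall>\<^sub>F t in at_top. \<Phi> (t + h) - \<Phi> h = exp (- \<mu> * of_real h) *\<^sub>C T h (\<Phi> t - \<Phi> 0)"
        unfolding eventually_at_top_linorder by (intro exI[of _ 0] allI impI) (rule shift[OF h, symmetric])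
    qed
  qed simp
  have "((\<lambda>h. exp (\<mu> * of_real h) *\<^sub>C (L - \<Phi> h)) has_vector_derivative
      exp (\<mu> * of_real 0) *\<^sub>C (0 - o' 0) + (\<mu> * exp (\<mu> * of_real 0)) *\<^sub>C (L - \<Phi> 0)) (at 0)"
    by (intro bounded_bilinear.has_vector_derivative[OF bounded_bilinear_scaleC] exp_derivative
        has_vector_derivative_diff has_vector_derivative_const d\<Phi>) simp
  then have "((\<lambda>h. T h z) has_vector_derivative \<mu> *\<^sub>C z - x) (at 0)"
  proof (rule has_vector_derivative_transform_within_open[OF has_vector_derivative_eq_rhs])
    show "exp (\<mu> * of_real 0) *\<^sub>C (0 - o' 0) + (\<mu> * exp (\<mu> * of_real 0)) *\<^sub>C (L - \<Phi> 0) = \<mu> *\<^sub>C z - x"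
      by (simp add: o'_def damped_orbit_def T_zero z_def)
    show "exp (\<mu> * of_real h) *\<^sub>C (L - \<Phi> h) = T h z" if "h \<in> {-1<..<1}" for h
    proof -
      have "exp (\<mu> * of_real h) *\<^sub>C (L - \<Phi> h) = exp (\<mu> * of_real h) *\<^sub>C exp (- \<mu> * of_real h) *\<^sub>C T h z"
        using that by (subst limit) auto
      also have "\<dots> = T h z" by (simp add: scaleC_scaleC exp_minus)
      finally show ?thesis .
    qed
  qed auto
  then show ?thesis
    using z_bound by (intro exI[of _ z]) (simp add: gen_iff_derivative K_def \<alpha>_def mult.assoc)
qed

text \<open>
  The damped orbit of an eigenvector is constant and tends to zero.
\<close>

lemma no_eigenvector_right:
  assumes \<mu>: "0 < Re \<mu>" and y: "gen y (\<mu> *\<^sub>C y)"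
  shows "y = 0"
proof -
  define g where "g = damped_orbit \<mu> y"
  have dg: "(g has_vector_derivative 0) (at t within UNIV)" for t
  proof -
    have "(g has_vector_derivative exp (- \<mu> * of_real t) *\<^sub>C T t (\<mu> *\<^sub>C y) + (- \<mu> * exp (- \<mu> * of_real t)) *\<^sub>C T t y) (at t)"
      unfolding g_def damped_orbit_def[abs_def]
      by (intro bounded_bilinear.has_vector_derivative[OF bounded_bilinear_scaleC] exp_derivative orbit_derivative y)
    moreover have "exp (- \<mu> * of_real t) *\<^sub>C T t (\<mu> *\<^sub>C y) + (- \<mu> * exp (- \<mu> * of_real t)) *\<^sub>C T t y = 0"
      by (simp add: bounded_clinear_scaleC[OF T_clinear] scaleC_scaleC scaleC_minus_left mult.commute)
    ultimately show ?thesis by simp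
  qed
  obtain c where "\<And>t. t \<in> UNIV \<Longrightarrow> g t = c"
    using has_vector_derivative_zero_constant[OF convex_UNIV dg] by metis
  then have c: "g t = c" for t by simp
  have g0: "g 0 = y" by (simp add: g_def damped_orbit_def T_zero)
  have "norm y \<le> 0"
  proof (rule tendsto_lowerbound)
    show "((\<lambda>t. M * (1 + 8 * Re \<mu> powr (- a)) * norm y * exp (- (Re \<mu> / 2) * t)) \<longlongrightarrow> 0) at_top"
      using \<mu> by real_asymp
    show "\<forall>\<^sub>F t in at_top. norm y \<le> M * (1 + 8 * Re \<mu> powr (- a)) * norm y * exp (- (Re \<mu> / 2) * t)"
      unfolding eventually_at_top_linorder
    proof (intro exI[of _ 0] allI impI)
      fix t :: real assume "0 \<le> t"
      then show "norm y \<le> M * (1 + 8 * Re \<mu> powr (- a)) * norm y * exp (- (Re \<mu> / 2) * t)"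
        using damped_orbit_bound[OF \<mu>, of t y] c[of t] c[of 0] g0 by (simp add: g_def)
    qed
  qed simp
  then show ?thesis by simp
qed

text \<open>
  Reversing time turns statements about the right half-plane into statements about the left
  one.
\<close>

lemma reversed_group: "polynomially_bounded_group (\<lambda>t. T (- t)) M a"
proof
  have "continuous_on UNIV (\<lambda>t. T (- t) x)" for x
    by (rule continuous_on_compose2[OF T_continuous]) (auto intro!: continuous_intros)
  then show "C0_group (\<lambda>t. T (- t))"
    unfolding C0_group_def using T_clinear by (auto simp: T_zero T_add[symmetric] fun_eq_iff add.commute)
  show "onorm (T (- t)) \<le> M * (1 + \<bar>t\<bar> powr a)" for t
    using onorm_T[of "- t"] by simp
qed (rule a_nonneg a_le_2)+

lemma gen_reversed: "polynomially_bounded_group.gen (\<lambda>t. T (- t)) x y \<longleftrightarrow> gen x (- y)"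
proof -
  interpret rev: polynomially_bounded_group "\<lambda>t. T (- t)" M a by (rule reversed_group)
  have neg: "((\<lambda>t. f (- t)) has_vector_derivative - d) (at 0)"
    if "(f has_vector_derivative d) (at (0::real))" for f :: "real \<Rightarrow> 'a" and d
  proof -
    have 1: "(uminus has_vector_derivative -1) (at (0::real))" by (auto intro!: derivative_eq_intros)
    have 2: "(f has_vector_derivative d) (at (- 0))" using that by simp
    from vector_diff_chain_at[OF 1 2] show ?thesis by (simp add: o_def)
  qed
  have "gen x (- y)" if "rev.gen x y"
    using neg[OF that[unfolded rev.gen_iff_derivative]] by (simp add: gen_iff_derivative)
  moreover have "rev.gen x y" if "gen x (- y)"
    using neg[OF that[unfolded gen_iff_derivative]] by (simp add: rev.gen_iff_derivative)
  ultimately show ?thesis by blast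
qed

definition res_bound :: "real \<Rightarrow> real" where
  "res_bound \<alpha> = 2 * M * (1 + 8 * \<alpha> powr (- a)) / \<alpha>"

lemma resolvent_exists:
  assumes \<mu>: "Re \<mu> \<noteq> 0"
  shows "\<exists>z. gen z (\<mu> *\<^sub>C z - x) \<and> norm z \<le> res_bound \<bar>Re \<mu>\<bar> * norm x"
proof (cases "0 < Re \<mu>")
  case True
  then show ?thesis using resolvent_exists_right[of \<mu> x] by (simp add: res_bound_def)
next
  case False
  interpret rev: polynomially_bounded_group "\<lambda>t. T (- t)" M a by (rule reversed_group)
  have "0 < Re (- \<mu>)" using False \<mu> by simp
  from rev.resolvent_exists_right[OF this, of "- x"] obtain z
    where z: "gen z (- ((- \<mu>) *\<^sub>C z - - x))" "norm z \<le> res_bound \<bar>Re \<mu>\<bar> * norm x"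
    using False by (auto simp: gen_reversed res_bound_def)
  then show ?thesis by (auto simp: scaleC_minus_left)
qed

lemma no_eigenvector:
  assumes \<mu>: "Re \<mu> \<noteq> 0" and y: "gen y (\<mu> *\<^sub>C y)"
  shows "y = 0"
proof (cases "0 < Re \<mu>")
  case False
  interpret rev: polynomially_bounded_group "\<lambda>t. T (- t)" M a by (rule reversed_group)
  show ?thesis
    using rev.no_eigenvector_right[of "- \<mu>" y] False \<mu> y by (simp add: gen_reversed scaleC_minus_left)
qed (use no_eigenvector_right[OF _ y] in simp)

abbreviation R :: "complex \<Rightarrow> 'a \<Rightarrow> 'a" where "R \<equiv> resolvent (generator T)"

lemma in_dom: "x \<in> dom (generator T) \<longleftrightarrow> (\<exists>y. gen x y)"
  by (simp add: dom_def flip: generator_eq_Some_iff)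

lemma the_generator: "gen x y \<Longrightarrow> the (generator T x) = y"
  by (simp flip: generator_eq_Some_iff)

lemma resolvent_bij:
  assumes \<mu>: "Re \<mu> \<noteq> 0"
  shows "bij_betw (\<lambda>x. \<mu> *\<^sub>C x - the (generator T x)) (dom (generator T)) UNIV"
  unfolding bij_betw_def
proof
  show "inj_on (\<lambda>x. \<mu> *\<^sub>C x - the (generator T x)) (dom (generator T))"
  proof (rule inj_onI)
    fix u v assume "u \<in> dom (generator T)" "v \<in> dom (generator T)"
      and eq: "\<mu> *\<^sub>C u - the (generator T u) = \<mu> *\<^sub>C v - the (generator T v)"
    then obtain u' v' where g: "gen u u'" "gen v v'" by (auto simp: in_dom)
    have "\<mu> *\<^sub>C u - u' = \<mu> *\<^sub>C v - v'" using eq by (simp add: the_generator[OF g(1)] the_generator[OF g(2)])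
    then have "u' - v' = \<mu> *\<^sub>C (u - v)" by (simp add: scaleC_diff_right algebra_simps)
    then have "gen (u - v) (\<mu> *\<^sub>C (u - v))" using gen_diff[OF g] by simp
    then show "u = v" using no_eigenvector[OF \<mu>] by force
  qed
  have "x \<in> (\<lambda>x. \<mu> *\<^sub>C x - the (generator T x)) ` dom (generator T)" for x
  proof -
    obtain z where z: "gen z (\<mu> *\<^sub>C z - x)" using resolvent_exists[OF \<mu>] by blast
    then show ?thesis by (intro image_eqI[of _ _ z]) (auto simp: in_dom the_generator)
  qed
  then show "(\<lambda>x. \<mu> *\<^sub>C x - the (generator T x)) ` dom (generator T) = UNIV" by auto
qed

lemma resolvent_eqI:
  assumes bij: "bij_betw (\<lambda>x. \<mu> *\<^sub>C x - the (generator T x)) (dom (generator T)) UNIV"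
    and z: "gen z (\<mu> *\<^sub>C z - x)"
  shows "R \<mu> x = z"
proof -
  have "z \<in> dom (generator T)" using z by (auto simp: in_dom)
  moreover have "inj_on (\<lambda>x. \<mu> *\<^sub>C x - the (generator T x)) (dom (generator T))"
    using bij by (simp add: bij_betw_def)
  ultimately have "inv_into (dom (generator T)) (\<lambda>x. \<mu> *\<^sub>C x - the (generator T x))
      (\<mu> *\<^sub>C z - the (generator T z)) = z"
    by (intro inv_into_f_f)
  then show ?thesis by (simp add: resolvent_def the_generator[OF z])
qed

lemma R_eqI: "Re \<mu> \<noteq> 0 \<Longrightarrow> gen z (\<mu> *\<^sub>C z - x) \<Longrightarrow> R \<mu> x = z"
  by (rule resolvent_eqI[OF resolvent_bij])

lemma gen_R: "Re \<mu> \<noteq> 0 \<Longrightarrow> gen (R \<mu> x) (\<mu> *\<^sub>C R \<mu> x - x)"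
  using resolvent_exists[of \<mu> x] R_eqI by blast

lemma R_bound: "Re \<mu> \<noteq> 0 \<Longrightarrow> norm (R \<mu> x) \<le> res_bound \<bar>Re \<mu>\<bar> * norm x"
  using resolvent_exists[of \<mu> x] R_eqI by blast

lemma R_clinear: assumes \<mu>: "Re \<mu> \<noteq> 0" shows "bounded_clinear (R \<mu>)"
proof -
  have scale: "R \<mu> (c *\<^sub>C x) = c *\<^sub>C R \<mu> x" for c x
    using gen_scale[OF gen_R[OF \<mu>], of c x]
    by (intro R_eqI[OF \<mu>]) (simp add: scaleC_diff_right scaleC_scaleC mult.commute)
  have "bounded_linear (R \<mu>)"
  proof (rule bounded_linear_intro)
    show "R \<mu> (x + y) = R \<mu> x + R \<mu> y" for x y
      using gen_add[OF gen_R[OF \<mu>, of x] gen_R[OF \<mu>, of y]]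
      by (intro R_eqI[OF \<mu>]) (simp add: scaleC_add_right algebra_simps)
    show "R \<mu> (r *\<^sub>R x) = r *\<^sub>R R \<mu> x" for r x
      using scale[of "of_real r" x] by (simp add: scaleC_of_real)
    show "norm (R \<mu> x) \<le> norm x * res_bound \<bar>Re \<mu>\<bar>" for x
      using R_bound[OF \<mu>] by (simp add: mult.commute)
  qed
  then show ?thesis using scale by (simp add: bounded_clinear_def)
qed

lemma in_resolvent_set: "Re \<mu> \<noteq> 0 \<Longrightarrow> \<mu> \<in> resolvent_set (generator T)"
  by (simp add: resolvent_set_def resolvent_bij R_clinear)

lemma R_add: "Re \<mu> \<noteq> 0 \<Longrightarrow> R \<mu> (x + y) = R \<mu> x + R \<mu> y"
  by (rule bounded_clinear_add[OF R_clinear])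

lemma R_diff: "Re \<mu> \<noteq> 0 \<Longrightarrow> R \<mu> (x - y) = R \<mu> x - R \<mu> y"
  by (rule bounded_clinear_diff[OF R_clinear])

lemma R_scale: "Re \<mu> \<noteq> 0 \<Longrightarrow> R \<mu> (c *\<^sub>C x) = c *\<^sub>C R \<mu> x"
  by (rule bounded_clinear_scaleC[OF R_clinear])

lemma resolvent_identity:
  assumes "Re \<mu> \<noteq> 0" "Re \<nu> \<noteq> 0"
  shows "R \<mu> x = R \<nu> x + (\<nu> - \<mu>) *\<^sub>C R \<mu> (R \<nu> x)"
proof (rule R_eqI[OF assms(1)])
  have "gen (R \<nu> x + (\<nu> - \<mu>) *\<^sub>C R \<mu> (R \<nu> x))
      (\<nu> *\<^sub>C R \<nu> x - x + (\<nu> - \<mu>) *\<^sub>C (\<mu> *\<^sub>C R \<mu> (R \<nu> x) - R \<nu> x))"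
    by (intro gen_add gen_scale gen_R assms)
  moreover have "\<nu> *\<^sub>C R \<nu> x - x + (\<nu> - \<mu>) *\<^sub>C (\<mu> *\<^sub>C R \<mu> (R \<nu> x) - R \<nu> x) =
      \<mu> *\<^sub>C (R \<nu> x + (\<nu> - \<mu>) *\<^sub>C R \<mu> (R \<nu> x)) - x"
    by (simp add: scaleC_diff_right scaleC_add_right scaleC_diff_left scaleC_scaleC algebra_simps)
  ultimately show "gen (R \<nu> x + (\<nu> - \<mu>) *\<^sub>C R \<mu> (R \<nu> x))
      (\<mu> *\<^sub>C (R \<nu> x + (\<nu> - \<mu>) *\<^sub>C R \<mu> (R \<nu> x)) - x)" by simp
qed

lemma R_commute:
  assumes "Re \<mu> \<noteq> 0" "Re \<nu> \<noteq> 0"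
  shows "R \<mu> (R \<nu> x) = R \<nu> (R \<mu> x)"
proof (cases "\<mu> = \<nu>")
  case False
  have "(\<nu> - \<mu>) *\<^sub>C R \<mu> (R \<nu> x) = R \<mu> x - R \<nu> x"
    by (metis resolvent_identity[OF assms] add_diff_cancel_left')
  also have "\<dots> = - (R \<nu> x - R \<mu> x)" by simp
  also have "R \<nu> x - R \<mu> x = (\<mu> - \<nu>) *\<^sub>C R \<nu> (R \<mu> x)"
    by (metis resolvent_identity[OF assms(2,1)] add_diff_cancel_left')
  also have "- \<dots> = (\<nu> - \<mu>) *\<^sub>C R \<nu> (R \<mu> x)"
    by (simp flip: scaleC_minus_left)
  finally have "(\<nu> - \<mu>) *\<^sub>C R \<mu> (R \<nu> x) = (\<nu> - \<mu>) *\<^sub>C R \<nu> (R \<mu> x)" .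
  then have "inverse (\<nu> - \<mu>) *\<^sub>C (\<nu> - \<mu>) *\<^sub>C R \<mu> (R \<nu> x) = inverse (\<nu> - \<mu>) *\<^sub>C (\<nu> - \<mu>) *\<^sub>C R \<nu> (R \<mu> x)"
    by simp
  then show ?thesis using False by (simp add: scaleC_scaleC)
qed simp

lemma res_bound_antimono:
  assumes "0 < \<alpha>" "\<alpha> \<le> \<beta>"
  shows "res_bound \<beta> \<le> res_bound \<alpha>"
proof -
  have "\<beta> powr (- a) \<le> \<alpha> powr (- a)"
    using assms a_nonneg by (intro powr_mono2') auto
  then show ?thesis
    unfolding res_bound_def using assms M_nonneg by (intro frac_le mult_left_mono) auto
qed

lemma res_bound_small:
  assumes "0 < \<alpha>" "\<alpha> \<le> 1"
  shows "res_bound \<alpha> \<le> 18 * M * \<alpha> powr (- a) / \<alpha>"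
proof -
  have "1 \<le> \<alpha> powr (- a)" using assms a_nonneg by (simp add: powr_minus field_simps powr_le1)
  then have "2 * M * (1 + 8 * \<alpha> powr (- a)) \<le> 2 * M * (9 * \<alpha> powr (- a))"
    using M_nonneg by (intro mult_left_mono) auto
  then show ?thesis unfolding res_bound_def using assms by (intro divide_right_mono) auto
qed

text \<open>
  The worst case \<open>a = 2\<close>, in the form in which the scalar estimates use it.
\<close>

lemma res_bound_cubic:
  assumes "0 < \<alpha>" "\<alpha> \<le> 1"
  shows "res_bound \<alpha> \<le> 18 * M / \<alpha> ^ 3"
proof -
  have "\<alpha> powr (- a) \<le> \<alpha> powr (- 2)" using assms a_le_2 by (intro powr_mono') auto
  also have "\<alpha> powr (- 2) = 1 / \<alpha>\<^sup>2" using assms by (simp add: powr_minus powr_numeral field_simps)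
  finally have "18 * M * \<alpha> powr (- a) / \<alpha> \<le> 18 * M * (1 / \<alpha>\<^sup>2) / \<alpha>"
    using assms M_nonneg by (intro divide_right_mono mult_left_mono) auto
  also have "\<dots> = 18 * M / \<alpha> ^ 3" by (simp add: power2_eq_square power3_eq_cube)
  finally show ?thesis using res_bound_small[OF assms] by simp
qed

lemma R_continuous:
  assumes \<mu>: "Re \<mu> \<noteq> 0"
  shows "isCont (\<lambda>\<nu>. R \<nu> x) \<mu>"
  unfolding isCont_def
proof (rule Lim_null_comparison[THEN LIM_zero_cancel])
  define B where "B = res_bound (\<bar>Re \<mu>\<bar> / 2) * norm (R \<mu> x)"
  show "\<forall>\<^sub>F \<nu> in at \<mu>. norm (R \<nu> x - R \<mu> x) \<le> cmod (\<mu> - \<nu>) * B"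
    unfolding eventually_at
  proof (intro exI[of _ "\<bar>Re \<mu>\<bar> / 2"] conjI ballI impI)
    fix \<nu> assume "\<nu> \<noteq> \<mu> \<and> dist \<nu> \<mu> < \<bar>Re \<mu>\<bar> / 2"
    then have "\<bar>Re \<nu> - Re \<mu>\<bar> < \<bar>Re \<mu>\<bar> / 2"
      using abs_Re_le_cmod[of "\<nu> - \<mu>"] by (simp add: dist_norm)
    then have \<nu>: "\<bar>Re \<mu>\<bar> / 2 \<le> \<bar>Re \<nu>\<bar>" "Re \<nu> \<noteq> 0" using \<mu> by (auto simp: abs_if split: if_splits)
    have "norm (R \<nu> (R \<mu> x)) \<le> res_bound \<bar>Re \<nu>\<bar> * norm (R \<mu> x)" by (rule R_bound[OF \<nu>(2)])
    also have "\<dots> \<le> B" unfolding B_def using \<mu> \<nu> by (intro mult_right_mono res_bound_antimono) auto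
    finally have "norm (R \<nu> (R \<mu> x)) \<le> B" .
    then show "norm (R \<nu> x - R \<mu> x) \<le> cmod (\<mu> - \<nu>) * B"
      using resolvent_identity[OF \<nu>(2) \<mu>, of x] by (simp add: norm_scaleC mult_left_mono)
  qed (use \<mu> in auto)
  have "((\<lambda>\<nu>. cmod (\<mu> - \<nu>) * B) \<longlongrightarrow> cmod (\<mu> - \<mu>) * B) (at \<mu>)" by (intro tendsto_intros)
  then show "((\<lambda>\<nu>. cmod (\<mu> - \<nu>) * B) \<longlongrightarrow> 0) (at \<mu>)" by simp
qed

lemma functional_R_holomorphic:
  assumes \<phi>: "unit_functional \<phi>"
  shows "(\<lambda>\<mu>. \<phi> (R \<mu> x)) holomorphic_on {\<mu>. Re \<mu> \<noteq> 0}"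
proof (rule holomorphic_onI)
  fix \<mu> assume "\<mu> \<in> {\<mu>. Re \<mu> \<noteq> 0}"
  then have \<mu>: "Re \<mu> \<noteq> 0" by simp
  have lin: "bounded_clinear \<phi>" by (rule unit_functional_linear[OF \<phi>])
  have "((\<lambda>\<nu>. - \<phi> (R \<nu> (R \<mu> x))) \<longlongrightarrow> - \<phi> (R \<mu> (R \<mu> x))) (at \<mu>)"
    using R_continuous[OF \<mu>, of "R \<mu> x"]
    by (intro tendsto_minus bounded_linear.tendsto[OF bounded_clinear_linear[OF lin]]) (simp add: isCont_def)
  then have "((\<lambda>\<nu>. (\<phi> (R \<nu> x) - \<phi> (R \<mu> x)) / (\<nu> - \<mu>)) \<longlongrightarrow> - \<phi> (R \<mu> (R \<mu> x))) (at \<mu>)"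
  proof (rule Lim_transform_eventually)
    show "\<forall>\<^sub>F \<nu> in at \<mu>. - \<phi> (R \<nu> (R \<mu> x)) = (\<phi> (R \<nu> x) - \<phi> (R \<mu> x)) / (\<nu> - \<mu>)"
      unfolding eventually_at
    proof (intro exI[of _ "\<bar>Re \<mu>\<bar>"] conjI ballI impI)
      fix \<nu> assume *: "\<nu> \<noteq> \<mu> \<and> dist \<nu> \<mu> < \<bar>Re \<mu>\<bar>"
      then have "\<bar>Re \<nu> - Re \<mu>\<bar> < \<bar>Re \<mu>\<bar>"
        using abs_Re_le_cmod[of "\<nu> - \<mu>"] by (simp add: dist_norm)
      then have \<nu>: "Re \<nu> \<noteq> 0" by auto
      have "\<phi> (R \<nu> x) = \<phi> (R \<mu> x) + (\<mu> - \<nu>) * \<phi> (R \<nu> (R \<mu> x))"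
        by (subst resolvent_identity[OF \<nu> \<mu>])
          (simp add: bounded_clinear_add[OF lin] unit_functional_scaleC[OF \<phi>])
      then show "- \<phi> (R \<nu> (R \<mu> x)) = (\<phi> (R \<nu> x) - \<phi> (R \<mu> x)) / (\<nu> - \<mu>)"
        using * by (simp add: field_simps)
    qed (use \<mu> in auto)
  qed
  then have "((\<lambda>\<mu>. \<phi> (R \<mu> x)) has_field_derivative - \<phi> (R \<mu> (R \<mu> x))) (at \<mu>)"
    by (simp add: has_field_derivative_iff)
  then show "(\<lambda>\<mu>. \<phi> (R \<mu> x)) field_differentiable at \<mu> within {\<mu>. Re \<mu> \<noteq> 0}"
    using field_differentiable_at_within field_differentiable_def by blast
qed

abbreviation D :: "real \<Rightarrow> real \<Rightarrow> 'a \<Rightarrow> 'a" where "D \<equiv> resolvent_jump (generator T)"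

text \<open>
  The first resolvent identity; the jump is thus a multiple of the resolvent of \<open>(A - i\<beta>)\<^sup>2\<close> at \<open>\<alpha>\<^sup>2\<close>.
\<close>

lemma jump_factored:
  assumes "\<alpha> \<noteq> 0"
  shows "D \<alpha> \<beta> x = (- 2 * of_real \<alpha>) *\<^sub>C R (Complex \<alpha> \<beta>) (R (Complex (- \<alpha>) \<beta>) x)"
proof -
  have "Complex (- \<alpha>) \<beta> - Complex \<alpha> \<beta> = - 2 * of_real \<alpha>" by (simp add: complex_eq_iff)
  then show ?thesis
    using resolvent_identity[of "Complex \<alpha> \<beta>" "Complex (- \<alpha>) \<beta>" x] assms by (simp add: resolvent_jump_def)
qed

lemma jump_bound:
  assumes "0 < \<alpha>" shows "norm (D \<alpha> \<beta> x) \<le> 2 * res_bound \<alpha> * norm x"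
proof -
  have "norm (D \<alpha> \<beta> x) \<le> norm (R (Complex \<alpha> \<beta>) x) + norm (R (Complex (- \<alpha>) \<beta>) x)"
    unfolding resolvent_jump_def by (rule norm_triangle_ineq4)
  then show ?thesis
    using R_bound[of "Complex \<alpha> \<beta>" x] R_bound[of "Complex (- \<alpha>) \<beta>" x] assms by simp
qed

text \<open>
  Here the growth improves from \<open>\<alpha>\<^sup>-\<^sup>a\<^sup>-\<^sup>1\<close> to \<open>\<alpha>\<^sup>-\<^sup>a\<close>. By the factorisation of the jump, the jump at height \<open>\<beta> + s\<close> is
  \<open>(1 - i s R l') (1 - i s R m')\<close> applied to the jump at height \<open>\<beta>\<close>. The terms linear in \<open>s\<close> are
  \<open>O(\<alpha> \<cdot> \<alpha>\<^sup>-\<^sup>a\<^sup>-\<^sup>1)\<close>. The quadratic term contains a product of two resolvents, which is again a jump divided by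
  \<open>2\<alpha>\<close> and so satisfies \<open>O(\<alpha>\<^sup>2 \<cdot> \<alpha>\<^sup>-\<^sup>1 \<cdot> \<alpha>\<^sup>-\<^sup>a\<^sup>-\<^sup>1)\<close>; estimating the two factors separately would lose a factor
  \<open>\<alpha>\<^sup>-\<^sup>a\<close>.
\<close>

lemma jump_in_cone:
  assumes \<alpha>: "0 < \<alpha>" "\<alpha> \<le> 1" and s: "\<bar>s\<bar> \<le> 3 * \<alpha>"
  shows "norm (D \<alpha> (\<beta> + s) x) \<le> (1 + 270 * M) * \<alpha> powr (- a) * norm (D \<alpha> \<beta> x)"
proof -
  define l m l' m' where "l = Complex \<alpha> \<beta>" and "m = Complex (- \<alpha>) \<beta>"
    and "l' = Complex \<alpha> (\<beta> + s)" and "m' = Complex (- \<alpha>) (\<beta> + s)"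
  have Re: "Re l \<noteq> 0" "Re m \<noteq> 0" "Re l' \<noteq> 0" "Re m' \<noteq> 0"
    using \<alpha> by (simp_all add: l_def m_def l'_def m'_def)
  have diff: "l - l' = - (\<i> * of_real s)" "m - m' = - (\<i> * of_real s)"
    by (simp_all add: l_def m_def l'_def m'_def complex_eq_iff)
  define c where "c = \<i> * complex_of_real s"
  have c: "cmod c = \<bar>s\<bar>" by (simp add: c_def norm_mult)
  have step_l: "R l' v = R l v - c *\<^sub>C R l' (R l v)" for v
    using resolvent_identity[OF Re(3) Re(1), of v] by (simp add: diff c_def scaleC_minus_left)
  have step_m: "R m' v = R m v - c *\<^sub>C R m' (R m v)" for v
    using resolvent_identity[OF Re(4) Re(2), of v] by (simp add: diff c_def scaleC_minus_left)
  define p where "p = R l (R m x)"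
  have "R l' (R m' x) = R l' (R m x) - c *\<^sub>C R l' (R m' (R m x))"
    by (subst step_m) (simp add: R_diff[OF Re(3)] R_scale[OF Re(3)])
  also have "R l' (R m' (R m x)) = R m' (R l' (R m x))" by (rule R_commute[OF Re(3,4)])
  also have "R l' (R m x) = p - c *\<^sub>C R l' p" unfolding p_def by (rule step_l)
  also have "R m' (p - c *\<^sub>C R l' p) = R m' p - c *\<^sub>C R m' (R l' p)"
    by (simp add: R_diff[OF Re(4)] R_scale[OF Re(4)])
  finally have prod: "R l' (R m' x) = p - c *\<^sub>C R l' p - c *\<^sub>C (R m' p - c *\<^sub>C R m' (R l' p))" .
  define k where "k = - 2 * complex_of_real \<alpha>"
  define y where "y = D \<alpha> \<beta> x"
  have y: "y = k *\<^sub>C p" using \<alpha> by (simp add: y_def jump_factored p_def k_def l_def m_def)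
  have "D \<alpha> (\<beta> + s) x = k *\<^sub>C (p - c *\<^sub>C R l' p - c *\<^sub>C (R m' p - c *\<^sub>C R m' (R l' p)))"
    using \<alpha> prod by (simp add: jump_factored k_def l'_def m'_def)
  also have "\<dots> = y - c *\<^sub>C R l' y - c *\<^sub>C (R m' y - c *\<^sub>C R m' (R l' y))"
    by (simp add: y R_scale Re scaleC_diff_right scaleC_scaleC mult.left_commute mult.commute)
  finally have eq: "D \<alpha> (\<beta> + s) x = y - c *\<^sub>C R l' y - c *\<^sub>C (R m' y - c *\<^sub>C R m' (R l' y))" .
  define r where "r = \<alpha> powr (- a)"
  have r: "1 \<le> r" using \<alpha> a_nonneg by (simp add: r_def powr_minus field_simps powr_le1)
  define N where "N = norm y"
  have N: "0 \<le> N" by (simp add: N_def)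
  define b where "b = 18 * M * r / \<alpha>"
  have b: "0 \<le> b" using M_nonneg r \<alpha> by (simp add: b_def)
  have Rb: "norm (R l' v) \<le> b * norm v" "norm (R m' v) \<le> b * norm v" for v
  proof -
    have "res_bound \<alpha> * norm v \<le> b * norm v"
      using res_bound_small[OF \<alpha>] by (intro mult_right_mono) (auto simp: b_def r_def)
    then show "norm (R l' v) \<le> b * norm v" "norm (R m' v) \<le> b * norm v"
      using R_bound[OF Re(3), of v] R_bound[OF Re(4), of v] \<alpha> by (auto simp: l'_def m'_def)
  qed
  have "norm (R m' (R l' y)) * (2 * \<alpha>) = norm (D \<alpha> (\<beta> + s) y)"
    using \<alpha> by (simp add: jump_factored R_commute[OF Re(3,4)] l'_def[symmetric] m'_def[symmetric] norm_scaleC norm_mult)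
  also have "\<dots> \<le> norm (R l' y) + norm (R m' y)"
    unfolding resolvent_jump_def l'_def m'_def by (rule norm_triangle_ineq4)
  also have "\<dots> \<le> 2 * b * N" using Rb[of y] by (simp add: N_def)
  finally have RR: "norm (R m' (R l' y)) * \<alpha> \<le> b * N" by simp
  have "norm (D \<alpha> (\<beta> + s) x) \<le> norm y + norm (c *\<^sub>C R l' y) + norm (c *\<^sub>C (R m' y - c *\<^sub>C R m' (R l' y)))"
    unfolding eq by (rule order_trans[OF norm_triangle_ineq4 add_right_mono[OF norm_triangle_ineq4]])
  also have "norm (c *\<^sub>C (R m' y - c *\<^sub>C R m' (R l' y))) \<le> \<bar>s\<bar> * (norm (R m' y) + \<bar>s\<bar> * norm (R m' (R l' y)))"
    unfolding norm_scaleC c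
    by (intro mult_left_mono order_trans[OF norm_triangle_ineq4]) (auto simp: norm_scaleC c)
  also have "norm (c *\<^sub>C R l' y) = \<bar>s\<bar> * norm (R l' y)" by (simp add: norm_scaleC c)
  finally have 1: "norm (D \<alpha> (\<beta> + s) x) \<le> N + \<bar>s\<bar> * norm (R l' y) + \<bar>s\<bar> * (norm (R m' y) + \<bar>s\<bar> * norm (R m' (R l' y)))"
    by (simp add: N_def)
  have 2: "\<bar>s\<bar> * norm (R l' y) \<le> 3 * \<alpha> * (b * N)"
    using s Rb(1)[of y] \<alpha> by (intro mult_mono) (auto simp: N_def)
  have "\<bar>s\<bar> * norm (R m' (R l' y)) \<le> 3 * \<alpha> * norm (R m' (R l' y))"
    using s by (intro mult_right_mono) auto
  also have "\<dots> \<le> 3 * (b * N)" using RR by (simp add: mult.commute mult.left_commute)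
  finally have "norm (R m' y) + \<bar>s\<bar> * norm (R m' (R l' y)) \<le> 4 * (b * N)"
    using Rb(2)[of y] by (simp add: N_def)
  then have 3: "\<bar>s\<bar> * (norm (R m' y) + \<bar>s\<bar> * norm (R m' (R l' y))) \<le> 3 * \<alpha> * (4 * (b * N))"
    using s \<alpha> by (intro mult_mono) auto
  \<comment> \<open>The three terms contribute \<open>1\<close>, \<open>3 \<alpha> b\<close> and \<open>12 \<alpha> b\<close>, and \<open>15 \<cdot> 18 = 270\<close>.\<close>
  have "norm (D \<alpha> (\<beta> + s) x) \<le> N + 15 * (\<alpha> * b) * N" using 1 2 3 by simp
  also have "\<alpha> * b = 18 * M * r" using \<alpha> by (simp add: b_def)
  also have "N + 15 * (18 * M * r) * N \<le> r * N + 15 * (18 * M * r) * N"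
    using r N by (simp add: mult_right_mono[of 1 r N, simplified])
  also have "\<dots> = (1 + 270 * M) * r * N" by (simp add: algebra_simps)
  finally show ?thesis by (simp add: r_def N_def y_def)
qed

end

section \<open>Local spectrum and local resolvent\<close>

context polynomially_bounded_group
begin

abbreviation spec :: "'a \<Rightarrow> complex set" where "spec \<equiv> local_spectrum (generator T)"

lemma not_in_specI:
  assumes "open U" "\<mu> \<in> U" "vholomorphic_on g U" "\<And>\<nu>. \<nu> \<in> U \<Longrightarrow> \<nu> \<in> resolvent_set (generator T) \<Longrightarrow> g \<nu> = R \<nu> x"
  shows "\<mu> \<notin> spec x"
  unfolding local_spectrum_def using assms by blast

lemma not_in_specE:
  assumes "\<mu> \<notin> spec x"
  obtains U g where "open U" "\<mu> \<in> U" "vholomorphic_on g U" "\<And>\<nu>. \<nu> \<in> U \<Longrightarrow> Re \<nu> \<noteq> 0 \<Longrightarrow> g \<nu> = R \<nu> x" "U \<subseteq> - spec x"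
proof -
  obtain U g where U: "open U" "\<mu> \<in> U" "vholomorphic_on g U" "\<forall>\<nu>\<in>U \<inter> resolvent_set (generator T). g \<nu> = R \<nu> x"
    using assms unfolding local_spectrum_def by blast
  moreover have "U \<subseteq> - spec x" using U unfolding local_spectrum_def by blast
  ultimately show ?thesis using in_resolvent_set by (intro that[of U g]) auto
qed

lemma off_axis_not_in_spec:
  assumes \<mu>: "Re \<mu> \<noteq> 0"
  shows "\<mu> \<notin> spec x"
proof (rule not_in_specI)
  define U where "U = ball \<mu> (\<bar>Re \<mu>\<bar> / 2)"
  have U: "\<bar>Re \<mu>\<bar> / 2 \<le> \<bar>Re \<nu>\<bar>" "Re \<nu> \<noteq> 0" if "\<nu> \<in> U" for \<nu>
  proof -
    have "\<bar>Re \<mu> - Re \<nu>\<bar> < \<bar>Re \<mu>\<bar> / 2"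
      using abs_Re_le_cmod[of "\<mu> - \<nu>"] that by (simp add: dist_norm U_def)
    then show "\<bar>Re \<mu>\<bar> / 2 \<le> \<bar>Re \<nu>\<bar>" "Re \<nu> \<noteq> 0" using \<mu> by (auto simp: abs_if split: if_splits)
  qed
  show "open U" "\<mu> \<in> U" using \<mu> by (auto simp: U_def)
  show "vholomorphic_on (\<lambda>\<nu>. R \<nu> x) U"
  proof (rule vholomorphic_if_weakly_holomorphic)
    show "open U" by (simp add: U_def)
    show "(\<lambda>\<nu>. \<phi> (R \<nu> x)) holomorphic_on U" if "unit_functional \<phi>" for \<phi>
      by (rule holomorphic_on_subset[OF functional_R_holomorphic[OF that]]) (use U in auto)
    show "norm (R \<nu> x) \<le> res_bound (\<bar>Re \<mu>\<bar> / 2) * norm x" if "\<nu> \<in> U" for \<nu>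
    proof -
      have "norm (R \<nu> x) \<le> res_bound \<bar>Re \<nu>\<bar> * norm x" by (rule R_bound[OF U(2)[OF that]])
      also have "\<dots> \<le> res_bound (\<bar>Re \<mu>\<bar> / 2) * norm x"
        using U(1)[OF that] \<mu> by (intro mult_right_mono res_bound_antimono) auto
      finally show ?thesis .
    qed
  qed
qed simp

lemma closed_spec: "closed (spec x)"
proof -
  have "\<exists>U. open U \<and> \<mu> \<in> U \<and> U \<subseteq> - spec x" if "\<mu> \<in> - spec x" for \<mu>
    using not_in_specE[of \<mu> x] that by (metis ComplD)
  then have "open (- spec x)" by (subst open_subopen) blast
  then show ?thesis by (simp add: closed_def)
qed

lemma vholomorphic_continuous:
  assumes "vholomorphic_on g U" "open U" "z \<in> U"
  shows "isCont g z"
proof -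
  obtain d where "(g has_derivative (\<lambda>h. h *\<^sub>C d)) (at z within U)"
    using assms by (auto simp: vholomorphic_on_def)
  then have "continuous (at z within U) g" by (rule has_derivative_continuous)
  then show ?thesis using at_within_open[OF assms(3,2)] by simp
qed

lemma functional_vholomorphic:
  assumes "vholomorphic_on g U" "unit_functional \<phi>"
  shows "(\<lambda>z. \<phi> (g z)) holomorphic_on U"
proof (rule holomorphic_onI)
  fix z assume "z \<in> U"
  then obtain d where d: "(g has_derivative (\<lambda>h. h *\<^sub>C d)) (at z within U)"
    using assms by (auto simp: vholomorphic_on_def)
  have "((\<lambda>z. \<phi> (g z)) has_derivative (\<lambda>h. \<phi> (h *\<^sub>C d))) (at z within U)"
    using bounded_linear.has_derivative[OF bounded_clinear_linear[OF unit_functional_linear[OF assms(2)]] d] .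
  then have "((\<lambda>z. \<phi> (g z)) has_derivative (\<lambda>h. \<phi> d * h)) (at z within U)"
    by (simp add: unit_functional_scaleC[OF assms(2)] mult.commute)
  then show "(\<lambda>z. \<phi> (g z)) field_differentiable at z within U"
    unfolding field_differentiable_def has_field_derivative_def by blast
qed

lemma off_axis_sequence: "(\<lambda>n. Complex (inverse (real (Suc n))) \<beta>) \<longlonglongrightarrow> Complex 0 \<beta>"
  by (intro tendsto_Complex tendsto_const LIMSEQ_inverse_real_of_nat)

text \<open>
  One function that represents all local continuations at once: on the imaginary axis it is the limit from
  the right, which is the value of any continuation at a point outside the local spectrum.
\<close>

definition local_resolvent :: "'a \<Rightarrow> complex \<Rightarrow> 'a" where
  "local_resolvent x \<mu> =
    (if Re \<mu> \<noteq> 0 then R \<mu> x else lim (\<lambda>n. R (Complex (inverse (real (Suc n))) (Im \<mu>)) x))"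

lemma local_resolvent_off_axis: "Re \<mu> \<noteq> 0 \<Longrightarrow> local_resolvent x \<mu> = R \<mu> x"
  by (simp add: local_resolvent_def)

lemma local_resolvent_eq:
  assumes g: "vholomorphic_on g U" "open U" "\<And>\<nu>. \<nu> \<in> U \<Longrightarrow> Re \<nu> \<noteq> 0 \<Longrightarrow> g \<nu> = R \<nu> x" and \<mu>: "\<mu> \<in> U"
  shows "local_resolvent x \<mu> = g \<mu>"
proof (cases "Re \<mu> = 0")
  case True
  have \<mu>_eq: "\<mu> = Complex 0 (Im \<mu>)" using True by (simp add: complex_eq_iff)
  define s where "s n = Complex (inverse (real (Suc n))) (Im \<mu>)" for n
  have s: "s \<longlonglongrightarrow> \<mu>"
    using off_axis_sequence[of "Im \<mu>"] unfolding \<mu>_eq[symmetric] s_def[abs_def] .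
  have "(\<lambda>n. g (s n)) \<longlonglongrightarrow> g \<mu>"
    by (rule isCont_tendsto_compose[OF vholomorphic_continuous[OF g(1,2) \<mu>] s])
  moreover have "\<forall>\<^sub>F n in sequentially. s n \<in> U"
    by (rule topological_tendstoD[OF s g(2) \<mu>])
  then have "\<forall>\<^sub>F n in sequentially. g (s n) = R (s n) x"
    by eventually_elim (rule g(3), auto simp: s_def)
  ultimately have "(\<lambda>n. R (s n) x) \<longlonglongrightarrow> g \<mu>"
    by (rule Lim_transform_eventually)
  then show ?thesis using True by (simp add: local_resolvent_def s_def limI)
qed (simp add: local_resolvent_off_axis g(3) \<mu>)

lemma local_resolvent_holomorphic:
  assumes \<phi>: "unit_functional \<phi>"
  shows "(\<lambda>\<mu>. \<phi> (local_resolvent x \<mu>)) holomorphic_on (- spec x)"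
proof (rule holomorphic_onI)
  fix \<mu> assume "\<mu> \<in> - spec x"
  then obtain U g where U: "open U" "\<mu> \<in> U" "vholomorphic_on g U" "\<And>\<nu>. \<nu> \<in> U \<Longrightarrow> Re \<nu> \<noteq> 0 \<Longrightarrow> g \<nu> = R \<nu> x"
    using not_in_specE[of \<mu> x] by (metis ComplD)
  have "(\<lambda>\<mu>. \<phi> (local_resolvent x \<mu>)) holomorphic_on U"
    by (rule holomorphic_transform[OF functional_vholomorphic[OF U(3) \<phi>]])
      (simp add: local_resolvent_eq[OF U(3,1,4)])
  then show "(\<lambda>\<mu>. \<phi> (local_resolvent x \<mu>)) field_differentiable at \<mu> within - spec x"
    using U by (meson field_differentiable_at_within holomorphic_on_imp_differentiable_at)
qed

lemma local_resolvent_continuous: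
  assumes "\<mu> \<notin> spec x"
  shows "isCont (local_resolvent x) \<mu>"
proof -
  obtain U g where U: "open U" "\<mu> \<in> U" "vholomorphic_on g U" "\<And>\<nu>. \<nu> \<in> U \<Longrightarrow> Re \<nu> \<noteq> 0 \<Longrightarrow> g \<nu> = R \<nu> x"
    using not_in_specE[OF assms] by metis
  have "\<forall>\<^sub>F \<nu> in nhds \<mu>. local_resolvent x \<nu> = g \<nu>"
    using eventually_nhds_in_open[OF U(1,2)]
    by eventually_elim (rule local_resolvent_eq[OF U(3,1,4)])
  then show ?thesis using vholomorphic_continuous[OF U(3,1,2)] isCont_cong by blast
qed

text \<open>
  The easy half of the theorem: both terms of the jump approach the same value of the continued
  local resolvent, even for an unrestricted approach to the axis.
\<close>

lemma jump_tendsto_0_unrestricted: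
  assumes "Complex 0 \<beta> \<notin> spec x"
  shows "((\<lambda>z. D (Re z) (Im z) x) \<longlongrightarrow> 0) (at (Complex 0 \<beta>) within {z. 0 < Re z})"
proof -
  have c: "isCont (local_resolvent x) (Complex 0 \<beta>)" by (rule local_resolvent_continuous[OF assms])
  define F where "F = at (Complex 0 \<beta>) within {z. 0 < Re z}"
  have 1: "((\<lambda>z. z) \<longlongrightarrow> Complex 0 \<beta>) F" unfolding F_def by (intro tendsto_intros)
  have "((\<lambda>z. - cnj z) \<longlongrightarrow> - cnj (Complex 0 \<beta>)) F" by (intro tendsto_intros 1)
  moreover have "- cnj (Complex 0 \<beta>) = Complex 0 \<beta>" by (simp add: complex_eq_iff)
  ultimately have 2: "((\<lambda>z. - cnj z) \<longlongrightarrow> Complex 0 \<beta>) F" by simp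
  have "((\<lambda>z. local_resolvent x z - local_resolvent x (- cnj z)) \<longlongrightarrow>
      local_resolvent x (Complex 0 \<beta>) - local_resolvent x (Complex 0 \<beta>)) F"
    by (intro tendsto_diff isCont_tendsto_compose[OF c] 1 2)
  then have "((\<lambda>z. local_resolvent x z - local_resolvent x (- cnj z)) \<longlongrightarrow> 0) F" by simp
  moreover have "\<forall>\<^sub>F z in F. local_resolvent x z - local_resolvent x (- cnj z) = D (Re z) (Im z) x"
    unfolding F_def eventually_at_filter
  proof (intro always_eventually allI impI)
    fix z :: complex assume "z \<in> {z. 0 < Re z}"
    moreover have "Complex (- Re z) (Im z) = - cnj z" by (simp add: complex_eq_iff)
    ultimately show "local_resolvent x z - local_resolvent x (- cnj z) = D (Re z) (Im z) x"
      by (simp add: local_resolvent_off_axis resolvent_jump_def)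
  qed
  ultimately show ?thesis unfolding F_def by (rule Lim_transform_eventually)
qed

lemma jump_tendsto_0:
  assumes "Complex 0 \<beta> \<notin> spec x"
  shows "((\<lambda>\<alpha>. D \<alpha> \<beta> x) \<longlongrightarrow> 0) (at_right 0)"
proof -
  have "((\<lambda>\<alpha>. Complex \<alpha> \<beta>) \<longlongrightarrow> Complex 0 \<beta>) (at_right 0)"
    by (intro tendsto_Complex tendsto_intros)
  moreover have "\<forall>\<^sub>F \<alpha> in at_right 0. Complex \<alpha> \<beta> \<in> {z. 0 < Re z} \<and> Complex \<alpha> \<beta> \<noteq> Complex 0 \<beta>"
    by (auto simp: eventually_at_filter)
  ultimately have "filterlim (\<lambda>\<alpha>. Complex \<alpha> \<beta>) (at (Complex 0 \<beta>) within {z. 0 < Re z}) (at_right 0)"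
    by (simp add: filterlim_at)
  from filterlim_compose[OF jump_tendsto_0_unrestricted[OF assms] this] show ?thesis by simp
qed

section \<open>Growth of the jump near the ends of a gap\<close>

text \<open>
  A holomorphic function with the same real part as \<open>\<phi> (D x)\<close>; conjugating the second term turns the
  antiholomorphic summand into a holomorphic one.
\<close>

definition weak_jump :: "('a \<Rightarrow> complex) \<Rightarrow> 'a \<Rightarrow> complex \<Rightarrow> complex" where
  "weak_jump \<phi> x z = \<phi> (R z x) - cnj (\<phi> (R (- cnj z) x))"

lemma Re_weak_jump:
  assumes "unit_functional \<phi>"
  shows "Re (weak_jump \<phi> x z) = Re (\<phi> (D (Re z) (Im z) x))"
proof -
  have "Complex (- Re z) (Im z) = - cnj z" by (simp add: complex_eq_iff)
  then show ?thesis
    by (simp add: weak_jump_def resolvent_jump_def bounded_clinear_diff[OF unit_functional_linear[OF assms]])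
qed

lemma Re_weak_jump_le:
  assumes "unit_functional \<phi>"
  shows "\<bar>Re (weak_jump \<phi> x z)\<bar> \<le> norm (D (Re z) (Im z) x)"
  unfolding Re_weak_jump[OF assms]
  using abs_Re_le_cmod unit_functional_le[OF assms] by (rule order_trans)

lemma weak_jump_holomorphic:
  assumes \<phi>: "unit_functional \<phi>"
  shows "weak_jump \<phi> x holomorphic_on {z. 0 < Re z}"
proof -
  have openH: "open {z. 0 < Re z}" by (intro open_Collect_less continuous_intros)
  have 1: "(\<lambda>z. \<phi> (R z x)) holomorphic_on {z. 0 < Re z}"
    by (rule holomorphic_on_subset[OF functional_R_holomorphic[OF \<phi>]]) auto
  have "uminus ` cnj ` {z. 0 < Re z} \<subseteq> {z. Re z \<noteq> 0}" by auto
  moreover have "uminus holomorphic_on cnj ` {z. 0 < Re z}" by (intro holomorphic_intros)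
  ultimately have "(\<lambda>w. \<phi> (R (- w) x)) holomorphic_on cnj ` {z. 0 < Re z}"
    using holomorphic_on_compose_gen[OF _ functional_R_holomorphic[OF \<phi>], of uminus] by (simp add: o_def)
  from holomorphic_on_compose_cnj_cnj[OF this openH]
  have 2: "(\<lambda>z. cnj (\<phi> (R (- cnj z) x))) holomorphic_on {z. 0 < Re z}" by (simp add: o_def)
  show ?thesis unfolding weak_jump_def[abs_def] by (intro holomorphic_intros 1 2)
qed

lemma R_cubic_bound:
  assumes "Re z \<noteq> 0" "\<bar>Re z\<bar> \<le> 1" and "unit_functional \<phi>"
  shows "cmod (\<phi> (R z x)) \<le> 18 * M * norm x / \<bar>Re z\<bar> ^ 3"
proof -
  have "cmod (\<phi> (R z x)) \<le> res_bound \<bar>Re z\<bar> * norm x"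
    using unit_functional_le[OF assms(3)] R_bound[OF assms(1)] by (rule order_trans)
  also have "\<dots> \<le> 18 * M / \<bar>Re z\<bar> ^ 3 * norm x"
    using assms by (intro mult_right_mono res_bound_cubic) auto
  finally show ?thesis by simp
qed

text \<open>
  Growth towards the end of a gap of the spectrum, where \<open>s\<close> is the distance to the end. If \<open>\<alpha>\<close> is comparable
  to \<open>s\<close>, this is the bound of the resolvent. Otherwise the local resolvent is holomorphic in a disc with radius
  \<open>2s/3\<close>, and \<open>bound_from_distance_to_axis\<close> applies. In the first case the constant is
  \<open>2 \<cdot> 18 \<cdot> 64\<close>, in the second it is \<open>2 \<cdot> 19 \<cdot> 18 \<cdot> 8 = 5472\<close>.
\<close>

lemma weak_jump_growth:
  assumes \<phi>: "unit_functional \<phi>" and \<alpha>: "0 < \<alpha>" "\<alpha> \<le> 1" and s: "0 < s" "s \<le> 1"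
    and regular: "\<And>t. \<bar>t - \<beta>\<bar> < s \<Longrightarrow> Complex 0 t \<notin> spec x"
  shows "cmod (weak_jump \<phi> x (Complex \<alpha> \<beta>)) \<le> 5472 * M * norm x / (\<alpha> + s) ^ 3"
proof -
  define z where "z = Complex \<alpha> \<beta>"
  have Mx: "0 \<le> M * norm x" using M_nonneg by simp
  have sum: "cmod (weak_jump \<phi> x z) \<le> cmod (\<phi> (R z x)) + cmod (\<phi> (R (- cnj z) x))"
    unfolding weak_jump_def using norm_triangle_ineq4[of "\<phi> (R z x)" "cnj (\<phi> (R (- cnj z) x))"] by simp
  have pos: "0 < (\<alpha> + s) ^ 3" using \<alpha> s by simp
  show ?thesis
  proof (cases "s \<le> 3 * \<alpha>")
    case True
    have "cmod (weak_jump \<phi> x z) \<le> 2 * (18 * M * norm x / \<alpha> ^ 3)"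
      using sum R_cubic_bound[of z \<phi> x] R_cubic_bound[of "- cnj z" \<phi> x] \<alpha> \<phi> by (simp add: z_def)
    also have "1 / \<alpha> ^ 3 \<le> 64 / (\<alpha> + s) ^ 3"
    proof -
      have "(\<alpha> + s) ^ 3 \<le> (4 * \<alpha>) ^ 3" using True \<alpha> s by (intro power_mono) auto
      then show ?thesis using \<alpha> pos by (simp add: field_simps power_mult_distrib)
    qed
    then have "M * norm x * (1 / \<alpha> ^ 3) \<le> M * norm x * (64 / (\<alpha> + s) ^ 3)"
      using Mx by (intro mult_left_mono) auto
    then have "2 * (18 * M * norm x / \<alpha> ^ 3) \<le> 2304 * (M * norm x / (\<alpha> + s) ^ 3)" by simp
    also have "\<dots> \<le> 5472 * (M * norm x / (\<alpha> + s) ^ 3)"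
      using Mx pos by (intro mult_right_mono) auto
    finally show ?thesis by (simp add: z_def mult.assoc)
  next
    case False
    define r where "r = 2 * s / 3"
    have r: "0 < r" "r \<le> 1" using s by (auto simp: r_def)
    define z0 where "z0 = Complex 0 \<beta>"
    have hb: "cmod (\<phi> (local_resolvent x v)) \<le> 19 * (18 * M * norm x) / r ^ 3" if "cmod (v - z0) \<le> r / 2" for v
    proof (rule bound_from_distance_to_axis[OF _ _ local_resolvent_holomorphic[OF \<phi>, of x] _ r(1) _ _ that])
      show "open (- spec x)" using closed_spec by auto
      show "cball z0 r \<subseteq> - spec x"
      proof
        fix v assume v: "v \<in> cball z0 r"
        show "v \<in> - spec x"
        proof (cases "Re v = 0")
          case True
          then have v_eq: "v = Complex 0 (Im v)" by (simp add: complex_eq_iff)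
          have "\<bar>Im v - \<beta>\<bar> \<le> r"
            using v abs_Im_le_cmod[of "v - z0"] by (simp add: dist_norm norm_minus_commute z0_def)
          then have "Complex 0 (Im v) \<notin> spec x" using s by (intro regular) (simp add: r_def)
          then show ?thesis using v_eq by simp
        next
          case False
          then show ?thesis using off_axis_not_in_spec by simp
        qed
      qed
      show "cmod (\<phi> (local_resolvent x v)) \<le> 18 * M * norm x / \<bar>Re v\<bar> ^ 3"
        if v: "v \<in> cball z0 r" "Re v \<noteq> 0" for v
      proof -
        have "\<bar>Re v\<bar> \<le> r"
          using v abs_Re_le_cmod[of "v - z0"] by (simp add: dist_norm norm_minus_commute z0_def)
        then show ?thesis using R_cubic_bound[OF v(2) _ \<phi>, of x] r v(2) by (simp add: local_resolvent_off_axis)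
      qed
    qed (use Mx in \<open>auto simp: z0_def\<close>)
    have "z - z0 = of_real \<alpha>" "- cnj z - z0 = - of_real \<alpha>" by (auto simp: z_def z0_def complex_eq_iff)
    then have "cmod (z - z0) \<le> r / 2" "cmod (- cnj z - z0) \<le> r / 2"
      using False \<alpha> by (auto simp: r_def)
    from hb[OF this(1)] hb[OF this(2)]
    have "cmod (weak_jump \<phi> x z) \<le> 2 * (19 * (18 * M * norm x) / r ^ 3)"
      using sum \<alpha> by (simp add: local_resolvent_off_axis z_def)
    also have "\<dots> = 684 * (M * norm x * (1 / r ^ 3))" by simp
    also have "1 / r ^ 3 \<le> 8 / (\<alpha> + s) ^ 3"
    proof -
      have "(\<alpha> + s) ^ 3 \<le> (2 * r) ^ 3" using False \<alpha> s by (intro power_mono) (auto simp: r_def)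
      then show ?thesis using r pos by (simp add: field_simps power_mult_distrib)
    qed
    then have "684 * (M * norm x * (1 / r ^ 3)) \<le> 684 * (M * norm x * (8 / (\<alpha> + s) ^ 3))"
      using Mx by (intro mult_left_mono) auto
    finally show ?thesis by (simp add: z_def mult.assoc)
  qed
qed

text \<open>
  The jump at the vertex controls the jump in the cone, with a loss of \<open>\<alpha>\<^sup>-\<^sup>a\<close> that the hypothesis compensates up to
  \<open>o(\<alpha>\<^sup>-\<^sup>2)\<close>. In the cone \<open>\<alpha>\<close> and the distance to the vertex are comparable.
\<close>

lemma weak_jump_small_in_cone:
  assumes \<phi>: "unit_functional \<phi>"
    and S: "((\<lambda>\<alpha>. \<alpha> powr (2 - a) * norm (D \<alpha> e x)) \<longlongrightarrow> 0) (at_right 0)" and \<epsilon>: "0 < \<epsilon>"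
  shows "\<exists>\<rho>>0. \<forall>z. 0 < Re z \<longrightarrow> cmod (z - Complex 0 e) < \<rho> \<longrightarrow> \<bar>Im z - e\<bar> \<le> 3 * Re z \<longrightarrow>
    Re (weak_jump \<phi> x z) \<le> \<epsilon> / cmod (z - Complex 0 e) ^ 2"
proof -
  define K where "K = 1 + 270 * M"
  have K: "1 \<le> K" using M_nonneg by (simp add: K_def)
  have "\<forall>\<^sub>F \<alpha> in at_right 0. \<alpha> powr (2 - a) * norm (D \<alpha> e x) < \<epsilon> / (10 * K)"
    using \<epsilon> K by (intro order_tendstoD(2)[OF S]) auto
  then obtain \<rho> where \<rho>: "0 < \<rho>" "\<And>\<alpha>. 0 < \<alpha> \<Longrightarrow> \<alpha> < \<rho> \<Longrightarrow> \<alpha> powr (2 - a) * norm (D \<alpha> e x) < \<epsilon> / (10 * K)"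
    unfolding eventually_at_right_field by auto
  show ?thesis
  proof (intro exI[of _ "min \<rho> 1"] conjI allI impI)
    fix z assume z: "0 < Re z" "cmod (z - Complex 0 e) < min \<rho> 1" "\<bar>Im z - e\<bar> \<le> 3 * Re z"
    define \<alpha> s where "\<alpha> = Re z" and "s = Im z - e"
    have \<alpha>: "0 < \<alpha>" "\<alpha> < \<rho>" "\<alpha> \<le> 1" and s: "\<bar>s\<bar> \<le> 3 * \<alpha>"
      using z abs_Re_le_cmod[of "z - Complex 0 e"] by (auto simp: \<alpha>_def s_def)
    have "Re (weak_jump \<phi> x z) \<le> norm (D \<alpha> (e + s) x)"
      using Re_weak_jump_le[OF \<phi>, of x z] by (simp add: \<alpha>_def s_def)
    also have "\<dots> \<le> K * \<alpha> powr (- a) * norm (D \<alpha> e x)"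
      unfolding K_def by (rule jump_in_cone[OF \<alpha>(1,3) s])
    also have "\<alpha> powr (- a) = \<alpha> powr (2 - a) / \<alpha>\<^sup>2"
      using \<alpha> by (simp add: powr_diff powr_minus powr_numeral field_simps)
    also have "K * (\<alpha> powr (2 - a) / \<alpha>\<^sup>2) * norm (D \<alpha> e x) = K / \<alpha>\<^sup>2 * (\<alpha> powr (2 - a) * norm (D \<alpha> e x))"
      by simp
    also have "\<dots> \<le> K / \<alpha>\<^sup>2 * (\<epsilon> / (10 * K))"
      using K \<rho>(2)[OF \<alpha>(1,2)] by (intro mult_left_mono) auto
    also have "\<dots> = \<epsilon> / (10 * \<alpha>\<^sup>2)" using K by simp
    also have "\<dots> \<le> \<epsilon> / cmod (z - Complex 0 e) ^ 2"
    proof (rule divide_left_mono)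
      have "s\<^sup>2 \<le> (3 * \<alpha>)\<^sup>2" using s by (metis abs_ge_zero power2_abs power_mono)
      then show "cmod (z - Complex 0 e) ^ 2 \<le> 10 * \<alpha>\<^sup>2"
        by (simp add: cmod_power2 \<alpha>_def s_def power_mult_distrib)
      have "z - Complex 0 e \<noteq> 0" using z(1) by (auto simp: complex_eq_iff)
      then show "0 < (10 * \<alpha>\<^sup>2) * cmod (z - Complex 0 e) ^ 2" using \<alpha> by simp
    qed (use \<epsilon> \<alpha> in auto)
    finally show "Re (weak_jump \<phi> x z) \<le> \<epsilon> / cmod (z - Complex 0 e) ^ 2" .
  qed (use \<rho>(1) in simp)
qed

text \<open>
  \<open>strip_bound\<close> for the strip of width 1 over a gap of the spectrum. It is essential that the bound inside is the
  bound on the sides, for the gaps may be arbitrarily short.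
\<close>

lemma jump_bound_in_gap:
  assumes cd: "c < d" and C: "0 \<le> C"
    and gap: "\<And>\<beta>. c < \<beta> \<Longrightarrow> \<beta> < d \<Longrightarrow> Complex 0 \<beta> \<notin> spec x"
    and sides: "\<And>\<alpha>. 0 < \<alpha> \<Longrightarrow> \<alpha> \<le> 1 \<Longrightarrow> norm (D \<alpha> c x) \<le> C" "\<And>\<alpha>. 0 < \<alpha> \<Longrightarrow> \<alpha> \<le> 1 \<Longrightarrow> norm (D \<alpha> d x) \<le> C"
    and top: "\<And>\<beta>. norm (D 1 \<beta> x) \<le> C"
    and S: "((\<lambda>\<alpha>. \<alpha> powr (2 - a) * norm (D \<alpha> c x)) \<longlongrightarrow> 0) (at_right 0)"
      "((\<lambda>\<alpha>. \<alpha> powr (2 - a) * norm (D \<alpha> d x)) \<longlongrightarrow> 0) (at_right 0)"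
    and \<alpha>: "0 < \<alpha>" "\<alpha> < 1" and \<beta>: "c < \<beta>" "\<beta> < d"
  shows "norm (D \<alpha> \<beta> x) \<le> C"
proof (rule norm_le_if_functionals_le)
  fix \<phi> :: "'a \<Rightarrow> complex" assume \<phi>: "unit_functional \<phi>"
  have "Re (weak_jump \<phi> x (Complex \<alpha> \<beta>)) \<le> C"
  proof (rule strip_bound[where f = "weak_jump \<phi> x" and z = "Complex \<alpha> \<beta>" and c = c and d = d and B = "5472 * M * norm x" and ?r0.0 = "min ((d - c) / 2) (1/2)"])
    show "weak_jump \<phi> x holomorphic_on {z. 0 < Re z}" by (rule weak_jump_holomorphic[OF \<phi>])
    show "Re (weak_jump \<phi> x (Complex t c)) \<le> C" "Re (weak_jump \<phi> x (Complex t d)) \<le> C" if "0 < t" "t \<le> 1" for t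
      using Re_weak_jump_le[OF \<phi>, of x "Complex t c"] Re_weak_jump_le[OF \<phi>, of x "Complex t d"]
        sides[OF that] by auto
    show "Re (weak_jump \<phi> x (Complex 1 s)) \<le> C" for s
      using Re_weak_jump_le[OF \<phi>, of x "Complex 1 s"] top[of s] by auto
    show "\<forall>\<^sub>F z in at (Complex 0 s) within {z. 0 < Re z}. Re (weak_jump \<phi> x z) \<le> e"
      if "c < s" "s < d" "0 < e" for s e
    proof -
      have "\<forall>\<^sub>F z in at (Complex 0 s) within {z. 0 < Re z}. norm (D (Re z) (Im z) x) < e"
        using order_tendstoD(2)[OF tendsto_norm_zero[OF jump_tendsto_0_unrestricted[OF gap]]] that by blast
      then show ?thesis
      proof eventually_elim
        case (elim z)
        then show ?case using Re_weak_jump_le[OF \<phi>, of x z] by linarith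
      qed
    qed
    have growth: "Re (weak_jump \<phi> x z) \<le> 5472 * M * norm x / cmod (z - Complex 0 e) ^ 3"
      if z: "0 < Re z" "c < Im z" "Im z < d" "cmod (z - Complex 0 e) < min ((d - c) / 2) (1/2)" and e: "e = c \<or> e = d" for z e
    proof -
      have ReIm: "Re z < 1/2" "\<bar>Im z - e\<bar> < (d - c) / 2" "\<bar>Im z - e\<bar> < 1/2"
        using z abs_Re_le_cmod[of "z - Complex 0 e"] abs_Im_le_cmod[of "z - Complex 0 e"] by auto
      have "Re (weak_jump \<phi> x z) \<le> cmod (weak_jump \<phi> x (Complex (Re z) (Im z)))"
        using complex_Re_le_cmod by simp
      also have "\<dots> \<le> 5472 * M * norm x / (Re z + \<bar>Im z - e\<bar>) ^ 3"
      proof (rule weak_jump_growth[OF \<phi>])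
        show "Complex 0 t \<notin> spec x" if "\<bar>t - Im z\<bar> < \<bar>Im z - e\<bar>" for t
          using that ReIm(2) e z by (intro gap) (auto simp: abs_if split: if_splits)
      qed (use z e ReIm in auto)
      also have "\<dots> \<le> 5472 * M * norm x / cmod (z - Complex 0 e) ^ 3"
      proof (rule divide_left_mono)
        show "cmod (z - Complex 0 e) ^ 3 \<le> (Re z + \<bar>Im z - e\<bar>) ^ 3"
          using cmod_le[of "z - Complex 0 e"] z by (intro power_mono) auto
        have "z - Complex 0 e \<noteq> 0" using z(1) by (auto simp: complex_eq_iff)
        then show "0 < (Re z + \<bar>Im z - e\<bar>) ^ 3 * cmod (z - Complex 0 e) ^ 3"
          using z by (intro mult_pos_pos zero_less_power) auto
      qed (use M_nonneg in auto)
      finally show ?thesis .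
    qed
    show "Re (weak_jump \<phi> x z) \<le> 5472 * M * norm x / cmod (z - Complex 0 c) ^ 3"
      if "z \<in> {z. 0 < Re z \<and> Re z < 1 \<and> c < Im z \<and> Im z < d}" "cmod (z - Complex 0 c) < min ((d - c) / 2) (1/2)" for z
      using that by (intro growth) auto
    show "Re (weak_jump \<phi> x z) \<le> 5472 * M * norm x / cmod (z - Complex 0 d) ^ 3"
      if "z \<in> {z. 0 < Re z \<and> Re z < 1 \<and> c < Im z \<and> Im z < d}" "cmod (z - Complex 0 d) < min ((d - c) / 2) (1/2)" for z
      using that by (intro growth) auto
    show "\<exists>\<rho>>0. \<forall>z\<in>{z. 0 < Re z \<and> Re z < 1 \<and> c < Im z \<and> Im z < d}. cmod (z - Complex 0 c) < \<rho> \<longrightarrow>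
        Im z - c \<le> 3 * Re z \<longrightarrow> Re (weak_jump \<phi> x z) \<le> \<epsilon> / cmod (z - Complex 0 c) ^ 2" if "0 < \<epsilon>" for \<epsilon>
      using weak_jump_small_in_cone[OF \<phi> S(1) that] by fastforce
    show "\<exists>\<rho>>0. \<forall>z\<in>{z. 0 < Re z \<and> Re z < 1 \<and> c < Im z \<and> Im z < d}. cmod (z - Complex 0 d) < \<rho> \<longrightarrow>
        d - Im z \<le> 3 * Re z \<longrightarrow> Re (weak_jump \<phi> x z) \<le> \<epsilon> / cmod (z - Complex 0 d) ^ 2" if "0 < \<epsilon>" for \<epsilon>
      using weak_jump_small_in_cone[OF \<phi> S(2) that] by fastforce
    show "min ((d - c) / 2) (1 / 2) < d - c" using cd by (auto simp: min_def)
  qed (use cd C M_nonneg \<alpha> \<beta> in auto)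
  then show "Re (\<phi> (D \<alpha> \<beta> x)) \<le> C" using Re_weak_jump[OF \<phi>, of x "Complex \<alpha> \<beta>"] by simp
qed

section \<open>Continuation of the local resolvent\<close>

text \<open>
  For each functional the scalar function continues to the same disc with the same bound, by
  \<open>two_sided_extension\<close> and \<open>bound_from_distance_to_axis\<close>. The resulting Lipschitz estimate makes the
  local resolvent uniformly continuous off the axis, so it has a continuous extension in norm, which is weakly
  holomorphic. The definition of the local spectrum also asks for agreement at those points of the axis that happen
  to lie in the resolvent set; there the resolvent identity passes to the limit.
\<close>

lemma regular_if_jump_bounded:
  assumes \<delta>: "0 < \<delta>"
    and C: "\<And>\<alpha> \<beta>. 0 < \<alpha> \<Longrightarrow> \<alpha> \<le> 1 \<Longrightarrow> \<bar>\<beta> - \<beta>0\<bar> < \<delta> \<Longrightarrow> norm (D \<alpha> \<beta> x) \<le> C"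
    and W: "\<And>\<phi> \<beta>. unit_functional \<phi> \<Longrightarrow> \<bar>\<beta> - \<beta>0\<bar> < \<delta> \<Longrightarrow> ((\<lambda>\<alpha>. \<phi> (D \<alpha> \<beta> x)) \<longlongrightarrow> 0) (at_right 0)"
  shows "Complex 0 \<beta>0 \<notin> spec x"
proof -
  define z0 where "z0 = Complex 0 \<beta>0"
  define r where "r = min \<delta> 1"
  have r: "0 < r" "r \<le> \<delta>" "r \<le> 1" using \<delta> by (auto simp: r_def)
  \<comment> \<open>The scalar continuations live on the disc with radius \<open>r/16\<close>. The estimate across the axis, for the radius
    \<open>r/32\<close>, bounds them on the concentric disc of half this radius, and a Cauchy estimate halves it once more.\<close>
  define \<rho> where "\<rho> = r / 128"
  have \<rho>: "0 < \<rho>" using r by (simp add: \<rho>_def)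
  define B where "B = 19 * (18 * M * norm x) / (r / 32) ^ 3"
  have B0: "0 \<le> B" using M_nonneg r by (simp add: B_def)
  define L where "L = B / \<rho>"
  have ext: "\<exists>g. g holomorphic_on ball z0 (r / 16) \<and> (\<forall>z\<in>ball z0 (r / 16). Re z \<noteq> 0 \<longrightarrow> g z = \<phi> (R z x)) \<and>
      (\<forall>z\<in>cball z0 (2 * \<rho>). cmod (g z) \<le> B)" if \<phi>: "unit_functional \<phi>" for \<phi>
  proof -
    define h where "h w = \<phi> (R (w + z0) x)" for w
    have "\<exists>g. g holomorphic_on ball 0 (r / 16) \<and> (\<forall>w\<in>ball 0 (r / 16). Re w \<noteq> 0 \<longrightarrow> g w = h w)"
    proof (rule two_sided_extension[of h r C])
      have "(\<lambda>w. w + z0) holomorphic_on {z. Re z \<noteq> 0 \<and> cmod z < r}" by (intro holomorphic_intros)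
      moreover have "(\<lambda>w. w + z0) ` {z. Re z \<noteq> 0 \<and> cmod z < r} \<subseteq> {\<mu>. Re \<mu> \<noteq> 0}"
        by (auto simp: z0_def)
      ultimately show "h holomorphic_on {z. Re z \<noteq> 0 \<and> cmod z < r}"
        using holomorphic_on_compose_gen[OF _ functional_R_holomorphic[OF \<phi>, of x]]
        by (simp add: h_def[abs_def] o_def)
      have eq: "h (Complex \<alpha> \<beta>) - h (Complex (- \<alpha>) \<beta>) = \<phi> (D \<alpha> (\<beta> + \<beta>0) x)" for \<alpha> \<beta>
      proof -
        have "Complex t \<beta> + z0 = Complex t (\<beta> + \<beta>0)" for t by (simp add: z0_def complex_eq_iff)
        then show ?thesis
          by (simp add: h_def resolvent_jump_def bounded_clinear_diff[OF unit_functional_linear[OF \<phi>]])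
      qed
      show "cmod (h z - h (- cnj z)) \<le> C" if z: "0 < Re z" "cmod z < r" for z
      proof -
        have "- cnj z = Complex (- Re z) (Im z)" by (simp add: complex_eq_iff)
        then have "h z - h (- cnj z) = \<phi> (D (Re z) (Im z + \<beta>0) x)"
          using eq[of "Re z" "Im z"] by simp
        also have "cmod \<dots> \<le> norm (D (Re z) (Im z + \<beta>0) x)" by (rule unit_functional_le[OF \<phi>])
        also have "\<dots> \<le> C"
          using z r abs_Re_le_cmod[of z] abs_Im_le_cmod[of z] by (intro C) auto
        finally show ?thesis .
      qed
      show "((\<lambda>\<alpha>. h (Complex \<alpha> \<beta>) - h (Complex (- \<alpha>) \<beta>)) \<longlongrightarrow> 0) (at_right 0)" if "\<bar>\<beta>\<bar> < r" for \<beta>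
        unfolding eq using that r by (intro W[OF \<phi>]) auto
    qed (use r in blast)+
    then obtain g where g: "g holomorphic_on ball 0 (r / 16)" "\<And>w. w \<in> ball 0 (r / 16) \<Longrightarrow> Re w \<noteq> 0 \<Longrightarrow> g w = h w"
      by blast
    have gb: "cmod (g w) \<le> B" if "cmod w \<le> 2 * \<rho>" for w
      unfolding B_def
    proof (rule bound_from_distance_to_axis[OF open_ball _ g(1), of 0])
      show "cball 0 (r / 32) \<subseteq> ball (0::complex) (r / 16)" using r by auto
      show "cmod (g w) \<le> 18 * M * norm x / \<bar>Re w\<bar> ^ 3" if w: "w \<in> cball 0 (r / 32)" "Re w \<noteq> 0" for w
      proof -
        have "Re (w + z0) = Re w" by (simp add: z0_def)
        moreover have "\<bar>Re w\<bar> \<le> 1" using w r abs_Re_le_cmod[of w] by simp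
        ultimately show ?thesis
          using R_cubic_bound[of "w + z0" \<phi> x] w g(2)[of w] r \<phi> by (simp add: h_def)
      qed
    qed (use r that M_nonneg in \<open>auto simp: \<rho>_def\<close>)
    show ?thesis
    proof (intro exI[of _ "\<lambda>z. g (z - z0)"] conjI ballI impI)
      have "(\<lambda>z. z - z0) ` ball z0 (r / 16) \<subseteq> ball 0 (r / 16)" by (auto simp: dist_norm norm_minus_commute)
      moreover have "(\<lambda>z. z - z0) holomorphic_on ball z0 (r / 16)" by (intro holomorphic_intros)
      ultimately show "(\<lambda>z. g (z - z0)) holomorphic_on ball z0 (r / 16)"
        using holomorphic_on_compose_gen[OF _ g(1)] by (auto simp: o_def)
      show "g (z - z0) = \<phi> (R z x)" if "z \<in> ball z0 (r / 16)" "Re z \<noteq> 0" for z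
        using g(2)[of "z - z0"] that by (simp add: h_def dist_norm norm_minus_commute z0_def)
      show "cmod (g (z - z0)) \<le> B" if "z \<in> cball z0 (2 * \<rho>)" for z
        using that by (intro gb) (simp add: dist_norm norm_minus_commute)
    qed
  qed
  then obtain g where g: "\<And>\<phi>. unit_functional \<phi> \<Longrightarrow> g \<phi> holomorphic_on ball z0 (r / 16)"
    "\<And>\<phi> z. unit_functional \<phi> \<Longrightarrow> z \<in> ball z0 (r / 16) \<Longrightarrow> Re z \<noteq> 0 \<Longrightarrow> g \<phi> z = \<phi> (R z x)"
    "\<And>\<phi> z. unit_functional \<phi> \<Longrightarrow> z \<in> cball z0 (2 * \<rho>) \<Longrightarrow> cmod (g \<phi> z) \<le> B"
    by metis
  have sub: "ball z0 \<rho> \<subseteq> ball z0 (r / 16)" using r by (auto simp: \<rho>_def)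
  have lip: "cmod (g \<phi> z - g \<phi> w) \<le> L * cmod (z - w)"
    if \<phi>: "unit_functional \<phi>" and z: "z \<in> ball z0 \<rho>" and w: "w \<in> ball z0 \<rho>" for \<phi> z w
  proof (rule field_differentiable_bound[where S = "ball z0 \<rho>" and f' = "deriv (g \<phi>)"])
    fix v assume v: "v \<in> ball z0 \<rho>"
    show "(g \<phi> has_field_derivative deriv (g \<phi>) v) (at v within ball z0 \<rho>)"
      using holomorphic_derivI[OF g(1)[OF \<phi>] open_ball] v sub has_field_derivative_at_within by blast
    have cb: "cball v \<rho> \<subseteq> cball z0 (2 * \<rho>)"
    proof
      fix u assume "u \<in> cball v \<rho>"
      then show "u \<in> cball z0 (2 * \<rho>)" using v dist_triangle[of z0 u v] by simp
    qed
    moreover have "cball z0 (2 * \<rho>) \<subseteq> ball z0 (r / 16)" using r by (auto simp: \<rho>_def)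
    ultimately have hol: "g \<phi> holomorphic_on cball v \<rho>"
      using g(1)[OF \<phi>] holomorphic_on_subset by blast
    have "cmod ((deriv ^^ 1) (g \<phi>) v) \<le> fact 1 * B / \<rho> ^ 1"
    proof (rule Cauchy_inequality)
      show "g \<phi> holomorphic_on ball v \<rho>" using hol ball_subset_cball holomorphic_on_subset by blast
      show "continuous_on (cball v \<rho>) (g \<phi>)" by (rule holomorphic_on_imp_continuous_on[OF hol])
      show "cmod (g \<phi> u) \<le> B" if "cmod (v - u) = \<rho>" for u
        using that cb by (intro g(3)[OF \<phi>]) (auto simp: dist_norm)
    qed (rule \<rho>)
    then show "cmod (deriv (g \<phi>) v) \<le> L" by (simp add: L_def)
  qed (use z w in auto)
  define V where "V = ball z0 \<rho> \<inter> {z. Re z \<noteq> 0}"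
  have L0: "0 \<le> L" using B0 \<rho> by (simp add: L_def)
  have R_lip: "norm (R z x - R w x) \<le> L * cmod (z - w)" if zw: "z \<in> V" "w \<in> V" for z w
  proof (rule norm_le_if_functionals_le)
    fix \<phi> :: "'a \<Rightarrow> complex" assume \<phi>: "unit_functional \<phi>"
    have "v \<in> ball z0 (r / 16)" "Re v \<noteq> 0" if "v \<in> V" for v
      using that sub unfolding V_def by blast+
    then have "\<phi> (R z x - R w x) = g \<phi> z - g \<phi> w"
      using zw by (simp add: g(2)[OF \<phi>] bounded_clinear_diff[OF unit_functional_linear[OF \<phi>]])
    then show "Re (\<phi> (R z x - R w x)) \<le> L * cmod (z - w)"
      using lip[OF \<phi>, of z w] zw complex_Re_le_cmod[of "g \<phi> z - g \<phi> w"] by (simp add: V_def)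
  qed
  have "uniformly_continuous_on V (\<lambda>z. R z x)"
  proof (rule lipschitz_on_uniformly_continuous)
    show "L-lipschitz_on V (\<lambda>z. R z x)"
      by (rule lipschitz_onI) (use R_lip L0 in \<open>auto simp: dist_norm\<close>)
  qed
  then obtain G where G: "uniformly_continuous_on (closure V) G" "\<And>z. z \<in> V \<Longrightarrow> R z x = G z"
    using uniformly_continuous_on_extension_on_closure by metis
  have approx: "\<exists>s. s \<longlonglongrightarrow> z \<and> (\<forall>n. s n \<in> V)" if z: "z \<in> ball z0 \<rho>" for z
  proof (cases "Re z = 0")
    case False
    then show ?thesis using z by (intro exI[of _ "\<lambda>n. z"]) (auto simp: V_def)
  next
    case True
    define t where "t = (\<rho> - cmod (z - z0)) / 2"
    have t: "0 < t" using z by (simp add: t_def dist_norm norm_minus_commute)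
    show ?thesis
    proof (intro exI conjI allI)
      have "(\<lambda>n. z + of_real (t * inverse (real (Suc n)))) \<longlonglongrightarrow> z + of_real (t * 0)"
        by (intro tendsto_intros LIMSEQ_inverse_real_of_nat)
      then show "(\<lambda>n. z + of_real (t * inverse (real (Suc n)))) \<longlonglongrightarrow> z" by simp
      fix n
      define q where "q = t * inverse (real (Suc n))"
      have "t * inverse (real (Suc n)) \<le> t * 1"
        using t by (intro mult_left_mono) (auto simp: field_simps)
      then have q: "0 < q" "q \<le> t" using t by (auto simp: q_def)
      have "cmod (z + of_real q - z0) \<le> cmod (z - z0) + q"
        using norm_triangle_ineq[of "z - z0" "of_real q"] q by (simp add: algebra_simps)
      also have "\<dots> < \<rho>" using t q by (simp add: t_def field_simps)
      finally show "z + of_real (t * inverse (real (Suc n))) \<in> V"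
        using q True unfolding q_def[symmetric] by (simp add: V_def dist_norm norm_minus_commute)
    qed
  qed
  have V_dense: "ball z0 \<rho> \<subseteq> closure V"
    using approx closure_sequential by blast
  have G_lim: "(\<lambda>n. G (s n)) \<longlonglongrightarrow> G z" if "z \<in> ball z0 \<rho>" "s \<longlonglongrightarrow> z" "\<forall>n. s n \<in> V" for s z
  proof (rule continuous_on_tendsto_compose[OF uniformly_continuous_imp_continuous[OF G(1)] that(2)])
    show "z \<in> closure V" using that(1) V_dense by blast
    show "\<forall>\<^sub>F n in sequentially. s n \<in> closure V"
      using that(3) closure_subset by (intro always_eventually) blast
  qed
  have \<phi>G: "\<phi> (G z) = g \<phi> z" if \<phi>: "unit_functional \<phi>" and z: "z \<in> ball z0 \<rho>" for \<phi> z
  proof -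
    obtain s where s: "s \<longlonglongrightarrow> z" "\<And>n. s n \<in> V" using approx[OF z] by blast
    have "(\<lambda>n. \<phi> (G (s n))) \<longlonglongrightarrow> \<phi> (G z)"
      using G_lim[OF z s(1)] s(2)
      by (intro bounded_linear.tendsto[OF bounded_clinear_linear[OF unit_functional_linear[OF \<phi>]]]) auto
    moreover have "(\<lambda>n. g \<phi> (s n)) \<longlonglongrightarrow> g \<phi> z"
    proof (rule isCont_tendsto_compose[OF _ s(1)])
      show "isCont (g \<phi>) z"
        using g(1)[OF \<phi>] z sub
        by (meson field_differentiable_imp_continuous_at holomorphic_on_imp_differentiable_at open_ball subsetD)
    qed
    moreover have "\<phi> (G (s n)) = g \<phi> (s n)" for n
      using G(2)[OF s(2), of n] g(2)[OF \<phi>, of "s n"] s(2)[of n] sub by (auto simp: V_def)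
    ultimately show ?thesis using LIMSEQ_unique by force
  qed
  show ?thesis
  proof (rule not_in_specI[where U = "ball z0 \<rho>" and g = G])
    show "Complex 0 \<beta>0 \<in> ball z0 \<rho>" using \<rho> by (simp add: z0_def)
    show "vholomorphic_on G (ball z0 \<rho>)"
    proof (rule vholomorphic_if_weakly_holomorphic)
      show "(\<lambda>z. \<phi> (G z)) holomorphic_on ball z0 \<rho>" if "unit_functional \<phi>" for \<phi>
        by (rule holomorphic_transform[OF holomorphic_on_subset[OF g(1)[OF that] sub]]) (simp add: \<phi>G that)
      show "norm (G z) \<le> B" if z: "z \<in> ball z0 \<rho>" for z
      proof (rule norm_le_if_functionals_le)
        fix \<phi> :: "'a \<Rightarrow> complex" assume \<phi>: "unit_functional \<phi>"
        show "Re (\<phi> (G z)) \<le> B"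
          using \<phi>G[OF \<phi> z] g(3)[OF \<phi>, of z] z \<rho> complex_Re_le_cmod[of "g \<phi> z"] by simp
      qed
    qed simp
    fix \<nu> assume \<nu>: "\<nu> \<in> ball z0 \<rho>" and res: "\<nu> \<in> resolvent_set (generator T)"
    obtain s where s: "s \<longlonglongrightarrow> \<nu>" "\<And>n. s n \<in> V" using approx[OF \<nu>] by blast
    have lim: "(\<lambda>n. G (s n)) \<longlonglongrightarrow> G \<nu>" using G_lim[OF \<nu> s(1)] s(2) by auto
    have eq: "R 1 x + (1 - s n) *\<^sub>C R 1 (G (s n)) = G (s n)" for n
    proof -
      have "Re (s n) \<noteq> 0" using s(2)[of n] by (simp add: V_def)
      then have "R (s n) x = R 1 x + (1 - s n) *\<^sub>C R 1 (R (s n) x)"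
        using resolvent_identity[of "s n" 1 x] R_commute[of "s n" 1 x] by simp
      then show ?thesis using G(2)[OF s(2), of n] by simp
    qed
    have "(\<lambda>n. R 1 x + (1 - s n) *\<^sub>C R 1 (G (s n))) \<longlonglongrightarrow> R 1 x + (1 - \<nu>) *\<^sub>C R 1 (G \<nu>)"
      by (intro tendsto_add tendsto_const tendsto_scaleC tendsto_diff s(1)
          bounded_linear.tendsto[OF bounded_clinear_linear[OF R_clinear] lim]) simp
    then have "G \<nu> = R 1 x + (1 - \<nu>) *\<^sub>C R 1 (G \<nu>)"
      unfolding eq using lim LIMSEQ_unique by blast
    then have *: "G \<nu> = R 1 (x + (1 - \<nu>) *\<^sub>C G \<nu>)" by (simp add: R_add R_scale)
    then have "gen (G \<nu>) (1 *\<^sub>C G \<nu> - (x + (1 - \<nu>) *\<^sub>C G \<nu>))"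
      using gen_R[of 1 "x + (1 - \<nu>) *\<^sub>C G \<nu>"] unfolding *[symmetric] by simp
    then have "gen (G \<nu>) (\<nu> *\<^sub>C G \<nu> - x)"
      by (simp add: scaleC_diff_left algebra_simps)
    then show "G \<nu> = R \<nu> x"
      using resolvent_eqI[of \<nu> "G \<nu>" x] res by (simp add: resolvent_set_def)
  qed simp
qed

end

context polynomially_bounded_group
begin

lemma jump_continuous_in_height:
  assumes "\<alpha> \<noteq> 0"
  shows "continuous_on UNIV (\<lambda>\<beta>. D \<alpha> \<beta> x)"
proof -
  have "isCont (\<lambda>\<beta>. R (Complex t \<beta>) x) \<beta>" if "t \<noteq> 0" for t \<beta>
  proof -
    have 1: "isCont (\<lambda>\<beta>. Complex t \<beta>) \<beta>" unfolding Complex_eq by (intro continuous_intros)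
    have 2: "isCont (\<lambda>\<nu>. R \<nu> x) (Complex t \<beta>)" using that by (intro R_continuous) simp
    show ?thesis by (rule isCont_o2[OF 1 2])
  qed
  then have "isCont (\<lambda>\<beta>. D \<alpha> \<beta> x) \<beta>" for \<beta>
    unfolding resolvent_jump_def using assms by (intro continuous_diff) auto
  then show ?thesis by (intro continuous_at_imp_continuous_on) auto
qed

section \<open>Boundedness over a segment\<close>

text \<open>
  If no \<open>E n\<close> contained a portion of \<open>S\<close>, the sets \<open>S - E n\<close> would be relatively open and dense in \<open>S\<close>, and
  by Baire's theorem their intersection, which is empty, would be dense too.
\<close>

lemma Baire_point:
  fixes S :: "real set"
  assumes S: "closed S" "S \<noteq> {}" and E: "\<And>n::nat. closed (E n)" "S \<subseteq> (\<Union>n. E n)"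
  obtains n s \<delta> where "s \<in> S" "0 < \<delta>" "S \<inter> ball s \<delta> \<subseteq> E n"
proof -
  have "\<exists>n. \<not> S \<subseteq> closure (S - E n)"
  proof (rule ccontr)
    assume "\<not> ?thesis"
    then have dense: "S \<subseteq> closure (S - E n)" for n by blast
    have "S \<subseteq> closure (\<Inter>(range (\<lambda>n. S - E n)))"
    proof (rule Baire[OF S(1)])
      fix U assume "U \<in> range (\<lambda>n. S - E n)"
      then obtain n where U: "U = S - E n" by blast
      have "openin (top_of_set S) (S \<inter> - E n)"
        using E(1)[of n] by (intro openin_open_Int) auto
      then show "openin (top_of_set S) U \<and> S \<subseteq> closure U"
        using dense[of n] by (simp add: U Diff_eq)
    qed simp
    moreover have "\<Inter>(range (\<lambda>n. S - E n)) = {}" using E(2) by blast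
    ultimately have "S \<subseteq> closure {}" by (simp only:)
    then show False using S(2) by simp
  qed
  then obtain n s where ns: "s \<in> S" "s \<notin> closure (S - E n)" by blast
  then obtain \<delta> where \<delta>: "0 < \<delta>" "\<forall>y\<in>S - E n. \<not> dist y s < \<delta>"
    unfolding closure_approachable by blast
  have "S \<inter> ball s \<delta> \<subseteq> E n"
  proof
    fix y assume y: "y \<in> S \<inter> ball s \<delta>"
    then have "dist y s < \<delta>" by (simp add: dist_commute)
    then show "y \<in> E n" using \<delta>(2) y by blast
  qed
  then show ?thesis using that ns(1) \<delta>(1) by blast
qed

text \<open>
  The end points \<open>c\<close> and \<open>d\<close> are treated like spectral points, so that every other point of the segment lies in a gap
  whose two ends both carry the bound \<open>C\<close>.
\<close>

lemma jump_bounded_between: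
  assumes cd: "c < d" and C: "0 \<le> C"
    and bnd: "\<And>\<beta> \<alpha>. c \<le> \<beta> \<Longrightarrow> \<beta> \<le> d \<Longrightarrow> Complex 0 \<beta> \<in> spec x \<or> \<beta> = c \<or> \<beta> = d \<Longrightarrow> 0 < \<alpha> \<Longrightarrow> \<alpha> \<le> 1 \<Longrightarrow>
        norm (D \<alpha> \<beta> x) \<le> C"
    and top: "\<And>\<beta>. norm (D 1 \<beta> x) \<le> C"
    and S: "\<And>\<beta>. c \<le> \<beta> \<Longrightarrow> \<beta> \<le> d \<Longrightarrow> ((\<lambda>\<alpha>. \<alpha> powr (2 - a) * norm (D \<alpha> \<beta> x)) \<longlongrightarrow> 0) (at_right 0)"
    and \<alpha>: "0 < \<alpha>" "\<alpha> \<le> 1" and \<beta>: "c \<le> \<beta>" "\<beta> \<le> d"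
  shows "norm (D \<alpha> \<beta> x) \<le> C"
proof -
  define P where "P = {\<beta>. c \<le> \<beta> \<and> \<beta> \<le> d \<and> (Complex 0 \<beta> \<in> spec x \<or> \<beta> = c \<or> \<beta> = d)}"
  have P_bnd: "norm (D \<alpha> \<beta> x) \<le> C" if "\<beta> \<in> P" "0 < \<alpha>" "\<alpha> \<le> 1" for \<alpha> \<beta>
    using that by (intro bnd) (auto simp: P_def)
  show ?thesis
  proof (cases "\<beta> \<in> P \<or> \<alpha> = 1")
    case True
    then show ?thesis using P_bnd \<alpha> top by blast
  next
    case False
    have "closed ((\<lambda>\<beta>. Complex 0 \<beta>) -` spec x)"
    proof (rule continuous_closed_vimage[OF closed_spec])
      show "isCont (Complex 0) t" for t unfolding Complex_eq by (intro continuous_intros)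
    qed
    then have "closed ({c..d} \<inter> ((\<lambda>\<beta>. Complex 0 \<beta>) -` spec x) \<union> {c, d})"
      by (intro closed_Un closed_Int) auto
    moreover have "P = {c..d} \<inter> ((\<lambda>\<beta>. Complex 0 \<beta>) -` spec x) \<union> {c, d}"
      using cd by (auto simp: P_def)
    ultimately have closedP: "closed P" by simp
    define lo hi where "lo = Sup (P \<inter> {..\<beta>})" and "hi = Inf (P \<inter> {\<beta>..})"
    have cP: "c \<in> P" "d \<in> P" using cd by (auto simp: P_def)
    have bdd: "bdd_above (P \<inter> {..\<beta>})" "bdd_below (P \<inter> {\<beta>..})" by auto
    have lo: "lo \<in> P \<inter> {..\<beta>}"
      unfolding lo_def using cP \<beta> closedP bdd by (intro closed_contains_Sup) auto
    have hi: "hi \<in> P \<inter> {\<beta>..}"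
      unfolding hi_def using cP \<beta> closedP bdd by (intro closed_contains_Inf) auto
    have lh: "lo < \<beta>" "\<beta> < hi" using lo hi False by (auto simp: order.order_iff_strict)
    have gap: "Complex 0 t \<notin> spec x" if t: "lo < t" "t < hi" for t
    proof
      assume "Complex 0 t \<in> spec x"
      then have "t \<in> P" using t lo hi by (auto simp: P_def)
      show False
      proof (cases "t \<le> \<beta>")
        case True
        then have "t \<le> lo" unfolding lo_def using \<open>t \<in> P\<close> bdd by (intro cSup_upper) auto
        then show False using t by simp
      next
        case False
        then have "hi \<le> t" unfolding hi_def using \<open>t \<in> P\<close> bdd by (intro cInf_lower) auto
        then show False using t by simp
      qed
    qed
    show ?thesis
    proof (rule jump_bound_in_gap[of lo hi])
      show "((\<lambda>\<alpha>. \<alpha> powr (2 - a) * norm (D \<alpha> lo x)) \<longlongrightarrow> 0) (at_right 0)"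
        "((\<lambda>\<alpha>. \<alpha> powr (2 - a) * norm (D \<alpha> hi x)) \<longlongrightarrow> 0) (at_right 0)"
        using lo hi by (auto intro!: S simp: P_def)
      show "norm (D t lo x) \<le> C" "norm (D t hi x) \<le> C" if "0 < t" "t \<le> 1" for t
        using P_bnd lo hi that by auto
    qed (use lh C gap top \<alpha> False in auto)
  qed
qed

text \<open>
  The common core of both parts of the theorem. Baire's theorem is applied to the closure of the
  spectral points in an open interval, not to the spectral points in a closed one: a relatively open
  portion of this closure contains a spectral point that is interior to the interval.
\<close>

theorem regular_if_jump_tame:
  assumes F: "closed F" and \<beta>: "\<beta> \<notin> F"
    and B: "\<And>\<beta>. \<beta> \<notin> F \<Longrightarrow> \<exists>C. \<forall>\<alpha>. 0 < \<alpha> \<longrightarrow> \<alpha> \<le> 1 \<longrightarrow> norm (D \<alpha> \<beta> x) \<le> C"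
    and S: "\<And>\<beta>. \<beta> \<notin> F \<Longrightarrow> ((\<lambda>\<alpha>. \<alpha> powr (2 - a) * norm (D \<alpha> \<beta> x)) \<longlongrightarrow> 0) (at_right 0)"
    and W: "\<And>\<beta> \<phi>. \<beta> \<notin> F \<Longrightarrow> unit_functional \<phi> \<Longrightarrow> ((\<lambda>\<alpha>. \<phi> (D \<alpha> \<beta> x)) \<longlongrightarrow> 0) (at_right 0)"
  shows "Complex 0 \<beta> \<notin> spec x"
proof
  assume bad: "Complex 0 \<beta> \<in> spec x"
  have "open (- F)" using F by auto
  then obtain r where r: "0 < r" "cball \<beta> r \<subseteq> - F"
    using \<beta> by (meson ComplI open_contains_cball)
  define I where "I = ball \<beta> r"
  define K where "K = (\<lambda>\<beta>. Complex 0 \<beta>) -` spec x"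
  have closedK: "closed K"
    unfolding K_def
  proof (rule continuous_closed_vimage[OF closed_spec])
    show "isCont (Complex 0) t" for t unfolding Complex_eq by (intro continuous_intros)
  qed
  \<comment> \<open>Every point of this closure lies in \<open>K\<close> and outside \<open>F\<close>, so that \<open>B\<close> applies to it.\<close>
  define S' where "S' = closure (K \<inter> I)"
  have "S' \<subseteq> closure K" unfolding S'_def by (rule closure_mono) blast
  moreover have "S' \<subseteq> closure I" unfolding S'_def by (rule closure_mono) blast
  moreover have "closure I = cball \<beta> r" using r(1) by (simp add: I_def)
  ultimately have S'_sub: "S' \<subseteq> K" "S' \<subseteq> - F" using closedK r(2) by (simp, blast)
  define E where "E n = {t. \<forall>\<alpha>. 0 < \<alpha> \<longrightarrow> \<alpha> \<le> 1 \<longrightarrow> norm (D \<alpha> t x) \<le> real n}" for n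
  have E_closed: "closed (E n)" for n
  proof -
    have "E n = (\<Inter>\<alpha>\<in>{0<..1}. {t. norm (D \<alpha> t x) \<le> real n})" by (auto simp: E_def)
    moreover have "closed {t. norm (D \<alpha> t x) \<le> real n}" if "\<alpha> \<in> {0<..1}" for \<alpha>
      using that by (intro closed_Collect_le continuous_intros jump_continuous_in_height) auto
    ultimately show ?thesis by auto
  qed
  have E_cover: "S' \<subseteq> (\<Union>n. E n)"
  proof
    fix t assume "t \<in> S'"
    then obtain C where C: "\<forall>\<alpha>. 0 < \<alpha> \<longrightarrow> \<alpha> \<le> 1 \<longrightarrow> norm (D \<alpha> t x) \<le> C" using B[of t] S'_sub by auto
    obtain n where "C \<le> real n" using real_arch_simple by blast
    then have "t \<in> E n" using C by (auto simp: E_def intro: order_trans)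
    then show "t \<in> (\<Union>n. E n)" by blast
  qed
  have "\<beta> \<in> K \<inter> I" using bad r by (simp add: K_def I_def)
  then have "S' \<noteq> {}" using closure_subset[of "K \<inter> I"] by (auto simp: S'_def)
  then obtain n s \<delta>1 where s: "s \<in> S'" "0 < \<delta>1" "S' \<inter> ball s \<delta>1 \<subseteq> E n"
    using Baire_point[of S' E] E_closed E_cover by (metis S'_def closed_closure)
  obtain t where t: "t \<in> K \<inter> I" "dist t s < \<delta>1"
    using s(1,2) unfolding S'_def closure_approachable by blast
  have "open (ball s \<delta>1 \<inter> I)" by (auto simp: I_def)
  moreover have "t \<in> ball s \<delta>1 \<inter> I" using t by (simp add: dist_commute)
  ultimately obtain \<delta> where \<delta>: "0 < \<delta>" "cball t \<delta> \<subseteq> ball s \<delta>1 \<inter> I"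
    using open_contains_cball by blast
  have notF: "u \<notin> F" if "u \<in> cball t \<delta>" for u
    using that \<delta>(2) r(2) ball_subset_cball[of \<beta> r] unfolding I_def by blast
  define c d where "c = t - \<delta>" and "d = t + \<delta>"
  have in_cball: "u \<in> cball t \<delta>" if "c \<le> u" "u \<le> d" for u
    using that by (auto simp: c_def d_def dist_real_def)
  have cd: "c \<le> d" "c \<notin> F" "d \<notin> F" using \<delta>(1) notF in_cball by (auto simp: c_def d_def)
  obtain Cc where Cc: "\<forall>\<alpha>. 0 < \<alpha> \<longrightarrow> \<alpha> \<le> 1 \<longrightarrow> norm (D \<alpha> c x) \<le> Cc" using B[OF cd(2)] by blast
  obtain Cd where Cd: "\<forall>\<alpha>. 0 < \<alpha> \<longrightarrow> \<alpha> \<le> 1 \<longrightarrow> norm (D \<alpha> d x) \<le> Cd" using B[OF cd(3)] by blast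
  define C where "C = Max {real n, Cc, Cd, 2 * res_bound 1 * norm x}"
  have C: "real n \<le> C" "Cc \<le> C" "Cd \<le> C" "2 * res_bound 1 * norm x \<le> C" by (auto simp: C_def)
  have "Complex 0 t \<notin> spec x"
  proof (rule regular_if_jump_bounded[OF \<delta>(1), of t x C])
    fix \<alpha> u :: real assume \<alpha>: "0 < \<alpha>" "\<alpha> \<le> 1" and u: "\<bar>u - t\<bar> < \<delta>"
    show "norm (D \<alpha> u x) \<le> C"
    proof (rule jump_bounded_between[of c d])
      fix v \<gamma> :: real
      assume v: "c \<le> v" "v \<le> d" "Complex 0 v \<in> spec x \<or> v = c \<or> v = d" and \<gamma>: "0 < \<gamma>" "\<gamma> \<le> 1"
      consider "v = c" | "v = d" | "Complex 0 v \<in> spec x" using v by blast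
      then show "norm (D \<gamma> v x) \<le> C"
      proof cases
        case 3
        have "v \<in> ball s \<delta>1 \<inter> I" using in_cball v \<delta>(2) by blast
        moreover from this 3 have "v \<in> S'" using closure_subset[of "K \<inter> I"] by (auto simp: S'_def K_def)
        ultimately have "v \<in> E n" using s(3) by blast
        then show ?thesis using \<gamma> C(1) by (auto simp: E_def intro: order_trans)
      qed (use Cc Cd C \<gamma> in \<open>auto intro: order_trans\<close>)
    next
      show "norm (D 1 v x) \<le> C" for v using jump_bound[of 1 v x] C(4) by simp
      show "((\<lambda>\<alpha>. \<alpha> powr (2 - a) * norm (D \<alpha> v x)) \<longlongrightarrow> 0) (at_right 0)" if "c \<le> v" "v \<le> d" for v
        using notF[OF in_cball[OF that]] by (rule S)
      show "0 \<le> C" using C(1) by (rule order_trans[rotated]) simp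
    qed (use \<alpha> u \<delta>(1) in \<open>auto simp: c_def d_def\<close>)
  next
    fix \<phi> :: "'a \<Rightarrow> complex" and u assume "unit_functional \<phi>" "\<bar>u - t\<bar> < \<delta>"
    moreover from this have "u \<notin> F" by (intro notF) (simp add: dist_real_def abs_minus_commute)
    ultimately show "((\<lambda>\<alpha>. \<phi> (D \<alpha> u x)) \<longlongrightarrow> 0) (at_right 0)" by (intro W)
  qed
  then show False using t(1) by (simp add: K_def)
qed

lemma jump_bounded_if_tendsto:
  assumes lim: "((\<lambda>\<alpha>. D \<alpha> \<beta> x) \<longlongrightarrow> 0) (at_right 0)"
  shows "\<exists>C. \<forall>\<alpha>. 0 < \<alpha> \<longrightarrow> norm (D \<alpha> \<beta> x) \<le> C"
proof -
  have "\<forall>\<^sub>F \<alpha> in at_right 0. norm (D \<alpha> \<beta> x) < 1"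
    by (intro order_tendstoD(2)[OF tendsto_norm_zero[OF lim]]) simp
  then obtain \<eta> where \<eta>: "0 < \<eta>" "\<And>\<alpha>. 0 < \<alpha> \<Longrightarrow> \<alpha> < \<eta> \<Longrightarrow> norm (D \<alpha> \<beta> x) < 1"
    unfolding eventually_at_right_field by auto
  have "norm (D \<alpha> \<beta> x) \<le> max 1 (2 * res_bound \<eta> * norm x)" if \<alpha>: "0 < \<alpha>" for \<alpha>
  proof (cases "\<alpha> < \<eta>")
    case False
    have "norm (D \<alpha> \<beta> x) \<le> 2 * res_bound \<alpha> * norm x" by (rule jump_bound[OF \<alpha>])
    also have "\<dots> \<le> 2 * res_bound \<eta> * norm x"
      using False \<eta> by (intro mult_right_mono mult_left_mono res_bound_antimono) auto
    finally show ?thesis by simp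
  qed (use \<eta>(2)[OF \<alpha>] in simp)
  then show ?thesis by blast
qed

lemma scaled_jump_tendsto_if_tendsto:
  assumes lim: "((\<lambda>\<alpha>. D \<alpha> \<beta> x) \<longlongrightarrow> 0) (at_right 0)"
  shows "((\<lambda>\<alpha>. \<alpha> powr (2 - a) * norm (D \<alpha> \<beta> x)) \<longlongrightarrow> 0) (at_right 0)"
proof (rule Lim_null_comparison[OF _ tendsto_norm_zero[OF lim]])
  have "\<forall>\<^sub>F \<alpha> in at_right 0. \<alpha> \<in> {0<..<1::real}" by (rule eventually_at_right_real) simp
  then show "\<forall>\<^sub>F \<alpha> in at_right 0. norm (\<alpha> powr (2 - a) * norm (D \<alpha> \<beta> x)) \<le> norm (D \<alpha> \<beta> x)"
  proof eventually_elim
    case (elim \<alpha>)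
    then have "\<alpha> powr (2 - a) \<le> 1" using a_le_2 by (intro powr_le1) auto
    then show ?case by (simp add: abs_mult mult_left_le_one_le)
  qed
qed

lemma scaled_jump_tendsto_if_bounded:
  assumes a: "a < 2" and C: "\<And>\<alpha>. 0 < \<alpha> \<Longrightarrow> norm (D \<alpha> \<beta> x) \<le> C"
  shows "((\<lambda>\<alpha>. \<alpha> powr (2 - a) * norm (D \<alpha> \<beta> x)) \<longlongrightarrow> 0) (at_right 0)"
proof (rule Lim_null_comparison)
  show "\<forall>\<^sub>F \<alpha> in at_right 0. norm (\<alpha> powr (2 - a) * norm (D \<alpha> \<beta> x)) \<le> \<alpha> powr (2 - a) * C"
    using C by (auto simp: eventually_at_filter abs_mult intro!: mult_left_mono)
  have "((\<lambda>\<alpha>. \<alpha> powr (2 - a) * C) \<longlongrightarrow> 0 * C) (at_right 0)"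
    using a by (intro tendsto_mult tendsto_const tendsto_zero_powrI[where b = "2 - a"])
      (auto intro!: tendsto_eq_intros simp: eventually_at_filter)
  then show "((\<lambda>\<alpha>. \<alpha> powr (2 - a) * C) \<longlongrightarrow> 0) (at_right 0)" by simp
qed

end

section \<open>Weak limits of the jump\<close>

text \<open>
  Weak compactness of bounded sets in a reflexive space. Tychonoff's theorem gives a cluster point in the
  product of discs indexed by the functionals. It is passed to along a finer filter \<open>G\<close>, where all limits exist at
  once, so that linearity of the limit comes from uniqueness of limits; reflexivity turns it into evaluation
  at a point.
\<close>

lemma bounded_functional_cluster:
  fixes v :: "'i \<Rightarrow> 'a::complex_banach"
  assumes refl: "reflexive_space TYPE('a)" and F: "F \<noteq> bot"
    and C: "\<forall>\<^sub>F i in F. norm (v i) \<le> C"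
  obtains G z where "G \<noteq> bot" "G \<le> F"
    "\<And>f :: 'a \<Rightarrow> complex. bounded_clinear f \<Longrightarrow> ((\<lambda>i. f (v i)) \<longlongrightarrow> f z) G"
proof -
  define Z where "Z i f = (if bounded_clinear f then f (v i) else 0)" for i and f :: "'a \<Rightarrow> complex"
  define X where "X = PiE UNIV (\<lambda>f :: 'a \<Rightarrow> complex. cball (0::complex) (if bounded_clinear f then onorm f * C else 0))"
  have "compactin (product_topology (\<lambda>_. euclidean) UNIV) X"
    unfolding X_def by (subst compactin_PiE) auto
  then have compact: "compact X" by (simp add: euclidean_product_topology)
  have le: "cmod (f (v i)) \<le> onorm f * C" if "bounded_clinear f" "norm (v i) \<le> C" for f :: "'a \<Rightarrow> complex" and i
  proof -
    have "cmod (f (v i)) \<le> onorm f * norm (v i)" by (rule onorm[OF bounded_clinear_linear[OF that(1)]])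
    also have "\<dots> \<le> onorm f * C"
      using that by (intro mult_left_mono onorm_pos_le bounded_clinear_linear)
    finally show ?thesis .
  qed
  have "\<forall>\<^sub>F i in F. Z i \<in> X"
    using C by eventually_elim (auto simp: X_def Z_def le)
  then have "\<forall>\<^sub>F w in filtermap Z F. w \<in> X" by (simp add: eventually_filtermap)
  moreover have "filtermap Z F \<noteq> bot" using F by (simp add: filtermap_bot_iff)
  ultimately obtain \<Psi> where \<Psi>: "inf (nhds \<Psi>) (filtermap Z F) \<noteq> bot"
    using compact unfolding compact_filter by blast
  define G where "G = inf (filtercomap Z (nhds \<Psi>)) F"
  have G: "G \<noteq> bot"
  proof
    assume "G = bot"
    then have "eventually (\<lambda>_. False) G" by simp
    then obtain Q Q' where Q: "eventually Q (filtercomap Z (nhds \<Psi>))" "eventually Q' F" "\<And>i. Q i \<Longrightarrow> Q' i \<Longrightarrow> False"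
      unfolding G_def eventually_inf by blast
    obtain Q2 where Q2: "eventually Q2 (nhds \<Psi>)" "\<And>i. Q2 (Z i) \<Longrightarrow> Q i"
      using Q(1) unfolding eventually_filtercomap by blast
    have "eventually (\<lambda>w. \<not> Q2 w) (filtermap Z F)"
      unfolding eventually_filtermap using Q(2) by eventually_elim (use Q(3) Q2(2) in blast)
    then have "eventually (\<lambda>_. False) (inf (nhds \<Psi>) (filtermap Z F))"
      unfolding eventually_inf using Q2(1) by blast
    then show False using \<Psi> by (simp add: eventually_False)
  qed
  have GF: "G \<le> F" by (simp add: G_def)
  have limZ: "filterlim Z (nhds \<Psi>) G"
    unfolding G_def filterlim_def filtermap_le_iff_le_filtercomap by simp
  have lim: "((\<lambda>i. f (v i)) \<longlongrightarrow> \<Psi> f) G" if "bounded_clinear f" for f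
  proof -
    have "continuous_on UNIV (\<lambda>w :: ('a \<Rightarrow> complex) \<Rightarrow> complex. w f)"
      by (rule continuous_on_product_coordinates)
    then have "((\<lambda>i. Z i f) \<longlongrightarrow> \<Psi> f) G"
      by (rule continuous_on_tendsto_compose[OF _ limZ]) auto
    then show ?thesis using that by (simp add: Z_def)
  qed
  have CG: "\<forall>\<^sub>F i in G. norm (v i) \<le> C" using C GF by (rule filter_leD[rotated])
  have add: "bounded_clinear (\<lambda>x. f x + g x)" if "bounded_clinear f" "bounded_clinear g" for f g :: "'a \<Rightarrow> complex"
    using that by (simp add: bounded_clinear_def bounded_linear_add scaleC_add_right)
  have scale: "bounded_clinear (\<lambda>x. c * f x)" if "bounded_clinear f" for c and f :: "'a \<Rightarrow> complex"
    using that unfolding bounded_clinear_def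
    by (auto simp: scaleC_complex_def mult.left_commute intro: bounded_linear_const_mult)
  have "\<exists>z. \<forall>f. bounded_clinear f \<longrightarrow> \<Psi> f = f z"
  proof (rule refl[unfolded reflexive_space_def, rule_format])
    fix f g :: "'a \<Rightarrow> complex" assume fg: "bounded_clinear f" "bounded_clinear g"
    show "\<Psi> (\<lambda>x. f x + g x) = \<Psi> f + \<Psi> g"
      by (rule tendsto_unique[OF G lim[OF add[OF fg]] tendsto_add[OF lim[OF fg(1)] lim[OF fg(2)]]])
  next
    fix c and f :: "'a \<Rightarrow> complex" assume f: "bounded_clinear f"
    show "\<Psi> (\<lambda>x. c * f x) = c * \<Psi> f"
      by (rule tendsto_unique[OF G lim[OF scale[OF f]] tendsto_mult[OF tendsto_const lim[OF f]]])
  next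
    have "cmod (\<Psi> f) \<le> C * onorm f" if f: "bounded_clinear f" for f
    proof (rule tendsto_upperbound[OF tendsto_norm[OF lim[OF f]] _ G])
      show "\<forall>\<^sub>F i in G. cmod (f (v i)) \<le> C * onorm f"
        using CG by eventually_elim (use le[OF f] in \<open>simp add: mult.commute\<close>)
    qed
    then show "\<exists>K. \<forall>f. bounded_clinear f \<longrightarrow> cmod (\<Psi> f) \<le> K * onorm f" by blast
  qed
  then obtain z where z: "\<And>f. bounded_clinear f \<Longrightarrow> \<Psi> f = f z" by blast
  show ?thesis
  proof (rule that[OF G GF])
    show "((\<lambda>i. f (v i)) \<longlongrightarrow> f z) G" if f: "bounded_clinear f" for f :: "'a \<Rightarrow> complex"
      using lim[OF f] z[OF f] by simp
  qed
qed

context polynomially_bounded_group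
begin

text \<open>
  The equation \<open>(A - i\<beta>)\<^sup>2 D x = \<alpha>\<^sup>2 D x - 2\<alpha> x\<close> after multiplication by the square of \<open>S = R (1 + i\<beta>)\<close>. As
  \<open>(A - i\<beta>) S = S - 1\<close>, only bounded operators are left, and they can be applied to weak limits.
\<close>

lemma squared_generator_on_jump:
  fixes \<alpha> \<beta> :: real and x :: 'a
  assumes \<alpha>: "0 < \<alpha>"
  defines "S \<equiv> R (Complex 1 \<beta>)"
  defines "P \<equiv> \<lambda>v. S v - v"
  shows "P (P (D \<alpha> \<beta> x)) = S (S ((of_real \<alpha>)\<^sup>2 *\<^sub>C D \<alpha> \<beta> x - (2 * of_real \<alpha>) *\<^sub>C x))"
proof -
  define l m where "l = Complex \<alpha> \<beta>" and "m = Complex (- \<alpha>) \<beta>"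
  have Re: "Re l \<noteq> 0" "Re m \<noteq> 0" "Re (Complex 1 \<beta>) \<noteq> 0" using \<alpha> by (auto simp: l_def m_def)
  define A' where "A' = complex_of_real \<alpha>"
  note S_simps = R_add[OF Re(3), folded S_def] R_diff[OF Re(3), folded S_def] R_scale[OF Re(3), folded S_def]
  have Pl: "P (R l v) = S (A' *\<^sub>C R l v - v)" for v
  proof -
    have "l - Complex 1 \<beta> = A' - 1" by (simp add: l_def A'_def complex_eq_iff)
    then have "S v = R l v + (A' - 1) *\<^sub>C S (R l v)"
      using resolvent_identity[OF Re(3,1), of v] by (simp add: S_def)
    then show ?thesis by (simp add: P_def S_simps scaleC_diff_left algebra_simps)
  qed
  have Pm: "P (R m v) = S (- (A' *\<^sub>C R m v) - v)" for v
  proof -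
    have "m - Complex 1 \<beta> = - A' - 1" by (simp add: m_def A'_def complex_eq_iff)
    then have "S v = R m v + (- A' - 1) *\<^sub>C S (R m v)"
      using resolvent_identity[OF Re(3,2), of v] by (simp add: S_def)
    then show ?thesis
      using bounded_clinear_minus[OF R_clinear[OF Re(3)], folded S_def]
      by (simp add: P_def S_simps scaleC_diff_left scaleC_minus_left algebra_simps)
  qed
  have PS: "P (S v) = S (P v)" for v by (simp add: P_def S_simps)
  have P_diff: "P (v - w) = P v - P w" and P_scale: "P (c *\<^sub>C v) = c *\<^sub>C P v" for v w c
    by (simp_all add: P_def S_simps scaleC_diff_right)
  define p where "p = R l (R m x)"
  have "P (P p) = P (S (A' *\<^sub>C p - R m x))" by (simp add: p_def Pl)
  also have "\<dots> = S (A' *\<^sub>C P p - P (R m x))" by (simp add: PS P_diff P_scale)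
  also have "\<dots> = S (A' *\<^sub>C S (A' *\<^sub>C p - R m x) - S (- (A' *\<^sub>C R m x) - x))"
    by (simp add: p_def Pl Pm)
  also have "\<dots> = S (S (A'\<^sup>2 *\<^sub>C p + x))"
    by (simp flip: S_simps) (simp add: scaleC_diff_right scaleC_scaleC power2_eq_square)
  finally have PPp: "P (P p) = S (S (A'\<^sup>2 *\<^sub>C p + x))" .
  have D: "D \<alpha> \<beta> x = (- 2 * A') *\<^sub>C p"
    using \<alpha> by (simp add: jump_factored p_def l_def m_def A'_def)
  have "P (P (D \<alpha> \<beta> x)) = (- 2 * A') *\<^sub>C S (S (A'\<^sup>2 *\<^sub>C p + x))"
    by (simp only: D P_scale PPp)
  also have "\<dots> = S (S ((- 2 * A') *\<^sub>C (A'\<^sup>2 *\<^sub>C p + x)))"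
    by (simp only: S_simps)
  also have "(- 2 * A') *\<^sub>C (A'\<^sup>2 *\<^sub>C p + x) = A'\<^sup>2 *\<^sub>C D \<alpha> \<beta> x - (2 * A') *\<^sub>C x"
    by (simp add: D scaleC_add_right scaleC_scaleC scaleC_minus_left scaleC_minus_right mult.commute mult.left_commute)
  finally show ?thesis by (simp add: A'_def)
qed

text \<open>
  A fixed point of \<open>R (1 + i\<beta>)\<close> is an eigenvector of the generator for \<open>i\<beta>\<close>.
\<close>

lemma resolvent_fixed_point_eq_0:
  assumes ps: "point_spectrum (generator T) = {}" and v: "R (Complex 1 \<beta>) v = v"
  shows "v = 0"
proof (rule ccontr)
  assume "v \<noteq> 0"
  have "gen v (Complex 1 \<beta> *\<^sub>C v - v)" using gen_R[of "Complex 1 \<beta>" v] v by simp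
  moreover have "Complex 1 \<beta> *\<^sub>C v - v = (Complex 1 \<beta> - 1) *\<^sub>C v" by (simp only: scaleC_diff_left scaleC_one)
  ultimately have "generator T v = Some ((Complex 1 \<beta> - 1) *\<^sub>C v)" by (simp add: generator_eq_Some_iff)
  then show False using ps \<open>v \<noteq> 0\<close> by (auto simp: point_spectrum_def)
qed

text \<open>
  If the limit were not zero, some filter finer than \<open>at_right 0\<close> would keep \<open>|\<phi> (D x)|\<close> away from zero. A weak
  cluster point along it is annihilated by \<open>(S - 1)\<^sup>2\<close>, hence it is zero, a contradiction.
\<close>

lemma jump_weakly_tendsto_0:
  assumes refl: "reflexive_space TYPE('a)" and ps: "point_spectrum (generator T) = {}"
    and C: "\<And>\<alpha>. 0 < \<alpha> \<Longrightarrow> norm (D \<alpha> \<beta> x) \<le> C" and \<phi>: "unit_functional \<phi>"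
  shows "((\<lambda>\<alpha>. \<phi> (D \<alpha> \<beta> x)) \<longlongrightarrow> 0) (at_right 0)"
proof (rule ccontr)
  assume "\<not> ?thesis"
  then obtain e where e: "0 < e" "\<not> (\<forall>\<^sub>F \<alpha> in at_right 0. cmod (\<phi> (D \<alpha> \<beta> x)) < e)"
    unfolding tendsto_iff by auto
  define F where "F = inf (at_right 0) (principal {\<alpha>. e \<le> cmod (\<phi> (D \<alpha> \<beta> x))})"
  have F: "F \<noteq> bot"
  proof
    assume "F = bot"
    then have "eventually (\<lambda>_. False) F" by simp
    then show False using e(2) by (simp add: F_def eventually_inf_principal not_le)
  qed
  have "\<forall>\<^sub>F \<alpha> in at_right 0. norm (D \<alpha> \<beta> x) \<le> C" using C by (auto simp: eventually_at_filter)
  then have "\<forall>\<^sub>F \<alpha> in F. norm (D \<alpha> \<beta> x) \<le> C" unfolding F_def by (rule filter_leD[OF inf_le1])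
  from bounded_functional_cluster[OF refl F this] obtain G z where G: "G \<noteq> bot" "G \<le> F"
    and lim: "\<And>f :: 'a \<Rightarrow> complex. bounded_clinear f \<Longrightarrow> ((\<lambda>\<alpha>. f (D \<alpha> \<beta> x)) \<longlongrightarrow> f z) G" by blast
  have G0: "G \<le> at_right 0" using G(2) by (simp add: F_def)
  define S where "S = R (Complex 1 \<beta>)"
  define P where "P v = S v - v" for v
  have S_lin: "bounded_clinear S" unfolding S_def by (intro R_clinear) simp
  have P_lin: "bounded_clinear P"
    using S_lin by (auto simp: P_def[abs_def] bounded_clinear_def scaleC_diff_right
        intro: bounded_linear_sub bounded_linear_ident)
  have "norm (P (P z)) \<le> 0"
  proof (rule norm_le_if_functionals_le)
    fix \<psi> :: "'a \<Rightarrow> complex" assume \<psi>: "unit_functional \<psi>"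
    note \<psi>_lin = unit_functional_linear[OF \<psi>]
    have "bounded_clinear (\<lambda>v. \<psi> (P (P v)))"
      using P_lin \<psi>_lin by (auto simp: bounded_clinear_def intro!: bounded_linear_compose[of \<psi>] bounded_linear_compose[of P])
    from lim[OF this] have 1: "((\<lambda>\<alpha>. \<psi> (P (P (D \<alpha> \<beta> x)))) \<longlongrightarrow> \<psi> (P (P z))) G" .
    have "((\<lambda>\<alpha>. (of_real \<alpha>)\<^sup>2 *\<^sub>C D \<alpha> \<beta> x - (2 * of_real \<alpha>) *\<^sub>C x) \<longlongrightarrow> 0 - (2 * of_real 0) *\<^sub>C x) (at_right 0)"
    proof (intro tendsto_diff tendsto_scaleC tendsto_intros)
      show "((\<lambda>\<alpha>. (of_real \<alpha>)\<^sup>2 *\<^sub>C D \<alpha> \<beta> x) \<longlongrightarrow> 0) (at_right 0)"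
      proof (rule Lim_null_comparison)
        show "\<forall>\<^sub>F \<alpha> in at_right 0. norm ((of_real \<alpha>)\<^sup>2 *\<^sub>C D \<alpha> \<beta> x) \<le> \<alpha>\<^sup>2 * C"
          using C by (auto simp: eventually_at_filter norm_scaleC norm_power intro!: mult_left_mono)
        have "((\<lambda>\<alpha>. \<alpha>\<^sup>2 * C) \<longlongrightarrow> 0\<^sup>2 * C) (at_right 0)" by (intro tendsto_intros)
        then show "((\<lambda>\<alpha>. \<alpha>\<^sup>2 * C) \<longlongrightarrow> 0) (at_right 0)" by simp
      qed
    qed
    then have "((\<lambda>\<alpha>. (of_real \<alpha>)\<^sup>2 *\<^sub>C D \<alpha> \<beta> x - (2 * of_real \<alpha>) *\<^sub>C x) \<longlongrightarrow> 0) (at_right 0)" by simp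
    from bounded_linear.tendsto[OF bounded_clinear_linear[OF \<psi>_lin]
        bounded_linear.tendsto[OF bounded_clinear_linear[OF S_lin]
        bounded_linear.tendsto[OF bounded_clinear_linear[OF S_lin] this]]]
    have "((\<lambda>\<alpha>. \<psi> (S (S ((of_real \<alpha>)\<^sup>2 *\<^sub>C D \<alpha> \<beta> x - (2 * of_real \<alpha>) *\<^sub>C x)))) \<longlongrightarrow> 0) (at_right 0)"
      by (simp add: bounded_clinear_0[OF S_lin] bounded_clinear_0[OF \<psi>_lin])
    then have "((\<lambda>\<alpha>. \<psi> (P (P (D \<alpha> \<beta> x)))) \<longlongrightarrow> 0) (at_right 0)"
    proof (rule Lim_transform_eventually)
      show "\<forall>\<^sub>F \<alpha> in at_right 0. \<psi> (S (S ((of_real \<alpha>)\<^sup>2 *\<^sub>C D \<alpha> \<beta> x - (2 * of_real \<alpha>) *\<^sub>C x))) = \<psi> (P (P (D \<alpha> \<beta> x)))"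
        unfolding P_def S_def by (auto simp: eventually_at_filter squared_generator_on_jump)
    qed
    then have "((\<lambda>\<alpha>. \<psi> (P (P (D \<alpha> \<beta> x)))) \<longlongrightarrow> 0) G" using G0 tendsto_mono by blast
    then have "\<psi> (P (P z)) = 0" using tendsto_unique[OF G(1) 1] by blast
    then show "Re (\<psi> (P (P z))) \<le> 0" by simp
  qed
  then have "P (P z) = 0" by simp
  then have "P z = 0" using resolvent_fixed_point_eq_0[OF ps, of \<beta> "P z"] by (simp add: P_def S_def)
  then have z: "z = 0" using resolvent_fixed_point_eq_0[OF ps, of \<beta> z] by (simp add: P_def S_def)
  have "e \<le> cmod (\<phi> z)"
  proof (rule tendsto_lowerbound[OF tendsto_norm[OF lim[OF unit_functional_linear[OF \<phi>]]] _ G(1)])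
    have "\<forall>\<^sub>F \<alpha> in F. e \<le> cmod (\<phi> (D \<alpha> \<beta> x))"
      by (simp add: F_def eventually_inf_principal)
    then show "\<forall>\<^sub>F \<alpha> in G. e \<le> cmod (\<phi> (D \<alpha> \<beta> x))" by (rule filter_leD[OF G(2)])
  qed
  then show False using e(1) by (simp add: z bounded_clinear_0[OF unit_functional_linear[OF \<phi>]])
qed

section \<open>Spectral subspaces\<close>

lemma spectral_subspace_iff:
  "x \<in> spectral_subspace (generator T) F \<longleftrightarrow> (\<forall>\<beta>. \<beta> \<notin> F \<longrightarrow> Complex 0 \<beta> \<notin> spec x)"
proof -
  have "spec x \<subseteq> (\<lambda>t. \<i> * of_real t) ` F \<longleftrightarrow> (\<forall>\<beta>. \<beta> \<notin> F \<longrightarrow> Complex 0 \<beta> \<notin> spec x)"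
  proof (intro iffI allI impI subsetI notI)
    fix \<beta> assume "spec x \<subseteq> (\<lambda>t. \<i> * of_real t) ` F" "\<beta> \<notin> F" "Complex 0 \<beta> \<in> spec x"
    then show False by (auto simp: complex_eq_iff)
  next
    fix \<mu> assume *: "\<forall>\<beta>. \<beta> \<notin> F \<longrightarrow> Complex 0 \<beta> \<notin> spec x" and \<mu>: "\<mu> \<in> spec x"
    have "Re \<mu> = 0" using off_axis_not_in_spec \<mu> by blast
    then have \<mu>_eq: "\<mu> = Complex 0 (Im \<mu>)" by (simp add: complex_eq_iff)
    then have "Im \<mu> \<in> F" using * \<mu> by metis
    then show "\<mu> \<in> (\<lambda>t. \<i> * of_real t) ` F"
      using \<mu>_eq by (intro image_eqI[of _ _ "Im \<mu>"]) (auto simp: complex_eq_iff)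
  qed
  then show ?thesis by (simp add: spectral_subspace_def)
qed

theorem spectral_subspace_eq_jump_vanishing:
  assumes F: "closed F"
  shows "spectral_subspace (generator T) F = {x. \<forall>\<beta>. \<beta> \<notin> F \<longrightarrow> ((\<lambda>\<alpha>. D \<alpha> \<beta> x) \<longlongrightarrow> 0) (at_right 0)}"
proof (intro set_eqI iffI)
  fix x assume "x \<in> spectral_subspace (generator T) F"
  then show "x \<in> {x. \<forall>\<beta>. \<beta> \<notin> F \<longrightarrow> ((\<lambda>\<alpha>. D \<alpha> \<beta> x) \<longlongrightarrow> 0) (at_right 0)}"
    using jump_tendsto_0 by (simp add: spectral_subspace_iff)
next
  fix x assume "x \<in> {x. \<forall>\<beta>. \<beta> \<notin> F \<longrightarrow> ((\<lambda>\<alpha>. D \<alpha> \<beta> x) \<longlongrightarrow> 0) (at_right 0)}"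
  then have lim: "((\<lambda>\<alpha>. D \<alpha> \<beta> x) \<longlongrightarrow> 0) (at_right 0)" if "\<beta> \<notin> F" for \<beta> using that by simp
  show "x \<in> spectral_subspace (generator T) F"
    unfolding spectral_subspace_iff
  proof (intro allI impI)
    fix \<beta> assume \<beta>: "\<beta> \<notin> F"
    show "Complex 0 \<beta> \<notin> spec x"
    proof (rule regular_if_jump_tame[OF F \<beta>])
      fix \<gamma> assume \<gamma>: "\<gamma> \<notin> F"
      show "\<exists>C. \<forall>\<alpha>. 0 < \<alpha> \<longrightarrow> \<alpha> \<le> 1 \<longrightarrow> norm (D \<alpha> \<gamma> x) \<le> C"
        using jump_bounded_if_tendsto[OF lim[OF \<gamma>]] by blast
      show "((\<lambda>\<alpha>. \<alpha> powr (2 - a) * norm (D \<alpha> \<gamma> x)) \<longlongrightarrow> 0) (at_right 0)"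
        by (rule scaled_jump_tendsto_if_tendsto[OF lim[OF \<gamma>]])
      show "((\<lambda>\<alpha>. \<phi> (D \<alpha> \<gamma> x)) \<longlongrightarrow> 0) (at_right 0)" if "unit_functional \<phi>" for \<phi>
        by (rule Lim_null_comparison[OF _ tendsto_norm_zero[OF lim[OF \<gamma>]]])
          (simp add: unit_functional_le[OF that])
    qed
  qed
qed

text \<open>
  Boundedness alone gives the smallness in cones because of the factor \<open>\<alpha>\<^sup>2\<^sup>-\<^sup>a\<close> with \<open>a < 2\<close>.
\<close>

theorem spectral_subspace_eq_jump_bounded:
  assumes F: "closed F" and refl: "reflexive_space TYPE('a)"
    and ps: "point_spectrum (generator T) = {}" and a: "a < 2"
  shows "spectral_subspace (generator T) F =
    {x. \<forall>\<beta>. \<beta> \<notin> F \<longrightarrow> bdd_above ((\<lambda>\<alpha>. norm (D \<alpha> \<beta> x)) ` {0<..})}"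
proof (intro set_eqI iffI)
  fix x assume "x \<in> spectral_subspace (generator T) F"
  then have "\<exists>C. \<forall>\<alpha>. 0 < \<alpha> \<longrightarrow> norm (D \<alpha> \<beta> x) \<le> C" if "\<beta> \<notin> F" for \<beta>
    using jump_bounded_if_tendsto[OF jump_tendsto_0] that by (simp add: spectral_subspace_iff)
  then have "bdd_above ((\<lambda>\<alpha>. norm (D \<alpha> \<beta> x)) ` {0<..})" if "\<beta> \<notin> F" for \<beta>
    using that by (metis bdd_aboveI2 greaterThan_iff)
  then show "x \<in> {x. \<forall>\<beta>. \<beta> \<notin> F \<longrightarrow> bdd_above ((\<lambda>\<alpha>. norm (D \<alpha> \<beta> x)) ` {0<..})}"
    by simp
next
  fix x assume *: "x \<in> {x. \<forall>\<beta>. \<beta> \<notin> F \<longrightarrow> bdd_above ((\<lambda>\<alpha>. norm (D \<alpha> \<beta> x)) ` {0<..})}"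
  have bdd: "\<exists>C. \<forall>\<alpha>. 0 < \<alpha> \<longrightarrow> norm (D \<alpha> \<beta> x) \<le> C" if "\<beta> \<notin> F" for \<beta>
  proof -
    have "bdd_above ((\<lambda>\<alpha>. norm (D \<alpha> \<beta> x)) ` {0<..})" using * that by simp
    then show ?thesis by (auto simp: bdd_above_def Ball_def)
  qed
  show "x \<in> spectral_subspace (generator T) F"
    unfolding spectral_subspace_iff
  proof (intro allI impI)
    fix \<beta> assume \<beta>: "\<beta> \<notin> F"
    show "Complex 0 \<beta> \<notin> spec x"
    proof (rule regular_if_jump_tame[OF F \<beta>])
      fix \<gamma> assume \<gamma>: "\<gamma> \<notin> F"
      obtain C where C: "\<And>\<alpha>. 0 < \<alpha> \<Longrightarrow> norm (D \<alpha> \<gamma> x) \<le> C" using bdd[OF \<gamma>] by blast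
      then show "\<exists>C. \<forall>\<alpha>. 0 < \<alpha> \<longrightarrow> \<alpha> \<le> 1 \<longrightarrow> norm (D \<alpha> \<gamma> x) \<le> C" by blast
      show "((\<lambda>\<alpha>. \<alpha> powr (2 - a) * norm (D \<alpha> \<gamma> x)) \<longlongrightarrow> 0) (at_right 0)"
        by (rule scaled_jump_tendsto_if_bounded[OF a C])
      show "((\<lambda>\<alpha>. \<phi> (D \<alpha> \<gamma> x)) \<longlongrightarrow> 0) (at_right 0)" if "unit_functional \<phi>" for \<phi>
        by (rule jump_weakly_tendsto_0[OF refl ps C that])
    qed
  qed
qed

end

theorem theorem1p5:
  fixes T :: "real \<Rightarrow> 'a::complex_banach \<Rightarrow> 'a"
    and A :: "'a \<rightharpoonup> 'a"
    and a :: real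
  assumes "C0_group T"
    and "A = generator T"
    and "0 \<le> a" and "a \<le> 2"
    and "\<exists>M. \<forall>t. onorm (T t) \<le> M * (1 + \<bar>t\<bar> powr a)"
  shows "(\<forall>F. closed F \<longrightarrow>
            spectral_subspace A F =
              {x. \<forall>\<beta>. \<beta> \<notin> F \<longrightarrow> ((\<lambda>\<alpha>. resolvent_jump A \<alpha> \<beta> x) \<longlongrightarrow> 0) (at_right 0)})
       \<and> (reflexive_space TYPE('a) \<and> point_spectrum A = {} \<and> a < 2 \<longrightarrow>
          (\<forall>F. closed F \<longrightarrow>
            spectral_subspace A F =
              {x. \<forall>\<beta>. \<beta> \<notin> F \<longrightarrow> bdd_above ((\<lambda>\<alpha>. norm (resolvent_jump A \<alpha> \<beta> x)) ` {0<..})}))"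
proof -
  obtain M where "\<And>t. onorm (T t) \<le> M * (1 + \<bar>t\<bar> powr a)" using assms(5) by blast
  then interpret polynomially_bounded_group T M a
    using assms by unfold_locales auto
  show ?thesis
    unfolding assms(2)
  proof (intro conjI impI allI)
    fix F :: "real set"
    assume "closed F"
    then show "spectral_subspace (generator T) F = {x. \<forall>\<beta>. \<beta> \<notin> F \<longrightarrow> ((\<lambda>\<alpha>. D \<alpha> \<beta> x) \<longlongrightarrow> 0) (at_right 0)}"
      by (rule spectral_subspace_eq_jump_vanishing)
  next
    fix F :: "real set"
    assume "reflexive_space TYPE('a) \<and> point_spectrum (generator T) = {} \<and> a < 2" "closed F"
    then show "spectral_subspace (generator T) F =
        {x. \<forall>\<beta>. \<beta> \<notin> F \<longrightarrow> bdd_above ((\<lambda>\<alpha>. norm (D \<alpha> \<beta> x)) ` {0<..})}"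
      by (intro spectral_subspace_eq_jump_bounded) auto
  qed
qed

end
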